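(* Let $l$ be a positive integer. For every $\alpha\in\mathbb{C}$ with $|\alpha|\ne1$, there are isomorphisms of $\mathcal{U}(\mathfrak{gl}_2)$-modules $$\mathcal{U}(\mathfrak{gl}_2)\cdot\det{}^{(\alpha)}(X)^l\cong(\mathrm{Sym}^l(\mathbb{C}^2))^{\otimes2}\cong\bigoplus_{s=0}^l\mathcal{M}_2^{(2l-s,s)} .$$ For $\alpha=\pm1$, $$\mathcal{U}(\mathfrak{gl}_2)\cdot\operatorname{per}(X)^l\cong\bigoplus_{j=0}^{\lfloor l/2\rfloor}\mathcal{M}_2^{(2l-2j,2j)}\cong\mathrm{Sym}^l(\mathrm{Sym}^2(\mathbb{C}^2)),$$ $$\mathcal{U}(\mathfrak{gl}_2)\cdot\det(X)^l=\mathbb{C}\cdot\det(X)^l\cong\mathcal{M}_2^{(l,l)} .$$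
   Context: $X=(x_{ij})_{1\le i,j\le2}$ is a matrix of variables; $\mathcal{U}(\mathfrak{gl}_2)$ acts on $\mathbb{C}[x_{11},x_{12},x_{21},x_{22}]$ by $E_{ij}\cdot f=\sum_{k=1}^2x_{ik}\,\partial f/\partial x_{jk}$, and $\mathcal{U}(\mathfrak{gl}_2)\cdot f$ is the submodule generated by $f$. The $\alpha$-determinant is $\det^{(\alpha)}(X)=x_{11}x_{22}+\alpha x_{21}x_{12}$; thus $\det^{(-1)}=\det$ and $\det^{(1)}=\operatorname{per}$ (the permanent). $\mathcal{M}_2^{\lambda}$ is the irreducible highest weight $\mathcal{U}(\mathfrak{gl}_2)$-module with highest weight $\lambda$. Symmetric and tensor powers of $\mathbb{C}^2$ carry the natural actions. *)

theory Defs
  imports "HOL-Analysis.Analysis" "HOL-Library.Poly_Mapping"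
begin

section \<open>The enveloping algebra of gl_2\<close>

text \<open>
  \<open>'b \<Rightarrow>\<^sub>0 complex\<close> is the complex vector space with basis \<open>'b\<close>. With lists as a monoid under
  concatenation, \<open>'a list \<Rightarrow>\<^sub>0 complex\<close> carries the convolution product and is the free
  associative unital algebra on \<open>'a\<close>.
\<close>

instantiation list :: (type) monoid_add
begin
definition zero_list :: "'a list" where "zero_list = []"
definition plus_list :: "'a list \<Rightarrow> 'a list \<Rightarrow> 'a list" where "plus_list xs ys = xs @ ys"
instance by standard (auto simp: zero_list_def plus_list_def)
end

type_synonym free_alg = "(2 \<times> 2) list \<Rightarrow>\<^sub>0 complex"

definition fgen :: "2 \<Rightarrow> 2 \<Rightarrow> free_alg" where
  "fgen i j = Poly_Mapping.single [(i, j)] 1"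

text \<open>The two-sided ideal generated by \<open>E\<^sub>i\<^sub>j E\<^sub>k\<^sub>l - E\<^sub>k\<^sub>l E\<^sub>i\<^sub>j - [E\<^sub>i\<^sub>j, E\<^sub>k\<^sub>l]\<close>, where
  \<open>[E\<^sub>i\<^sub>j, E\<^sub>k\<^sub>l] = \<delta>\<^sub>j\<^sub>k E\<^sub>i\<^sub>l - \<delta>\<^sub>l\<^sub>i E\<^sub>k\<^sub>j\<close>.\<close>

inductive_set gl2_ideal :: "free_alg set" where
  rel: "fgen i j * fgen k l - fgen k l * fgen i j
          - ((if j = k then fgen i l else 0) - (if l = i then fgen k j else 0)) \<in> gl2_ideal"
| zero: "0 \<in> gl2_ideal"
| add: "a \<in> gl2_ideal \<Longrightarrow> b \<in> gl2_ideal \<Longrightarrow> a + b \<in> gl2_ideal"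
| left: "a \<in> gl2_ideal \<Longrightarrow> b * a \<in> gl2_ideal"
| right: "a \<in> gl2_ideal \<Longrightarrow> a * b \<in> gl2_ideal"

lemma gl2_ideal_uminus: "a \<in> gl2_ideal \<Longrightarrow> - a \<in> gl2_ideal"
  using gl2_ideal.left[of a "- 1"] by simp

definition gl2_cong :: "free_alg \<Rightarrow> free_alg \<Rightarrow> bool" where
  "gl2_cong a b \<longleftrightarrow> a - b \<in> gl2_ideal"

lemma equivp_gl2_cong: "equivp gl2_cong"
proof (rule equivpI)
  show "reflp gl2_cong"
    by (auto simp: reflp_def gl2_cong_def intro: gl2_ideal.zero)
  show "symp gl2_cong"
    unfolding symp_def gl2_cong_def using gl2_ideal_uminus by fastforce
  show "transp gl2_cong"
    unfolding transp_def gl2_cong_def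
  proof (intro allI impI)
    fix x y z assume "x - y \<in> gl2_ideal" "y - z \<in> gl2_ideal"
    then show "x - z \<in> gl2_ideal" using gl2_ideal.add[of "x - y" "y - z"] by simp
  qed
qed

quotient_type Ugl2 = free_alg / gl2_cong
  by (rule equivp_gl2_cong)

instantiation Ugl2 :: ring_1
begin

lift_definition zero_Ugl2 :: Ugl2 is 0 .
lift_definition one_Ugl2 :: Ugl2 is 1 .

lift_definition plus_Ugl2 :: "Ugl2 \<Rightarrow> Ugl2 \<Rightarrow> Ugl2" is "(+)"
proof -
  fix a b c d assume "gl2_cong a b" "gl2_cong c d"
  then show "gl2_cong (a + c) (b + d)"
    unfolding gl2_cong_def using gl2_ideal.add[of "a - b" "c - d"] by (simp add: algebra_simps)
qed

lift_definition uminus_Ugl2 :: "Ugl2 \<Rightarrow> Ugl2" is uminus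
  unfolding gl2_cong_def using gl2_ideal_uminus by fastforce

lift_definition minus_Ugl2 :: "Ugl2 \<Rightarrow> Ugl2 \<Rightarrow> Ugl2" is "(-)"
proof -
  fix a b c d assume "gl2_cong a b" "gl2_cong c d"
  then show "gl2_cong (a - c) (b - d)"
    unfolding gl2_cong_def using gl2_ideal.add[of "a - b" "- (c - d)"] gl2_ideal_uminus[of "c - d"]
    by (simp add: algebra_simps)
qed

lift_definition times_Ugl2 :: "Ugl2 \<Rightarrow> Ugl2 \<Rightarrow> Ugl2" is "(*)"
proof -
  fix a b c d assume "gl2_cong a b" "gl2_cong c d"
  then have "(a - b) * c + b * (c - d) \<in> gl2_ideal"
    unfolding gl2_cong_def by (intro gl2_ideal.add gl2_ideal.right gl2_ideal.left)
  then show "gl2_cong (a * c) (b * d)"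
    unfolding gl2_cong_def by (simp add: algebra_simps)
qed

lemma one_notin_gl2_ideal: "1 \<notin> gl2_ideal"
proof -
  \<comment> \<open>every element of the ideal has constant term 0\<close>
  have mult0: "Poly_Mapping.lookup (a * b) [] = Poly_Mapping.lookup a [] * Poly_Mapping.lookup b []"
    for a b :: free_alg
  proof -
    have "Poly_Mapping.lookup (a * b) [] = Sum_any (\<lambda>l. Poly_Mapping.lookup a l * Sum_any (\<lambda>q. Poly_Mapping.lookup b q when l = [] \<and> q = []))"
      unfolding lookup_mult by (simp add: plus_list_def eq_commute[of "[]"])
    also have "\<dots> = Sum_any (\<lambda>l. (Poly_Mapping.lookup a l * Poly_Mapping.lookup b []) when l = [])"
      by (intro Sum_any.cong) (simp add: when_def)
    also have "\<dots> = Poly_Mapping.lookup a [] * Poly_Mapping.lookup b []" by simp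
    finally show ?thesis .
  qed
  have "Poly_Mapping.lookup a [] = 0" if "a \<in> gl2_ideal" for a
    using that
    by induction (auto simp: mult0 lookup_add lookup_minus fgen_def lookup_single)
  then show ?thesis by (metis lookup_one when_simps(1) zero_list_def zero_neq_one)
qed

instance
proof
  fix a b c :: Ugl2
  show "a + b + c = a + (b + c)" "a + b = b + a" "0 + a = a" "- a + a = 0" "a - b = a + - b"
    "a * b * c = a * (b * c)" "1 * a = a" "a * 1 = a"
    "(a + b) * c = a * c + b * c" "a * (b + c) = a * b + a * c"
    by (transfer; simp add: algebra_simps gl2_cong_def gl2_ideal.zero)+
  show "(0::Ugl2) \<noteq> 1"
    using gl2_ideal_uminus[of "- 1"] one_notin_gl2_ideal
    unfolding zero_Ugl2_def one_Ugl2_def map_fun_def id_def by (auto simp: Ugl2.abs_eq_iff gl2_cong_def)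
qed

end

lift_definition gen :: "2 \<Rightarrow> 2 \<Rightarrow> Ugl2" is fgen .

lift_definition Uconst :: "complex \<Rightarrow> Ugl2" is "\<lambda>c. Poly_Mapping.single [] c" .

lemma gen_commutator:
  "gen i j * gen k l - gen k l * gen i j
     = (if j = k then gen i l else 0) - (if l = i then gen k j else 0)"
proof -
  have *: "(if P then gen a b else 0) = abs_Ugl2 (if P then fgen a b else 0)" for P a b
    by (simp add: gen.abs_eq zero_Ugl2.abs_eq)
  show ?thesis
    unfolding * unfolding gen.abs_eq times_Ugl2.abs_eq minus_Ugl2.abs_eq Ugl2.abs_eq_iff gl2_cong_def
    by (rule gl2_ideal.rel)
qed


section \<open>Left modules\<close>

text \<open>
  A left module over a (not necessarily commutative) ring lives on a subset of an additive group
  type. The complex vector space structure of a \<open>Ugl2\<close>-module is the action of the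
  constants \<open>Uconst c\<close>.
\<close>

record ('r, 'v) lmod =
  mcarrier :: "'v set"
  mact :: "'r \<Rightarrow> 'v \<Rightarrow> 'v"

definition left_module :: "('r::ring_1, 'v::ab_group_add) lmod \<Rightarrow> bool" where
  "left_module M \<longleftrightarrow>
     0 \<in> mcarrier M \<and>
     (\<forall>v \<in> mcarrier M. \<forall>w \<in> mcarrier M. v + w \<in> mcarrier M) \<and>
     (\<forall>v \<in> mcarrier M. - v \<in> mcarrier M) \<and>
     (\<forall>r. \<forall>v \<in> mcarrier M. mact M r v \<in> mcarrier M) \<and>
     (\<forall>r. \<forall>v \<in> mcarrier M. \<forall>w \<in> mcarrier M. mact M r (v + w) = mact M r v + mact M r w) \<and>
     (\<forall>r s. \<forall>v \<in> mcarrier M. mact M (r + s) v = mact M r v + mact M s v) \<and>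
     (\<forall>r s. \<forall>v \<in> mcarrier M. mact M (r * s) v = mact M r (mact M s v)) \<and>
     (\<forall>v \<in> mcarrier M. mact M 1 v = v)"

definition submodule :: "'v set \<Rightarrow> ('r::ring_1, 'v::ab_group_add) lmod \<Rightarrow> bool" where
  "submodule N M \<longleftrightarrow> N \<subseteq> mcarrier M \<and> left_module (M\<lparr>mcarrier := N\<rparr>)"

definition cyclic :: "('r::ring_1, 'v::ab_group_add) lmod \<Rightarrow> 'v \<Rightarrow> ('r, 'v) lmod" where
  "cyclic M f = M\<lparr>mcarrier := {mact M u f | u. True}\<rparr>"

definition irreducible_module :: "('r::ring_1, 'v::ab_group_add) lmod \<Rightarrow> bool" where
  "irreducible_module M \<longleftrightarrow> left_module M \<and> mcarrier M \<noteq> {0} \<and>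
     (\<forall>N. submodule N M \<longrightarrow> N = {0} \<or> N = mcarrier M)"

definition lmod_iso ::
  "('r::ring_1, 'v::ab_group_add) lmod \<Rightarrow> ('r, 'w::ab_group_add) lmod \<Rightarrow> bool" (infix "\<cong>\<^sub>U" 50) where
  "M \<cong>\<^sub>U N \<longleftrightarrow> left_module M \<and> left_module N \<and>
     (\<exists>\<phi>. bij_betw \<phi> (mcarrier M) (mcarrier N) \<and>
        (\<forall>v \<in> mcarrier M. \<forall>w \<in> mcarrier M. \<phi> (v + w) = \<phi> v + \<phi> w) \<and>
        (\<forall>r. \<forall>v \<in> mcarrier M. \<phi> (mact M r v) = mact N r (\<phi> v)))"

definition direct_sum ::
  "'i set \<Rightarrow> ('i \<Rightarrow> ('r::ring_1, 'v::ab_group_add) lmod) \<Rightarrow> ('r, 'i \<Rightarrow>\<^sub>0 'v) lmod" where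
  "direct_sum I M =
     \<lparr>mcarrier = {f. Poly_Mapping.keys f \<subseteq> I \<and> (\<forall>i \<in> I. Poly_Mapping.lookup f i \<in> mcarrier (M i))},
      mact = (\<lambda>r. Poly_Mapping.mapp (\<lambda>i. mact (M i) r))\<rparr>"

definition highest_weight_module ::
  "complex \<Rightarrow> complex \<Rightarrow> (Ugl2, 'v::ab_group_add) lmod \<Rightarrow> bool" where
  "highest_weight_module \<mu>\<^sub>1 \<mu>\<^sub>2 M \<longleftrightarrow> left_module M \<and>
     (\<exists>v \<in> mcarrier M. v \<noteq> 0 \<and>
        mact M (gen 1 2) v = 0 \<and>
        mact M (gen 1 1) v = mact M (Uconst \<mu>\<^sub>1) v \<and>
        mact M (gen 2 2) v = mact M (Uconst \<mu>\<^sub>2) v \<and>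
        mcarrier (cyclic M v) = mcarrier M)"

definition irreducible_highest_weight_module ::
  "complex \<Rightarrow> complex \<Rightarrow> (Ugl2, 'v::ab_group_add) lmod \<Rightarrow> bool" where
  "irreducible_highest_weight_module \<mu>\<^sub>1 \<mu>\<^sub>2 M \<longleftrightarrow>
     irreducible_module M \<and> highest_weight_module \<mu>\<^sub>1 \<mu>\<^sub>2 M"


section \<open>Representations of gl_2 in coordinates\<close>

definition pscale :: "complex \<Rightarrow> ('b \<Rightarrow>\<^sub>0 complex) \<Rightarrow> ('b \<Rightarrow>\<^sub>0 complex)" where
  "pscale c = Poly_Mapping.map ((*) c)"

text \<open>The linear map with values \<open>g b\<close> on the basis vectors \<open>b\<close>.\<close>

definition lin_ext :: "('b \<Rightarrow> ('c \<Rightarrow>\<^sub>0 complex)) \<Rightarrow> ('b \<Rightarrow>\<^sub>0 complex) \<Rightarrow> ('c \<Rightarrow>\<^sub>0 complex)" where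
  "lin_ext g f = (\<Sum>b \<in> Poly_Mapping.keys f. pscale (Poly_Mapping.lookup f b) (g b))"

abbreviation basis_vec :: "'b \<Rightarrow> ('b \<Rightarrow>\<^sub>0 complex)" where
  "basis_vec b \<equiv> Poly_Mapping.single b 1"

definition span_of :: "'b set \<Rightarrow> ('b \<Rightarrow>\<^sub>0 complex) set" where
  "span_of B = {f. Poly_Mapping.keys f \<subseteq> B}"

text \<open>
  A representation of \<open>gl\<^sub>2\<close> on the space with basis \<open>B\<close>, given by the operators
  \<open>E\<^sub>i\<^sub>j\<close>: the operators are linear, preserve the space and satisfy the commutation relations.
\<close>

type_synonym 'b rep = "'b set \<times> (2 \<Rightarrow> 2 \<Rightarrow> ('b \<Rightarrow>\<^sub>0 complex) \<Rightarrow> ('b \<Rightarrow>\<^sub>0 complex))"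

definition is_rep :: "'b rep \<Rightarrow> bool" where
  "is_rep V \<longleftrightarrow> (case V of (B, \<rho>) \<Rightarrow>
     (\<forall>i j. \<forall>v \<in> span_of B. \<rho> i j v \<in> span_of B) \<and>
     (\<forall>i j. \<forall>v \<in> span_of B. \<forall>w \<in> span_of B. \<rho> i j (v + w) = \<rho> i j v + \<rho> i j w) \<and>
     (\<forall>i j c. \<forall>v \<in> span_of B. \<rho> i j (pscale c v) = pscale c (\<rho> i j v)) \<and>
     (\<forall>i j k l. \<forall>v \<in> span_of B. \<rho> i j (\<rho> k l v) - \<rho> k l (\<rho> i j v)
        = (if j = k then \<rho> i l v else 0) - (if l = i then \<rho> k j v else 0)))"

text \<open>
  Extension of operators \<open>E\<^sub>i\<^sub>j\<close> to an action of \<open>Ugl2\<close>: a word acts by composition, and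
  an element of \<open>Ugl2\<close> through a representative in the free algebra. On a representation the
  choice of representative does not matter (\<open>U_action_abs\<close> below).
\<close>

definition free_action ::
  "(2 \<Rightarrow> 2 \<Rightarrow> ('b \<Rightarrow>\<^sub>0 complex) \<Rightarrow> ('b \<Rightarrow>\<^sub>0 complex)) \<Rightarrow> free_alg \<Rightarrow> ('b \<Rightarrow>\<^sub>0 complex) \<Rightarrow> ('b \<Rightarrow>\<^sub>0 complex)" where
  "free_action \<rho> a v = lin_ext (\<lambda>w. foldr (\<lambda>(i, j). \<rho> i j) w v) a"

definition U_action ::
  "(2 \<Rightarrow> 2 \<Rightarrow> ('b \<Rightarrow>\<^sub>0 complex) \<Rightarrow> ('b \<Rightarrow>\<^sub>0 complex)) \<Rightarrow> Ugl2 \<Rightarrow> ('b \<Rightarrow>\<^sub>0 complex) \<Rightarrow> ('b \<Rightarrow>\<^sub>0 complex)" where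
  "U_action \<rho> u = free_action \<rho> (rep_Ugl2 u)"

definition module_of :: "'b rep \<Rightarrow> (Ugl2, 'b \<Rightarrow>\<^sub>0 complex) lmod" where
  "module_of V = \<lparr>mcarrier = span_of (fst V), mact = U_action (snd V)\<rparr>"


lemma lookup_pscale [simp]: "Poly_Mapping.lookup (pscale c f) b = c * Poly_Mapping.lookup f b"
  by (simp add: pscale_def Poly_Mapping.map.rep_eq when_def)

lemma pscale_simps [simp]:
  "pscale c 0 = 0" "pscale 0 v = 0" "pscale 1 v = v" "pscale c (pscale d v) = pscale (c * d) v"
  "pscale c (v + w) = pscale c v + pscale c w" "pscale c (v - w) = pscale c v - pscale c w"
  "pscale c (- v) = - pscale c v" "pscale c (Poly_Mapping.single b d) = Poly_Mapping.single b (c * d)"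
  by (auto intro!: poly_mapping_eqI simp: lookup_add lookup_minus algebra_simps lookup_single when_def)

lemma pscale_add_left: "pscale (c + d) v = pscale c v + pscale d v"
  by (auto intro!: poly_mapping_eqI simp: lookup_add algebra_simps)

lemma lin_ext_superset:
  assumes "finite A" "Poly_Mapping.keys f \<subseteq> A"
  shows "lin_ext g f = (\<Sum>b \<in> A. pscale (Poly_Mapping.lookup f b) (g b))"
  unfolding lin_ext_def using assms
  by (intro sum.mono_neutral_left) (auto simp: in_keys_iff)

lemma pscale_sum: "pscale c (sum h A) = (\<Sum>b \<in> A. pscale c (h b))"
  by (induction A rule: infinite_finite_induct) auto

lemma lin_ext_zero [simp]: "lin_ext g 0 = 0"
  by (simp add: lin_ext_def)

lemma lin_ext_add: "lin_ext g (f + h) = lin_ext g f + lin_ext g h"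
proof -
  let ?A = "Poly_Mapping.keys f \<union> Poly_Mapping.keys h"
  have "lin_ext g (f + h) = (\<Sum>b \<in> ?A. pscale (Poly_Mapping.lookup (f + h) b) (g b))"
    by (rule lin_ext_superset) (auto dest: set_mp[OF keys_add])
  also have "\<dots> = (\<Sum>b \<in> ?A. pscale (Poly_Mapping.lookup f b) (g b))
                  + (\<Sum>b \<in> ?A. pscale (Poly_Mapping.lookup h b) (g b))"
    by (simp add: lookup_add pscale_add_left sum.distrib)
  also have "\<dots> = lin_ext g f + lin_ext g h"
    by (simp add: lin_ext_superset[of ?A f] lin_ext_superset[of ?A h])
  finally show ?thesis .
qed

lemma lin_ext_pscale: "lin_ext g (pscale c f) = pscale c (lin_ext g f)"
proof -
  have "lin_ext g (pscale c f)
      = (\<Sum>b \<in> Poly_Mapping.keys f. pscale (Poly_Mapping.lookup (pscale c f) b) (g b))"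
    by (rule lin_ext_superset) (auto simp: in_keys_iff)
  then show ?thesis by (simp add: lin_ext_def pscale_sum)
qed

lemma lin_ext_single [simp]: "lin_ext g (Poly_Mapping.single b c) = pscale c (g b)"
  by (simp add: lin_ext_def)

lemma lin_ext_uminus: "lin_ext g (- f) = - lin_ext g f"
  using lin_ext_add[of g f "- f"] by (simp add: minus_unique)

lemma lin_ext_minus: "lin_ext g (f - h) = lin_ext g f - lin_ext g h"
  using lin_ext_add[of g f "- h"] by (simp add: lin_ext_uminus)

lemma poly_mapping_linear_induct [case_names zero single add]:
  fixes f :: "'b \<Rightarrow>\<^sub>0 complex"
  assumes "P 0" and "\<And>b c. P (Poly_Mapping.single b c)" and "\<And>f g. P f \<Longrightarrow> P g \<Longrightarrow> P (f + g)"
  shows "P f"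
proof -
  have "P (\<Sum>b \<in> A. Poly_Mapping.single b (Poly_Mapping.lookup f b))" if "finite A" for A
    using that by (induction A) (auto intro: assms)
  moreover have "(\<Sum>b \<in> Poly_Mapping.keys f. Poly_Mapping.single b (Poly_Mapping.lookup f b)) = f"
    by (rule poly_mapping_eqI) (auto simp: lookup_sum lookup_single when_def in_keys_iff sum.delta)
  ultimately show ?thesis by (metis finite_keys)
qed

lemma span_of_zero [simp]: "0 \<in> span_of B"
  by (simp add: span_of_def)

lemma span_of_add: "v \<in> span_of B \<Longrightarrow> w \<in> span_of B \<Longrightarrow> v + w \<in> span_of B"
  using keys_add[of v w] by (auto simp: span_of_def)

lemma span_of_pscale: "v \<in> span_of B \<Longrightarrow> pscale c v \<in> span_of B"
  by (auto simp: span_of_def in_keys_iff)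

lemma span_of_uminus: "v \<in> span_of B \<Longrightarrow> - v \<in> span_of B"
  by (auto simp: span_of_def in_keys_iff)

lemma span_of_sum: "(\<And>b. b \<in> A \<Longrightarrow> h b \<in> span_of B) \<Longrightarrow> sum h A \<in> span_of B"
  by (induction A rule: infinite_finite_induct) (auto intro: span_of_add)

lemma span_of_lin_ext: "(\<And>b. b \<in> Poly_Mapping.keys f \<Longrightarrow> g b \<in> span_of B) \<Longrightarrow> lin_ext g f \<in> span_of B"
  unfolding lin_ext_def by (auto intro: span_of_sum span_of_pscale)

context
  fixes B :: "'b set" and \<rho> :: "2 \<Rightarrow> 2 \<Rightarrow> ('b \<Rightarrow>\<^sub>0 complex) \<Rightarrow> ('b \<Rightarrow>\<^sub>0 complex)"
  assumes rep: "is_rep (B, \<rho>)"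
begin

abbreviation (input) "word_act w v \<equiv> foldr (\<lambda>(i, j). \<rho> i j) w v"

lemma rep_span: "v \<in> span_of B \<Longrightarrow> \<rho> i j v \<in> span_of B"
  and rep_add: "v \<in> span_of B \<Longrightarrow> w \<in> span_of B \<Longrightarrow> \<rho> i j (v + w) = \<rho> i j v + \<rho> i j w"
  and rep_pscale: "v \<in> span_of B \<Longrightarrow> \<rho> i j (pscale c v) = pscale c (\<rho> i j v)"
  and rep_commutator: "v \<in> span_of B \<Longrightarrow> \<rho> i j (\<rho> k l v) - \<rho> k l (\<rho> i j v)
        = (if j = k then \<rho> i l v else 0) - (if l = i then \<rho> k j v else 0)"
  using rep by (auto simp: is_rep_def)

lemma word_act_span: "v \<in> span_of B \<Longrightarrow> word_act w v \<in> span_of B"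
  by (induction w) (auto intro: rep_span)

lemma word_act_add: "v \<in> span_of B \<Longrightarrow> v' \<in> span_of B \<Longrightarrow> word_act w (v + v') = word_act w v + word_act w v'"
  by (induction w) (auto simp: rep_add word_act_span)

lemma word_act_pscale: "v \<in> span_of B \<Longrightarrow> word_act w (pscale c v) = pscale c (word_act w v)"
  by (induction w) (auto simp: rep_pscale word_act_span)

lemma free_action_span: "v \<in> span_of B \<Longrightarrow> free_action \<rho> a v \<in> span_of B"
  unfolding free_action_def by (intro span_of_lin_ext word_act_span)

lemma free_action_zero: "free_action \<rho> 0 v = 0"
  by (simp add: free_action_def)

lemma free_action_add: "free_action \<rho> (a + b) v = free_action \<rho> a v + free_action \<rho> b v"
  by (simp add: free_action_def lin_ext_add)

lemma free_action_minus: "free_action \<rho> (a - b) v = free_action \<rho> a v - free_action \<rho> b v"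
  by (simp add: free_action_def lin_ext_minus)

lemma free_action_add_right:
  "v \<in> span_of B \<Longrightarrow> w \<in> span_of B \<Longrightarrow> free_action \<rho> a (v + w) = free_action \<rho> a v + free_action \<rho> a w"
  by (simp add: free_action_def lin_ext_def word_act_add sum.distrib)

lemma free_action_pscale:
  "v \<in> span_of B \<Longrightarrow> free_action \<rho> a (pscale c v) = pscale c (free_action \<rho> a v)"
  by (simp add: free_action_def lin_ext_def word_act_pscale pscale_sum mult.commute)

lemma free_action_zero_right: "free_action \<rho> a 0 = 0"
  using free_action_add_right[of 0 0 a] by simp

lemma free_action_mult:
  assumes "v \<in> span_of B"
  shows "free_action \<rho> (a * b) v = free_action \<rho> a (free_action \<rho> b v)"
proof (induction a rule: poly_mapping_linear_induct)
  case zero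
  then show ?case by (simp add: free_action_zero)
next
  case (single w c)
  show ?case
  proof (induction b rule: poly_mapping_linear_induct)
    case zero
    then show ?case by (simp add: free_action_zero free_action_zero_right)
  next
    case (single w' d)
    show ?case using assms
      by (simp add: mult_single free_action_def plus_list_def word_act_pscale word_act_span)
  next
    case (add f g)
    then show ?case
      by (simp add: ring_distribs free_action_add free_action_add_right free_action_span assms)
  qed
next
  case (add f g)
  then show ?case by (simp add: ring_distribs free_action_add)
qed

lemma free_action_fgen: "free_action \<rho> (fgen i j) v = \<rho> i j v"
  by (simp add: free_action_def fgen_def)

lemma free_action_ideal: "a \<in> gl2_ideal \<Longrightarrow> v \<in> span_of B \<Longrightarrow> free_action \<rho> a v = 0"
proof (induction arbitrary: v rule: gl2_ideal.induct)
  case (rel i j k l)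
  then show ?case using rep_commutator[of v i j k l]
    by (simp add: free_action_minus free_action_mult free_action_fgen free_action_zero
          split: if_splits)
next
  case zero
  then show ?case by (simp add: free_action_zero)
next
  case (add a b)
  then show ?case by (simp add: free_action_add)
next
  case (left a b)
  then show ?case by (simp add: free_action_mult free_action_zero_right)
next
  case (right a b)
  then show ?case by (simp add: free_action_mult free_action_span)
qed

lemma U_action_abs:
  assumes "v \<in> span_of B"
  shows "U_action \<rho> (abs_Ugl2 a) v = free_action \<rho> a v"
proof -
  have "gl2_cong (rep_Ugl2 (abs_Ugl2 a)) a"
    by (metis Ugl2.abs_eq_iff Quotient3_Ugl2 Quotient3_abs_rep)
  then have "free_action \<rho> (rep_Ugl2 (abs_Ugl2 a) - a) v = 0"
    unfolding gl2_cong_def using assms by (rule free_action_ideal)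
  then show ?thesis by (simp add: U_action_def free_action_minus)
qed

lemma U_action_gen: "v \<in> span_of B \<Longrightarrow> U_action \<rho> (gen i j) v = \<rho> i j v"
  by (simp add: gen.abs_eq U_action_abs free_action_fgen)

lemma U_action_Uconst: "v \<in> span_of B \<Longrightarrow> U_action \<rho> (Uconst c) v = pscale c v"
  by (simp add: Uconst.abs_eq U_action_abs) (simp add: free_action_def)

lemma left_module_module_of: "left_module (module_of (B, \<rho>))"
proof -
  have *: "\<exists>a. u = abs_Ugl2 a" for u
    by (metis Quotient3_Ugl2 Quotient3_abs_rep)
  have "U_action \<rho> u v \<in> span_of B" "U_action \<rho> u (v + w) = U_action \<rho> u v + U_action \<rho> u w"
    "U_action \<rho> (u + u') v = U_action \<rho> u v + U_action \<rho> u' v"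
    "U_action \<rho> (u * u') v = U_action \<rho> u (U_action \<rho> u' v)"
    "U_action \<rho> 1 v = v"
    if "v \<in> span_of B" "w \<in> span_of B" for u u' v w
  proof -
    obtain a b where ab: "u = abs_Ugl2 a" "u' = abs_Ugl2 b" using * by blast
    show "U_action \<rho> u v \<in> span_of B" "U_action \<rho> u (v + w) = U_action \<rho> u v + U_action \<rho> u w"
      "U_action \<rho> (u + u') v = U_action \<rho> u v + U_action \<rho> u' v"
      "U_action \<rho> (u * u') v = U_action \<rho> u (U_action \<rho> u' v)"
      using that unfolding ab
      by (simp_all add: U_action_abs span_of_add free_action_span free_action_add_right
           plus_Ugl2.abs_eq times_Ugl2.abs_eq free_action_add free_action_mult)
    have one: "(1 :: free_alg) = Poly_Mapping.single [] 1"
      by (metis single_one zero_list_def)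
    show "U_action \<rho> 1 v = v"
      using that by (simp add: one_Ugl2.abs_eq U_action_abs) (simp add: free_action_def one)
  qed
  then show ?thesis
    unfolding left_module_def module_of_def by (auto intro: span_of_add span_of_uminus)
qed

end


section \<open>Polynomials\<close>

text \<open>Polynomials in the variables \<open>'v\<close>: a monomial is its exponent vector \<open>'v \<Rightarrow>\<^sub>0 nat\<close>.\<close>

type_synonym 'v cpoly = "('v \<Rightarrow>\<^sub>0 nat) \<Rightarrow>\<^sub>0 complex"

definition var :: "'v \<Rightarrow> 'v cpoly" where
  "var x = Poly_Mapping.single (Poly_Mapping.single x 1) 1"

definition const :: "complex \<Rightarrow> 'v cpoly" where
  "const c = Poly_Mapping.single 0 c"

definition pderivative :: "'v \<Rightarrow> 'v cpoly \<Rightarrow> 'v cpoly" where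
  "pderivative x = lin_ext (\<lambda>m. Poly_Mapping.single (m - Poly_Mapping.single x 1)
                                   (of_nat (Poly_Mapping.lookup m x)))"

definition mono_degree :: "('v \<Rightarrow>\<^sub>0 nat) \<Rightarrow> nat" where
  "mono_degree m = (\<Sum>x \<in> Poly_Mapping.keys m. Poly_Mapping.lookup m x)"

definition vars :: "'v cpoly \<Rightarrow> 'v set" where
  "vars f = (\<Union>m \<in> Poly_Mapping.keys f. Poly_Mapping.keys m)"


section \<open>The natural representation, tensor products and symmetric powers\<close>

definition natural_rep :: "2 rep" where
  "natural_rep = (UNIV, \<lambda>i j v. Poly_Mapping.single i (Poly_Mapping.lookup v j))"

definition tensor_vec :: "('a \<Rightarrow>\<^sub>0 complex) \<Rightarrow> ('b \<Rightarrow>\<^sub>0 complex) \<Rightarrow> ('a \<times> 'b \<Rightarrow>\<^sub>0 complex)" where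
  "tensor_vec v w = lin_ext (\<lambda>a. lin_ext (\<lambda>b. basis_vec (a, b)) w) v"

text \<open>\<open>E\<^sub>i\<^sub>j (v \<otimes> w) = E\<^sub>i\<^sub>j v \<otimes> w + v \<otimes> E\<^sub>i\<^sub>j w\<close>, on the space with basis
  \<open>a \<otimes> b\<close> for \<open>a \<in> A\<close>, \<open>b \<in> B\<close>.\<close>

definition tensor_rep :: "'a rep \<Rightarrow> 'b rep \<Rightarrow> ('a \<times> 'b) rep" where
  "tensor_rep V W =
     (fst V \<times> fst W,
      \<lambda>i j. lin_ext (\<lambda>(a, b). tensor_vec (snd V i j (basis_vec a)) (basis_vec b)
                             + tensor_vec (basis_vec a) (snd W i j (basis_vec b))))"

text \<open>
  \<open>Sym\<^sup>l(V)\<close> is the degree \<open>l\<close> part of the symmetric algebra of \<open>V\<close>, the polynomial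
  algebra on a basis \<open>B\<close> of \<open>V\<close>; \<open>E\<^sub>i\<^sub>j\<close> acts by the derivation
  \<open>f \<mapsto> \<Sum>\<^sub>b (E\<^sub>i\<^sub>j b) \<partial>f/\<partial>b\<close> extending its action on the linear forms \<open>V\<close>.
\<close>

definition sym_rep :: "nat \<Rightarrow> 'b rep \<Rightarrow> ('b \<Rightarrow>\<^sub>0 nat) rep" where
  "sym_rep l V =
     ({m. Poly_Mapping.keys m \<subseteq> fst V \<and> mono_degree m = l},
      \<lambda>i j f. \<Sum>b \<in> vars f. lin_ext var (snd V i j (basis_vec b)) * pderivative b f)"


section \<open>The polynomial representation and the alpha-determinant\<close>

text \<open>The variable \<open>x\<^sub>i\<^sub>j\<close> is indexed by \<open>(i, j) :: 2 \<times> 2\<close>; in the type \<open>2\<close> the second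
  element is written \<open>2\<close> and equals \<open>0\<close>.\<close>

definition X :: "(2 \<times> 2) cpoly ^ 2 ^ 2" where
  "X = (\<chi> i j. var (i, j))"

definition poly_rep :: "((2 \<times> 2) \<Rightarrow>\<^sub>0 nat) rep" where
  "poly_rep = (UNIV, \<lambda>i j f. \<Sum>k \<in> UNIV. X $ i $ k * pderivative (j, k) f)"

definition alpha_det :: "complex \<Rightarrow> (2 \<times> 2) cpoly ^ 2 ^ 2 \<Rightarrow> (2 \<times> 2) cpoly" where
  "alpha_det \<alpha> A = A $ 1 $ 1 * A $ 2 $ 2 + const \<alpha> * A $ 2 $ 1 * A $ 1 $ 2"

definition per :: "'a::comm_ring_1 ^ 'n ^ 'n \<Rightarrow> 'a" where
  "per A = (\<Sum>p | p permutes (UNIV :: 'n set). \<Prod>i \<in> UNIV. A $ i $ p i)"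

lemma alpha_det_minus_one: "alpha_det (- 1) A = det A"
  by (simp add: alpha_det_def const_def det_2 single_uminus mult.commute)

lemma alpha_det_one: "alpha_det 1 A = per A"
proof -
  have *: "finite {2::2}" "1 \<notin> {2::2}" by auto
  show ?thesis
    unfolding alpha_det_def const_def per_def UNIV_2
    unfolding sum_over_permutations_insert[OF *] permutes_sing
    by (simp add: swap_id_eq mult.commute)
qed


section \<open>Existence of the irreducible highest weight modules\<close>

text \<open>The standard model of the module of highest weight \<open>(a, b)\<close>: it has the basis
  \<open>v\<^sub>0, \<dots>, v\<^sub>n\<close> with \<open>n = a - b\<close>, and \<open>E\<^sub>2\<^sub>1 v\<^sub>k = (k + 1) v\<^sub>k\<^sub>+\<^sub>1\<close>,
  \<open>E\<^sub>1\<^sub>2 v\<^sub>k = (n - k + 1) v\<^sub>k\<^sub>-\<^sub>1\<close>.\<close>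

definition hw_model :: "nat \<Rightarrow> nat \<Rightarrow> nat rep" where
  "hw_model a b = ({0..a - b}, \<lambda>i j. lin_ext (\<lambda>k.
     if i = 1 \<and> j = 1 then Poly_Mapping.single k (of_nat a - of_nat k)
     else if i = 2 \<and> j = 2 then Poly_Mapping.single k (of_nat b + of_nat k)
     else if i = 2 then (if k < a - b then Poly_Mapping.single (k + 1) (of_nat k + 1) else 0)
     else (if k = 0 then 0 else Poly_Mapping.single (k - 1) (of_nat (a - b) - of_nat k + 1))))"

lemma span_of_induct [consumes 1, case_names zero single add]:
  assumes "v \<in> span_of B"
    and "P 0" and "\<And>b c. b \<in> B \<Longrightarrow> P (Poly_Mapping.single b c)"
    and "\<And>f g. f \<in> span_of B \<Longrightarrow> g \<in> span_of B \<Longrightarrow> P f \<Longrightarrow> P g \<Longrightarrow> P (f + g)"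
  shows "P v"
proof -
  have "P (\<Sum>b \<in> A. Poly_Mapping.single b (Poly_Mapping.lookup v b)) \<and>
        (\<Sum>b \<in> A. Poly_Mapping.single b (Poly_Mapping.lookup v b)) \<in> span_of B"
    if "finite A" "A \<subseteq> B" for A
    using that
  proof (induction A)
    case (insert x F)
    have "Poly_Mapping.single x (Poly_Mapping.lookup v x) \<in> span_of B"
      using insert.prems by (auto simp: span_of_def)
    then show ?case using insert by (auto intro!: assms span_of_add)
  qed (auto intro: assms)
  moreover have "(\<Sum>b \<in> Poly_Mapping.keys v. Poly_Mapping.single b (Poly_Mapping.lookup v b)) = v"
    by (rule poly_mapping_eqI) (auto simp: lookup_sum lookup_single when_def in_keys_iff sum.delta)
  ultimately show ?thesis using assms(1) by (metis finite_keys mem_Collect_eq span_of_def)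
qed

lemma is_rep_hw_model:
  assumes "b \<le> a"
  shows "is_rep (hw_model a b)"
proof -
  obtain n where a: "a = b + n" using assms le_iff_add by blast
  define \<rho> where "\<rho> = snd (hw_model a b)"
  have model: "hw_model a b = ({0..n}, \<rho>)" by (simp add: \<rho>_def hw_model_def a)
  have rho: "\<rho> i j (v + w) = \<rho> i j v + \<rho> i j w" "\<rho> i j (pscale c v) = pscale c (\<rho> i j v)" for i j v w c
    by (simp_all add: \<rho>_def hw_model_def lin_ext_add lin_ext_pscale)
  have rho_single: "\<rho> i j (Poly_Mapping.single k c) = pscale c (
     if i = 1 \<and> j = 1 then Poly_Mapping.single k (of_nat a - of_nat k)
     else if i = 2 \<and> j = 2 then Poly_Mapping.single k (of_nat b + of_nat k)
     else if i = 2 then (if k < n then Poly_Mapping.single (k + 1) (of_nat k + 1) else 0)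
     else (if k = 0 then 0 else Poly_Mapping.single (k - 1) (of_nat n - of_nat k + 1)))" for i j k c
    by (simp add: \<rho>_def hw_model_def a)
  have rho0: "\<rho> i j 0 = 0" for i j
    by (simp add: \<rho>_def hw_model_def)
  have span: "\<rho> i j v \<in> span_of {0..n}" if "v \<in> span_of {0..n}" for i j v
    using that
    by (induction rule: span_of_induct) (auto simp: rho0 rho rho_single span_of_add, auto simp: span_of_def)
  have comm: "\<rho> i j (\<rho> k l v) - \<rho> k l (\<rho> i j v)
        = (if j = k then \<rho> i l v else 0) - (if l = i then \<rho> k j v else 0)"
    if "v \<in> span_of {0..n}" for i j k l v
    using that
  proof (induction rule: span_of_induct)
    case zero
    then show ?case by (simp add: rho0)
  next
    case (single m c)
    let ?v = "Poly_Mapping.single m c"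
    have r11: "\<rho> 1 1 (Poly_Mapping.single k d) = Poly_Mapping.single k (d * (of_nat a - of_nat k))" for k d
      by (simp add: rho_single)
    have r22: "\<rho> 2 2 (Poly_Mapping.single k d) = Poly_Mapping.single k (d * (of_nat b + of_nat k))" for k d
      by (simp add: rho_single)
    have r21: "\<rho> 2 1 (Poly_Mapping.single k d)
        = (if k < n then Poly_Mapping.single (k + 1) (d * (of_nat k + 1)) else 0)" for k d
      by (simp add: rho_single)
    have r12: "\<rho> 1 2 (Poly_Mapping.single k d)
        = (if k = 0 then 0 else Poly_Mapping.single (k - 1) (d * (of_nat n - of_nat k + 1)))" for k d
      by (simp add: rho_single)
    have c1: "\<rho> 1 1 (\<rho> 2 2 ?v) = \<rho> 2 2 (\<rho> 1 1 ?v)"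
      by (simp add: r11 r22 mult_ac)
    have c2: "\<rho> 1 1 (\<rho> 1 2 ?v) - \<rho> 1 2 (\<rho> 1 1 ?v) = \<rho> 1 2 ?v"
      by (rule poly_mapping_eqI, cases m)
        (simp_all add: r11 r12 rho0 lookup_minus lookup_single when_def algebra_simps)
    have c3: "\<rho> 1 1 (\<rho> 2 1 ?v) - \<rho> 2 1 (\<rho> 1 1 ?v) = - \<rho> 2 1 ?v"
      by (rule poly_mapping_eqI)
        (simp add: r11 r21 rho0 lookup_minus lookup_single when_def algebra_simps)
    have c4: "\<rho> 2 2 (\<rho> 1 2 ?v) - \<rho> 1 2 (\<rho> 2 2 ?v) = - \<rho> 1 2 ?v"
      by (rule poly_mapping_eqI, cases m)
        (simp_all add: r22 r12 rho0 lookup_minus lookup_single when_def algebra_simps)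
    have c5: "\<rho> 2 2 (\<rho> 2 1 ?v) - \<rho> 2 1 (\<rho> 2 2 ?v) = \<rho> 2 1 ?v"
      by (rule poly_mapping_eqI)
        (simp add: r22 r21 rho0 lookup_minus lookup_single when_def algebra_simps)
    have c6: "\<rho> 1 2 (\<rho> 2 1 ?v) - \<rho> 2 1 (\<rho> 1 2 ?v) = \<rho> 1 1 ?v - \<rho> 2 2 ?v"
    proof (cases "m < n")
      case True
      then show ?thesis
        by (intro poly_mapping_eqI, cases m)
          (simp_all add: r11 r22 r12 r21 rho0 a lookup_minus lookup_single when_def algebra_simps)
    next
      case False
      then have "m = n" using single by simp
      then show ?thesis
        by (intro poly_mapping_eqI, cases m)
          (simp_all add: r11 r22 r12 r21 rho0 a lookup_minus lookup_single when_def algebra_simps)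
    qed
    have neg: "q - p = - t" if "p - q = t" for p q t :: "nat \<Rightarrow>\<^sub>0 complex"
      using that by auto
    show ?case
      using exhaust_2[of i] exhaust_2[of j] exhaust_2[of k] exhaust_2[of l]
      by (elim disjE) (simp_all add: c1 c2 c3 c4 c5 c6 neg[OF c2] neg[OF c3] neg[OF c4] neg[OF c5] neg[OF c6])
  next
    case (add f g)
    have "\<rho> i j (\<rho> k l (f + g)) - \<rho> k l (\<rho> i j (f + g))
        = (\<rho> i j (\<rho> k l f) - \<rho> k l (\<rho> i j f)) + (\<rho> i j (\<rho> k l g) - \<rho> k l (\<rho> i j g))"
      by (simp add: rho)
    then show ?case by (simp add: add.IH rho)
  qed
  show ?thesis
    unfolding is_rep_def model using rho span comm by auto
qed

lemma submodule_cyclic: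
  assumes M: "left_module M" and f: "f \<in> mcarrier M"
  shows "submodule (mcarrier (cyclic M f)) M"
proof -
  have add: "mact M u f + mact M u' f = mact M (u + u') f"
    and mult: "mact M u (mact M u' f) = mact M (u * u') f" for u u'
    using M f by (auto simp: left_module_def)
  have closed: "mact M u f \<in> mcarrier M" for u
    using M f by (auto simp: left_module_def)
  have zero: "mact M 0 f = 0"
    using add[of 0 0] by simp
  have "- mact M u f = mact M (- u) f" for u
    using add[of u "- u"] zero by (simp add: minus_unique)
  then have "left_module (M\<lparr>mcarrier := {mact M u f | u. True}\<rparr>)"
    using M closed zero[symmetric] by (auto simp: left_module_def add mult algebra_simps)
  then show ?thesis
    using closed by (auto simp: submodule_def cyclic_def)
qed

lemma irreducible_hw_model:
  assumes "b \<le> a"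
  shows "irreducible_highest_weight_module (of_nat a) (of_nat b) (module_of (hw_model a b))"
proof -
  obtain n where a: "a = b + n" using assms le_iff_add by blast
  define \<rho> where "\<rho> = snd (hw_model a b)"
  have model: "hw_model a b = ({0..n}, \<rho>)" by (simp add: \<rho>_def hw_model_def a)
  have rep: "is_rep ({0..n}, \<rho>)" using is_rep_hw_model[OF assms] by (simp add: model)
  let ?M = "module_of ({0..n}, \<rho>)"
  have M: "left_module ?M" using rep by (rule left_module_module_of)
  have car: "mcarrier ?M = span_of {0..n}" and act: "mact ?M = U_action \<rho>"
    by (simp_all add: module_of_def)
  have rho_single: "\<rho> i j (Poly_Mapping.single k c) = pscale c (
     if i = 1 \<and> j = 1 then Poly_Mapping.single k (of_nat a - of_nat k)
     else if i = 2 \<and> j = 2 then Poly_Mapping.single k (of_nat b + of_nat k)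
     else if i = 2 then (if k < n then Poly_Mapping.single (k + 1) (of_nat k + 1) else 0)
     else (if k = 0 then 0 else Poly_Mapping.single (k - 1) (of_nat n - of_nat k + 1)))" for i j k c
    by (simp add: \<rho>_def hw_model_def a)
  have lookup12: "Poly_Mapping.lookup (\<rho> 1 2 v) k = (of_nat n - of_nat k) * Poly_Mapping.lookup v (Suc k)" for v k
  proof (induction v rule: poly_mapping_linear_induct)
    case zero
    then show ?case by (simp add: \<rho>_def hw_model_def)
  next
    case (single m c)
    then show ?case by (cases m) (auto simp: rho_single lookup_single when_def)
  next
    case (add f g)
    moreover have "\<rho> 1 2 (f + g) = \<rho> 1 2 f + \<rho> 1 2 g"
      by (simp add: \<rho>_def hw_model_def lin_ext_add)
    ultimately show ?case by (simp add: lookup_add algebra_simps)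
  qed
  have key: "N = span_of {0..n}" if N: "submodule N ?M" "N \<noteq> {0}" for N
  proof -
    have NM: "N \<subseteq> span_of {0..n}" and zeroN: "0 \<in> N"
      and addN: "\<And>v w. v \<in> N \<Longrightarrow> w \<in> N \<Longrightarrow> v + w \<in> N"
      and actN: "\<And>u v. v \<in> N \<Longrightarrow> U_action \<rho> u v \<in> N"
      using N(1) by (auto simp: submodule_def left_module_def car act)
    have rhoN: "\<rho> i j v \<in> N" if "v \<in> N" for i j v
      using actN[OF that, of "gen i j"] U_action_gen[OF rep] NM that by auto
    have scaleN: "pscale c v \<in> N" if "v \<in> N" for c v
      using actN[OF that, of "Uconst c"] U_action_Uconst[OF rep] NM that by auto
    have lower: "basis_vec 0 \<in> N"
      if "f \<in> N" "f \<noteq> 0" "Poly_Mapping.keys f \<subseteq> {0..q}" "q \<le> n" for f q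
      using that
    proof (induction q arbitrary: f)
      case 0
      then have f: "f = Poly_Mapping.single 0 (Poly_Mapping.lookup f 0)"
        by (intro poly_mapping_eqI) (auto simp: lookup_single when_def in_keys_iff)
      with 0 have "Poly_Mapping.lookup f 0 \<noteq> 0" by auto
      then have "basis_vec 0 = pscale (1 / Poly_Mapping.lookup f 0) f"
        by (subst (2) f) simp
      then show ?case using scaleN[OF 0(1)] by metis
    next
      case (Suc q)
      show ?case
      proof (cases "Poly_Mapping.lookup f (Suc q) = 0")
        case True
        have "Poly_Mapping.keys f \<subseteq> {0..q}"
        proof
          fix k assume k: "k \<in> Poly_Mapping.keys f"
          then have "k \<noteq> Suc q" using True by (auto simp: in_keys_iff)
          then show "k \<in> {0..q}" using k Suc.prems(3) by (auto simp: le_Suc_eq)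
        qed
        then show ?thesis using Suc by simp
      next
        case False
        have "Poly_Mapping.lookup (\<rho> 1 2 f) q \<noteq> 0"
          using False Suc.prems(4) by (auto simp: lookup12)
        then have "\<rho> 1 2 f \<noteq> 0" by auto
        moreover have "Poly_Mapping.keys (\<rho> 1 2 f) \<subseteq> {0..q}"
          using Suc.prems(3) by (auto simp: in_keys_iff lookup12)
        ultimately show ?thesis using Suc.IH[of "\<rho> 1 2 f"] Suc.prems rhoN by simp
      qed
    qed
    obtain f where "f \<in> N" "f \<noteq> 0" using N(2) zeroN by blast
    then have v0: "basis_vec 0 \<in> N" using lower[of f n] NM by (auto simp: span_of_def)
    have vk: "basis_vec k \<in> N" if "k \<le> n" for k
      using that
    proof (induction k)
      case 0
      show ?case by (rule v0)
    next
      case (Suc k)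
      then have "\<rho> 2 1 (basis_vec k) = Poly_Mapping.single (Suc k) (of_nat k + 1)"
        by (simp add: rho_single)
      then have "basis_vec (Suc k) = pscale (1 / (of_nat k + 1)) (\<rho> 2 1 (basis_vec k))"
        by (simp add: of_nat_neq_0[where 'a = complex, simplified] add.commute)
      then show ?case using Suc rhoN scaleN by (metis Suc_leD)
    qed
    have "v \<in> N" if "v \<in> span_of {0..n}" for v
      using that
    proof (induction rule: span_of_induct)
      case (single m c)
      then have "pscale c (basis_vec m) \<in> N" by (intro scaleN vk) simp
      then show ?case by simp
    qed (auto intro: zeroN addN)
    then show ?thesis using NM by blast
  qed
  have v0: "basis_vec 0 \<in> span_of {0..n}" "(basis_vec 0 :: nat \<Rightarrow>\<^sub>0 complex) \<noteq> 0"
    by (simp add: span_of_def) (metis lookup_single_eq lookup_zero zero_neq_one)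
  have "span_of {0..n} \<noteq> {0}" using v0 by blast
  then have irr: "irreducible_module ?M"
    using M key by (auto simp: irreducible_module_def car)
  have cyc: "submodule (mcarrier (cyclic ?M (basis_vec 0))) ?M"
    using submodule_cyclic[OF M] v0 by (simp add: car)
  have "basis_vec 0 = mact ?M 1 (basis_vec 0)"
    using M v0 by (simp add: left_module_def car)
  then have "basis_vec 0 \<in> mcarrier (cyclic ?M (basis_vec 0))"
    by (auto simp: cyclic_def)
  then have "mcarrier (cyclic ?M (basis_vec 0)) \<noteq> {0}"
    using v0(2) by blast
  then have "mcarrier (cyclic ?M (basis_vec 0)) = mcarrier ?M"
    using key[OF cyc] car by simp
  moreover have "\<rho> 1 2 (basis_vec 0) = 0" "\<rho> 1 1 (basis_vec 0) = pscale (of_nat a) (basis_vec 0)"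
    "\<rho> 2 2 (basis_vec 0) = pscale (of_nat b) (basis_vec 0)"
    unfolding rho_single by (simp_all del: single_one)
  ultimately have "highest_weight_module (of_nat a) (of_nat b) ?M"
    unfolding highest_weight_module_def using M v0
    by (intro conjI bexI[of _ "basis_vec 0"])
      (simp_all add: car act U_action_gen[OF rep] U_action_Uconst[OF rep] del: single_one)
  then show ?thesis
    using irr by (simp add: irreducible_highest_weight_module_def model)
qed

end

theory Submission
  imports Defs "HOL-Computational_Algebra.Formal_Power_Series"
begin

text \<open>
  Write \<open>u = x\<^sub>1\<^sub>1 x\<^sub>2\<^sub>2\<close>, \<open>v = x\<^sub>1\<^sub>2 x\<^sub>2\<^sub>1\<close>, \<open>D = x\<^sub>1\<^sub>1 x\<^sub>1\<^sub>2\<close>, \<open>D' = x\<^sub>2\<^sub>1 x\<^sub>2\<^sub>2\<close>, so that \<open>D D' = u v\<close> and the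
  \<open>\<alpha>\<close>-determinant is \<open>u + \<alpha> v\<close>. The tensor square of \<open>Sym\<^sup>l\<close> is the space of polynomials of
  degree \<open>l\<close> in each column of \<open>X\<close>, spanned by the \<open>D\<^sup>m u\<^sup>i v\<^sup>j\<close> and \<open>D'\<^sup>m u\<^sup>i v\<^sup>j\<close> with
  \<open>m + i + j = l\<close>. The submodule generated by \<open>(u + \<alpha> v)\<^sup>l\<close> contains
  \<open>D\<^sup>m (u + \<alpha> v)\<^sup>l\<^sup>-\<^sup>m\<close> for all \<open>m\<close>. If it contains all \<open>D\<^sup>m\<^sup>+\<^sup>1 u\<^sup>i v\<^sup>j\<close>, applying \<open>E\<^sub>2\<^sub>1\<close> to them
  leaves at most one dimension of the \<open>D\<^sup>m u\<^sup>i v\<^sup>j\<close> unaccounted for, and this last dimension is reached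
  unless a certain polynomial in \<open>\<alpha>\<close> vanishes. Up to a factor this polynomial, evaluated at
  \<open>\<alpha> = - x\<close>, is a coefficient of \<open>(1 - t)\<^sup>-\<^sup>m\<^sup>-\<^sup>1 (1 - x t)\<^sup>-\<^sup>m\<^sup>-\<^sup>1\<close>, all of whose zeros lie on the unit circle.

  A module generated by highest weight vectors on which \<open>E\<^sub>2\<^sub>1\<close> is nilpotent, with pairwise distinct
  Casimir eigenvalues, is the direct sum of the corresponding irreducible modules. This applies to the
  vectors \<open>D\<^sup>l\<^sup>-\<^sup>s (det X)\<^sup>s\<close>; for the permanent \<open>p\<close>, to \<open>D\<^sup>l\<^sup>-\<^sup>2\<^sup>j (p\<^sup>2 - 4 D D')\<^sup>j\<close>, both in the
  polynomial ring and in \<open>Sym\<^sup>l(Sym\<^sup>2)\<close>.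
\<close>

section \<open>Modules over the enveloping algebra\<close>

text \<open>The family \<open>M\<close> is known only through irreducibility and highest weights, so
  every comparison runs through the explicit \<open>hw_model\<close>: an irreducible module of
  dominant integral weight is isomorphic to it, and a highest weight vector whose lowering string
  stops embeds it. The generation argument is used at three values. At the given \<alpha> it shows
  that the power of the \<alpha>-determinant generates everything. At \<alpha> = -1 the passage from
  (u - v)^l to D^m (u - v)^(l - m) breaks down, because E_12 kills the determinant; but in
  decomposing the tensor square these products are the given highest weight vectors, and all terms
  of \<open>kappa\<close> then have one sign. The outcome is u^l, the case \<alpha> = 0, which
  generates everything. The vectors for the permanent come from (u + v)^2 - 4 u v = (u - v)^2: the
  discriminant of the quadratic form with coefficients D, p, D' is the square of the determinant.
  Written in D, p, D' it also makes sense in Sym^l(Sym^2), where there is no determinant.\<close>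

lemma Ugl2_abs_cases: obtains a where "u = abs_Ugl2 a"
  by (metis Quotient3_Ugl2 Quotient3_abs_rep)

lemma Uconst_zero [simp]: "Uconst 0 = 0"
  by (simp add: Uconst.abs_eq zero_Ugl2.abs_eq)

lemma Uconst_one [simp]: "Uconst 1 = 1"
proof -
  have "(1 :: free_alg) = Poly_Mapping.single [] 1"
    by (metis single_one zero_list_def)
  then show ?thesis by (simp add: Uconst.abs_eq one_Ugl2.abs_eq)
qed

lemma Uconst_add: "Uconst (c + d) = Uconst c + Uconst d"
  by (simp add: Uconst.abs_eq plus_Ugl2.abs_eq single_add)

lemma Uconst_mult: "Uconst (c * d) = Uconst c * Uconst d"
proof -
  have "Poly_Mapping.single [] (c * d) = (Poly_Mapping.single [] c * Poly_Mapping.single [] d :: free_alg)"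
    by (simp add: mult_single plus_list_def)
  then show ?thesis by (simp add: Uconst.abs_eq times_Ugl2.abs_eq)
qed

lemma Uconst_uminus: "Uconst (- c) = - Uconst c"
  by (simp add: Uconst.abs_eq uminus_Ugl2.abs_eq single_uminus)

lemma Uconst_diff: "Uconst (c - d) = Uconst c - Uconst d"
  using Uconst_add[of c "- d"] by (simp add: Uconst_uminus)

text \<open>Scalars are central, so every \<open>act r\<close> is complex linear.\<close>

lemma Uconst_commute: "u * Uconst c = Uconst c * u"
proof -
  obtain a where u: "u = abs_Ugl2 a" by (rule Ugl2_abs_cases)
  have "a * Poly_Mapping.single [] c = Poly_Mapping.single [] c * a"
    by (induction a rule: poly_mapping_linear_induct)
      (simp_all add: mult_single plus_list_def mult.commute ring_distribs)
  then show ?thesis by (simp add: u Uconst.abs_eq times_Ugl2.abs_eq)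
qed

text \<open>Elements are linear combinations of words, and a word arises by multiplying generators
  on the left one at a time. Stability and equivariance therefore need checking only on scalars and
  on the \<open>gen i j\<close>.\<close>

lemma Ugl2_induct [case_names Uconst gen add mult]:
  assumes "\<And>c. P (Uconst c)" and "\<And>i j. P (gen i j)"
    and "\<And>u v. P u \<Longrightarrow> P v \<Longrightarrow> P (u + v)" and "\<And>u v. P u \<Longrightarrow> P v \<Longrightarrow> P (u * v)"
  shows "P u"
proof -
  obtain a where u: "u = abs_Ugl2 a" by (rule Ugl2_abs_cases)
  have "P (abs_Ugl2 a)"
  proof (induction a rule: poly_mapping_linear_induct)
    case zero
    then show ?case using assms(1)[of 0] by (simp add: zero_Ugl2.abs_eq)
  next
    case (single w c)
    show ?case
    proof (induction w)
      case Nil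
      then show ?case using assms(1)[of c] by (simp add: Uconst.abs_eq)
    next
      case (Cons x w)
      obtain i j where x: "x = (i, j)" by fastforce
      have "Poly_Mapping.single (x # w) c = fgen i j * Poly_Mapping.single w c"
        by (simp add: fgen_def x mult_single plus_list_def)
      then have "abs_Ugl2 (Poly_Mapping.single (x # w) c) = gen i j * abs_Ugl2 (Poly_Mapping.single w c)"
        by (simp add: gen.abs_eq times_Ugl2.abs_eq)
      then show ?case using Cons assms(2,4) by simp
    qed
  next
    case (add f g)
    then show ?case using assms(3) by (simp add: plus_Ugl2.abs_eq[symmetric])
  qed
  then show ?thesis by (simp add: u)
qed

section \<open>Calculus in a module and independence of eigenvectors\<close>

locale gl2_module =
  fixes V :: "(Ugl2, 'v::ab_group_add) lmod"
  assumes left_module: "left_module V"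
begin

abbreviation act :: "Ugl2 \<Rightarrow> 'v \<Rightarrow> 'v" where "act \<equiv> mact V"

lemma zero_closed [simp]: "0 \<in> mcarrier V"
  and add_closed [simp]: "v \<in> mcarrier V \<Longrightarrow> w \<in> mcarrier V \<Longrightarrow> v + w \<in> mcarrier V"
  and uminus_closed [simp]: "v \<in> mcarrier V \<Longrightarrow> - v \<in> mcarrier V"
  and act_closed [simp]: "v \<in> mcarrier V \<Longrightarrow> act r v \<in> mcarrier V"
  and act_add: "v \<in> mcarrier V \<Longrightarrow> w \<in> mcarrier V \<Longrightarrow> act r (v + w) = act r v + act r w"
  and add_act: "v \<in> mcarrier V \<Longrightarrow> act (r + s) v = act r v + act s v"
  and mult_act: "v \<in> mcarrier V \<Longrightarrow> act (r * s) v = act r (act s v)"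
  and one_act [simp]: "v \<in> mcarrier V \<Longrightarrow> act 1 v = v"
  using left_module by (auto simp: left_module_def)

lemma act_zero [simp]: "act r 0 = 0"
  using act_add[of 0 0 r] by simp

lemma zero_act [simp]: "v \<in> mcarrier V \<Longrightarrow> act 0 v = 0"
  using add_act[of v 0 0] by simp

lemma uminus_act: "v \<in> mcarrier V \<Longrightarrow> act (- r) v = - act r v"
  using add_act[of v r "- r"] by (simp add: minus_unique)

lemma diff_act: "v \<in> mcarrier V \<Longrightarrow> act (r - s) v = act r v - act s v"
  using add_act[of v r "- s"] by (simp add: uminus_act)

lemma act_uminus: "v \<in> mcarrier V \<Longrightarrow> act r (- v) = - act r v"
  using act_add[of v "- v" r] by (simp add: minus_unique)

lemma act_diff: "v \<in> mcarrier V \<Longrightarrow> w \<in> mcarrier V \<Longrightarrow> act r (v - w) = act r v - act r w"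
  using act_add[of v "- w" r] by (simp add: act_uminus)

lemma diff_closed [simp]: "v \<in> mcarrier V \<Longrightarrow> w \<in> mcarrier V \<Longrightarrow> v - w \<in> mcarrier V"
  using add_closed[of v "- w"] by simp

lemma sum_closed: "(\<And>i. i \<in> I \<Longrightarrow> f i \<in> mcarrier V) \<Longrightarrow> sum f I \<in> mcarrier V"
  by (induction I rule: infinite_finite_induct) auto

lemma act_sum: "(\<And>i. i \<in> I \<Longrightarrow> f i \<in> mcarrier V) \<Longrightarrow> act r (sum f I) = (\<Sum>i\<in>I. act r (f i))"
  by (induction I rule: infinite_finite_induct) (auto simp: act_add sum_closed)

lemma act_Uconst_commute: "v \<in> mcarrier V \<Longrightarrow> act r (act (Uconst c) v) = act (Uconst c) (act r v)"
  by (metis Uconst_commute mult_act)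

lemma act_Uconst_Uconst: "v \<in> mcarrier V \<Longrightarrow> act (Uconst c) (act (Uconst d) v) = act (Uconst (c * d)) v"
  by (simp add: Uconst_mult mult_act)

lemma act_gen_Uconst: "v \<in> mcarrier V \<Longrightarrow> act (gen i j) (act (Uconst c) v) = act (Uconst c) (act (gen i j) v)"
  by (rule act_Uconst_commute)

lemma act_Uconst_eq_0_iff:
  assumes "v \<in> mcarrier V" "c \<noteq> 0"
  shows "act (Uconst c) v = 0 \<longleftrightarrow> v = 0"
proof
  assume "act (Uconst c) v = 0"
  then have "act (Uconst (1 / c * c)) v = 0" using assms by (simp only: Uconst_mult mult_act act_zero)
  then show "v = 0" using assms by simp
qed simp

text \<open>\<open>C - Uconst (c x)\<close> kills the term at \<open>x\<close> and rescales the
  others by the nonzero \<open>c i - c x\<close>, which shortens the relation. Later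
  \<open>C\<close> is \<open>gen 1 1\<close>, separating the weights of a string, or
  \<open>casimir\<close>, separating the summands of a decomposition.\<close>

lemma eigenvectors_independent:
  assumes "finite I" and "\<And>i. i \<in> I \<Longrightarrow> v i \<in> mcarrier V"
    and "\<And>i. i \<in> I \<Longrightarrow> act C (v i) = act (Uconst (c i)) (v i)"
    and "inj_on c I" and "sum v I = 0"
  shows "\<forall>i\<in>I. v i = 0"
  using assms
proof (induction I arbitrary: v)
  case (insert x I)
  let ?D = "C - Uconst (c x)"
  have eig: "act ?D (v i) = act (Uconst (c i - c x)) (v i)" if "i \<in> insert x I" for i
    using insert.prems that by (simp add: diff_act Uconst_diff)
  have "0 = act ?D (sum v (insert x I))" by (simp only: insert.prems act_zero)
  also have "\<dots> = (\<Sum>i\<in>insert x I. act (Uconst (c i - c x)) (v i))"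
    using insert.prems eig by (subst act_sum) auto
  also have "\<dots> = (\<Sum>i\<in>I. act (Uconst (c i - c x)) (v i))"
    using insert by (simp add: insert.prems)
  finally have 0: "(\<Sum>i\<in>I. act (Uconst (c i - c x)) (v i)) = 0" by simp
  have "\<forall>i\<in>I. act (Uconst (c i - c x)) (v i) = 0"
  proof (rule insert.IH)
    fix i assume "i \<in> I"
    then show "act C (act (Uconst (c i - c x)) (v i)) = act (Uconst (c i)) (act (Uconst (c i - c x)) (v i))"
      using insert.prems by (simp add: act_Uconst_commute[of _ C] act_Uconst_Uconst mult.commute)
  qed (use insert.prems(1) insert.prems(3) insert.hyps(1) 0 in \<open>simp_all add: inj_on_def\<close>)
  moreover have "c i - c x \<noteq> 0" if "i \<in> I" for i
    using insert.prems(3) insert.hyps that by (auto simp: inj_on_def)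
  ultimately have "\<forall>i\<in>I. v i = 0"
    using insert.prems act_Uconst_eq_0_iff by auto
  then show ?case using insert by simp
qed simp

lemma submoduleI:
  assumes "N \<subseteq> mcarrier V" and "0 \<in> N" and add: "\<And>v w. v \<in> N \<Longrightarrow> w \<in> N \<Longrightarrow> v + w \<in> N"
    and Uconst: "\<And>c v. v \<in> N \<Longrightarrow> act (Uconst c) v \<in> N"
    and gen: "\<And>i j v. v \<in> N \<Longrightarrow> act (gen i j) v \<in> N"
  shows "submodule N V"
proof -
  have act: "act r v \<in> N" if "v \<in> N" for r v
    using that
  proof (induction r arbitrary: v rule: Ugl2_induct)
    case (add r s)
    then have "v \<in> mcarrier V" using assms(1) by blast
    then show ?case using add.IH add.prems by (simp add: add_act assms(3))
  next
    case (mult r s)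
    then have "v \<in> mcarrier V" using assms(1) by blast
    then show ?case using mult by (simp add: mult_act)
  qed (auto intro: Uconst gen)
  have "- v = act (- 1) v" if "v \<in> N" for v
    using assms(1) that by (simp add: uminus_act subset_iff)
  then have "- v \<in> N" if "v \<in> N" for v
    using act that by metis
  moreover have "v \<in> mcarrier V" if "v \<in> N" for v using assms(1) that by blast
  ultimately show ?thesis
    unfolding submodule_def left_module_def using assms(1,2) add act
    by (simp add: act_add add_act mult_act)
qed

lemma cyclic_submodule: "f \<in> mcarrier V \<Longrightarrow> submodule (mcarrier (cyclic V f)) V"
  using submodule_cyclic left_module by blast

lemma in_cyclic: "f \<in> mcarrier V \<Longrightarrow> f \<in> mcarrier (cyclic V f)"
  by (auto simp: cyclic_def intro: exI[of _ 1])

lemma cyclic_subset: "submodule N V \<Longrightarrow> f \<in> N \<Longrightarrow> mcarrier (cyclic V f) \<subseteq> N"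
  by (auto simp: cyclic_def submodule_def left_module_def)

end

section \<open>Lowering strings of highest weight vectors\<close>

locale hw_vector = gl2_module V for V :: "(Ugl2, 'v::ab_group_add) lmod" +
  fixes w :: 'v and a b :: complex
  assumes w_closed [simp]: "w \<in> mcarrier V"
    and w_raise: "act (gen 1 2) w = 0"
    and w_weight1: "act (gen 1 1) w = act (Uconst a) w"
    and w_weight2: "act (gen 2 2) w = act (Uconst b) w"
begin

text \<open>Divided powers, normalized so that E_21 and E_12 act with the coefficients of
  \<open>hw_model\<close>.\<close>

definition lowered :: "nat \<Rightarrow> 'v" where
  "lowered k = act (Uconst (1 / fact k) * gen 2 1 ^ k) w"

lemma lowered_closed [simp]: "lowered k \<in> mcarrier V"
  by (simp add: lowered_def)

lemma lowered_0 [simp]: "lowered 0 = w"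
  by (simp add: lowered_def)

lemma gen21_lowered: "act (gen 2 1) (lowered k) = act (Uconst (of_nat k + 1)) (lowered (Suc k))"
proof -
  have "Uconst (of_nat k + 1) * (Uconst (1 / fact (Suc k)) * gen 2 1 ^ Suc k)
      = Uconst ((of_nat k + 1) * (1 / fact (Suc k))) * gen 2 1 ^ Suc k"
    by (simp only: Uconst_mult mult.assoc)
  also have "(of_nat k + 1) * (1 / fact (Suc k)) = (1 / fact k :: complex)"
    using of_nat_neq_0[of k, where 'a = complex] by (simp add: add.commute)
  also have "Uconst (1 / fact k) * gen 2 1 ^ Suc k = gen 2 1 * (Uconst (1 / fact k) * gen 2 1 ^ k)"
    by (metis Uconst_commute mult.assoc power_Suc)
  finally show ?thesis unfolding lowered_def by (metis mult_act w_closed)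
qed

lemma lowered_Suc: "lowered (Suc k) = act (Uconst (1 / (of_nat k + 1))) (act (gen 2 1) (lowered k))"
proof -
  have "of_nat k + (1::complex) \<noteq> 0" using of_nat_neq_0[of k, where 'a = complex] by (simp add: add.commute)
  then have "lowered (Suc k) = act (Uconst (1 / (of_nat k + 1) * (of_nat k + 1))) (lowered (Suc k))"
    by simp
  then show ?thesis unfolding gen21_lowered Uconst_mult by (simp add: mult_act)
qed

lemma act_commutator:
  assumes "v \<in> mcarrier V"
  shows "act (gen i j) (act (gen k l) v) = act (gen k l) (act (gen i j) v)
     + act ((if j = k then gen i l else 0) - (if l = i then gen k j else 0)) v"
proof -
  have "gen i j * gen k l = gen k l * gen i j + ((if j = k then gen i l else 0) - (if l = i then gen k j else 0))"
    using gen_commutator[of i j k l] by (simp add: algebra_simps)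
  then show ?thesis using assms by (metis add_act mult_act)
qed

lemma act_Uconst_simps:
  "v \<in> mcarrier V \<Longrightarrow> act (Uconst c) v + act (Uconst d) v = act (Uconst (c + d)) v"
  "v \<in> mcarrier V \<Longrightarrow> act (Uconst c) v - act (Uconst d) v = act (Uconst (c - d)) v"
  "v \<in> mcarrier V \<Longrightarrow> - act (Uconst c) v = act (Uconst (- c)) v"
  by (simp_all add: Uconst_add add_act Uconst_diff diff_act Uconst_uminus uminus_act)

lemma gen11_lowered: "act (gen 1 1) (lowered k) = act (Uconst (a - of_nat k)) (lowered k)"
proof (induction k)
  case 0
  then show ?case by (simp add: w_weight1)
next
  case (Suc k)
  have "act (gen 1 1) (act (gen 2 1) (lowered k)) = act (gen 2 1) (act (gen 1 1) (lowered k)) - act (gen 2 1) (lowered k)"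
    by (subst act_commutator) (simp_all add: uminus_act)
  also have "\<dots> = act (Uconst (a - of_nat k - 1)) (act (gen 2 1) (lowered k))"
    by (simp add: Suc act_gen_Uconst Uconst_diff diff_act act_diff)
  finally have "act (gen 1 1) (act (gen 2 1) (lowered k)) = act (Uconst (a - of_nat k - 1)) (act (gen 2 1) (lowered k))" .
  then show ?case
    by (simp add: lowered_Suc act_gen_Uconst act_Uconst_Uconst act_Uconst_simps mult.commute diff_diff_eq add.commute)
qed

lemma gen22_lowered: "act (gen 2 2) (lowered k) = act (Uconst (b + of_nat k)) (lowered k)"
proof (induction k)
  case 0
  then show ?case by (simp add: w_weight2)
next
  case (Suc k)
  have "act (gen 2 2) (act (gen 2 1) (lowered k)) = act (gen 2 1) (act (gen 2 2) (lowered k)) + act (gen 2 1) (lowered k)"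
    by (subst act_commutator) simp_all
  also have "\<dots> = act (Uconst (b + of_nat k + 1)) (act (gen 2 1) (lowered k))"
    by (simp add: Suc act_gen_Uconst Uconst_add add_act act_add)
  finally have "act (gen 2 2) (act (gen 2 1) (lowered k)) = act (Uconst (b + of_nat k + 1)) (act (gen 2 1) (lowered k))" .
  then show ?case
    by (simp add: lowered_Suc act_gen_Uconst act_Uconst_Uconst act_Uconst_simps mult.commute add_ac)
qed

text \<open>The sl_2 computation. Moving E_12 past E_21 adds the weight difference a - b - 2 (k + 1)
  to (a - b - k)(k + 1); the total factors as (k + 2)(a - b - (k + 1)), and the divided power
  removes k + 2.\<close>

lemma gen12_lowered_Suc: "act (gen 1 2) (lowered (Suc k)) = act (Uconst (a - b - of_nat k)) (lowered k)"
proof (induction k)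
  case 0
  have "act (gen 1 2) (act (gen 2 1) w) = act (gen 1 1) w - act (gen 2 2) w"
    by (subst act_commutator) (simp_all add: w_raise diff_act)
  then show ?case by (simp add: lowered_Suc w_weight1 w_weight2 act_Uconst_Uconst act_Uconst_simps)
next
  case (Suc k)
  have nz: "of_nat k + (2::complex) \<noteq> 0"
    using of_nat_neq_0[of "Suc k", where 'a = complex] by (simp add: add.commute)
  have "act (gen 1 2) (act (gen 2 1) (lowered (Suc k)))
      = act (gen 2 1) (act (gen 1 2) (lowered (Suc k))) + (act (gen 1 1) (lowered (Suc k)) - act (gen 2 2) (lowered (Suc k)))"
    by (subst act_commutator) (simp_all add: diff_act)
  also have "\<dots> = act (Uconst ((a - b - of_nat k) * (of_nat k + 1) + ((a - of_nat (Suc k)) - (b + of_nat (Suc k))))) (lowered (Suc k))"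
    by (simp only: Suc act_gen_Uconst lowered_closed gen21_lowered gen11_lowered gen22_lowered act_Uconst_Uconst act_Uconst_simps)
  also have "(a - b - of_nat k) * (of_nat k + 1) + ((a - of_nat (Suc k)) - (b + of_nat (Suc k))) = (of_nat k + 2) * (a - b - of_nat (Suc k))"
    by (simp add: algebra_simps)
  finally have *: "act (gen 1 2) (act (gen 2 1) (lowered (Suc k))) = act (Uconst ((of_nat k + 2) * (a - b - of_nat (Suc k)))) (lowered (Suc k))" .
  have "act (gen 1 2) (lowered (Suc (Suc k))) = act (Uconst (1 / (of_nat (Suc k) + 1) * ((of_nat k + 2) * (a - b - of_nat (Suc k))))) (lowered (Suc k))"
    unfolding lowered_Suc[of "Suc k"] by (simp only: act_gen_Uconst act_closed lowered_closed * act_Uconst_Uconst act_Uconst_simps)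
  moreover have "1 / (of_nat (Suc k) + 1) * ((of_nat k + 2) * (a - b - of_nat (Suc k))) = a - b - of_nat (Suc k)"
    using nz by (simp add: add.commute)
  ultimately show ?case by (simp only:)
qed

definition hw_map :: "(nat \<Rightarrow>\<^sub>0 complex) \<Rightarrow> 'v" where
  "hw_map f = (\<Sum>k\<in>Poly_Mapping.keys f. act (Uconst (Poly_Mapping.lookup f k)) (lowered k))"

lemma hw_map_superset:
  "finite A \<Longrightarrow> Poly_Mapping.keys f \<subseteq> A \<Longrightarrow> hw_map f = (\<Sum>k\<in>A. act (Uconst (Poly_Mapping.lookup f k)) (lowered k))"
  unfolding hw_map_def by (intro sum.mono_neutral_left) (auto simp: in_keys_iff)

lemma hw_map_closed [simp]: "hw_map f \<in> mcarrier V"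
  by (auto simp: hw_map_def intro: sum_closed)

lemma hw_map_zero [simp]: "hw_map 0 = 0"
  by (simp add: hw_map_def)

lemma hw_map_add: "hw_map (f + g) = hw_map f + hw_map g"
proof -
  let ?A = "Poly_Mapping.keys f \<union> Poly_Mapping.keys g"
  have "hw_map h = (\<Sum>k\<in>?A. act (Uconst (Poly_Mapping.lookup h k)) (lowered k))" if "h \<in> {f, g, f + g}" for h
    using that by (intro hw_map_superset) (auto dest: set_mp[OF keys_add])
  then show ?thesis by (simp add: lookup_add Uconst_add add_act sum.distrib)
qed

lemma hw_map_single: "hw_map (Poly_Mapping.single k c) = act (Uconst c) (lowered k)"
  by (simp add: hw_map_def)

lemma hw_map_pscale: "hw_map (pscale c f) = act (Uconst c) (hw_map f)"
  by (induction f rule: poly_mapping_linear_induct)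
    (simp_all add: hw_map_single hw_map_add act_add act_Uconst_Uconst act_Uconst_simps)

text \<open>The vectors of a string have pairwise distinct E_11-weights, so a vanishing combination
  vanishes term by term.\<close>

lemma hw_map_eq_0D:
  assumes "hw_map f = 0" and "k \<in> Poly_Mapping.keys f"
  shows "lowered k = 0"
proof -
  let ?v = "\<lambda>k. act (Uconst (Poly_Mapping.lookup f k)) (lowered k)"
  have "\<forall>k\<in>Poly_Mapping.keys f. ?v k = 0"
  proof (rule eigenvectors_independent[where C = "gen 1 1" and c = "\<lambda>k. a - of_nat k"])
    show "inj_on (\<lambda>k. a - of_nat k) (Poly_Mapping.keys f)" by (auto simp: inj_on_def)
    show "sum ?v (Poly_Mapping.keys f) = 0" using assms(1) by (simp add: hw_map_def)
  qed (simp_all add: act_gen_Uconst gen11_lowered act_Uconst_Uconst act_Uconst_simps mult.commute)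
  then show ?thesis using assms(2) by (simp add: act_Uconst_eq_0_iff in_keys_iff)
qed

text \<open>A string can be cut in two ways. A tail starting at n is stable if the coefficient a - b
  - (n - 1) with which E_12 would leave it is zero; an initial segment below n is stable if the
  string has ended at n.\<close>

lemma submodule_image_hw_map:
  assumes B: "B = {n..} \<and> a - b - of_nat n + 1 = 0 \<or> B = {..<n} \<and> lowered n = 0"
  shows "submodule (hw_map ` span_of B) V"
proof (rule submoduleI)
  have single: "act (Uconst c) (lowered k) \<in> hw_map ` span_of B" if "k \<in> B" for c k
    using that by (intro image_eqI[of _ _ "Poly_Mapping.single k c"]) (auto simp: hw_map_single span_of_def)
  have zero: "0 \<in> hw_map ` span_of B" by (intro image_eqI[of _ _ 0]) auto
  show "0 \<in> hw_map ` span_of B" by (rule zero)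
  show add: "v + w \<in> hw_map ` span_of B" if "v \<in> hw_map ` span_of B" "w \<in> hw_map ` span_of B" for v w
    using that by (auto simp: hw_map_add[symmetric] intro!: imageI span_of_add)
  show "act (Uconst c) v \<in> hw_map ` span_of B" if "v \<in> hw_map ` span_of B" for c v
    using that by (auto simp: hw_map_pscale[symmetric] intro!: imageI span_of_pscale)
  have gen: "act (gen i j) (act (Uconst c) (lowered k)) \<in> hw_map ` span_of B" if "k \<in> B" for i j c k
  proof -
    have 21: "act (gen 2 1) (act (Uconst c) (lowered k)) \<in> hw_map ` span_of B"
    proof (cases "Suc k \<in> B")
      case True
      then show ?thesis by (simp add: act_gen_Uconst gen21_lowered act_Uconst_Uconst act_Uconst_simps single)
    next
      case False
      with that B have "Suc k = n" "lowered n = 0" by auto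
      then have "lowered (Suc k) = 0" by simp
      then show ?thesis by (simp add: act_gen_Uconst gen21_lowered zero)
    qed
    have 12: "act (gen 1 2) (act (Uconst c) (lowered k)) \<in> hw_map ` span_of B"
    proof (cases k)
      case 0
      then show ?thesis using zero by (simp add: act_gen_Uconst w_raise)
    next
      case (Suc m)
      show ?thesis
      proof (cases "m \<in> B")
        case True
        then show ?thesis by (simp add: Suc act_gen_Uconst gen12_lowered_Suc act_Uconst_Uconst act_Uconst_simps single)
      next
        case False
        \<comment> \<open>An initial segment would contain the predecessor of k, so this is the tail
          case and k is its first index.\<close>
        with that B Suc have "n = Suc m" "a - b - of_nat n + 1 = 0" by auto
        then have "a - b - of_nat m = 0" by (simp add: algebra_simps)
        then have "act (gen 1 2) (lowered k) = 0" by (simp add: Suc gen12_lowered_Suc)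
        then show ?thesis using zero by (simp add: act_gen_Uconst)
      qed
    qed
    have "act (gen 1 1) (act (Uconst c) (lowered k)) \<in> hw_map ` span_of B"
      "act (gen 2 2) (act (Uconst c) (lowered k)) \<in> hw_map ` span_of B"
      using that by (simp_all add: act_gen_Uconst gen11_lowered gen22_lowered act_Uconst_Uconst act_Uconst_simps single)
    then show ?thesis using 12 21 exhaust_2[of i] exhaust_2[of j] by (elim disjE) simp_all
  qed
  show "act (gen i j) v \<in> hw_map ` span_of B" if v: "v \<in> hw_map ` span_of B" for i j v
  proof -
    obtain f where f: "f \<in> span_of B" "v = hw_map f" using v by blast
    have "act (gen i j) (hw_map f) \<in> hw_map ` span_of B"
      using f(1) by (induction rule: span_of_induct)
        (auto simp: zero hw_map_single gen hw_map_add act_add add)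
    then show ?thesis using f by simp
  qed
qed auto

text \<open>As long as k < n, E_12 maps the vector at k + 1 to a nonzero multiple of the one at
  k.\<close>

lemma lowered_nonzero:
  assumes "w \<noteq> 0" and "k \<le> n" and "a - b = of_nat n"
  shows "lowered k \<noteq> 0"
  using assms(2)
proof (induction k)
  case (Suc k)
  have "a - b - of_nat k \<noteq> 0" using Suc.prems assms(3) by auto
  then have "act (Uconst (a - b - of_nat k)) (lowered k) \<noteq> 0"
    using Suc by (simp add: act_Uconst_eq_0_iff)
  then show ?case using gen12_lowered_Suc[of k] by auto
qed (simp add: assms)

text \<open>Beyond index n the coefficients of E_12 are negative integers. If the string survived
  the step to n + 1 it could never end, against nilpotency.\<close>

lemma lowered_eq_0_if_nilpotent:
  assumes "act (gen 2 1 ^ K) w = 0" and "a - b = of_nat n"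
  shows "lowered (Suc n) = 0"
proof (rule ccontr)
  assume n: "lowered (Suc n) \<noteq> 0"
  have "lowered (Suc n + k) \<noteq> 0" for k
  proof (induction k)
    case (Suc k)
    have "a - b - of_nat (Suc n + k) = of_int (int n - int (Suc n + k))"
      by (simp only: assms(2) of_int_diff of_int_of_nat_eq)
    also have "\<dots> \<noteq> 0" by (simp only: of_int_eq_0_iff)
    finally have "act (gen 1 2) (lowered (Suc (Suc n + k))) \<noteq> 0"
      unfolding gen12_lowered_Suc using Suc by (subst act_Uconst_eq_0_iff) simp_all
    then show ?case by auto
  qed (use n in simp)
  moreover have "lowered (Suc n + K) = 0"
  proof -
    have "gen 2 1 ^ (Suc n + K) = gen 2 1 ^ Suc n * gen 2 1 ^ K" by (rule power_add)
    then show ?thesis unfolding lowered_def using assms(1) by (simp only: mult_act act_closed w_closed act_zero)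
  qed
  ultimately show False by blast
qed

text \<open>Otherwise the tail from n + 1 on spans a nonzero submodule, hence everything; then w
  would be a combination of vectors of other weights.\<close>

lemma lowered_eq_0_if_irreducible:
  assumes "irreducible_module V" and "w \<noteq> 0" and "a - b = of_nat n"
  shows "lowered (Suc n) = 0"
proof (rule ccontr)
  assume n: "lowered (Suc n) \<noteq> 0"
  let ?N = "hw_map ` span_of {Suc n..}"
  have "submodule ?N V" by (rule submodule_image_hw_map[of _ "Suc n"]) (simp add: assms(3))
  moreover have "lowered (Suc n) \<in> ?N"
    by (intro image_eqI[of _ _ "basis_vec (Suc n)"]) (simp_all add: hw_map_single span_of_def)
  ultimately have "?N = mcarrier V" using assms(1) n by (auto simp: irreducible_module_def)
  then obtain g where g: "g \<in> span_of {Suc n..}" "w = hw_map g" using w_closed by blast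
  \<comment> \<open>Encodes the relation - w + hw_map g = 0, whose coefficient at index 0 is
    -1.\<close>
  have "hw_map (Poly_Mapping.single 0 (-1) + g) = 0"
    by (simp add: hw_map_add hw_map_single g(2)[symmetric] Uconst_uminus uminus_act)
  moreover have "0 \<in> Poly_Mapping.keys (Poly_Mapping.single 0 (-1) + g)"
  proof -
    have "Poly_Mapping.lookup g 0 = 0" using g(1) by (auto simp: span_of_def in_keys_iff subset_iff)
    then show ?thesis by (simp add: in_keys_iff lookup_add)
  qed
  ultimately have "lowered 0 = 0" by (rule hw_map_eq_0D)
  then show False using assms(2) by simp
qed

end

section \<open>Isomorphisms of modules\<close>

lemma lmod_isoI:
  assumes "left_module M" "left_module N" "bij_betw \<phi> (mcarrier M) (mcarrier N)"
    and "\<And>v w. v \<in> mcarrier M \<Longrightarrow> w \<in> mcarrier M \<Longrightarrow> \<phi> (v + w) = \<phi> v + \<phi> w"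
    and "\<And>r v. v \<in> mcarrier M \<Longrightarrow> \<phi> (mact M r v) = mact N r (\<phi> v)"
  shows "M \<cong>\<^sub>U N"
  unfolding lmod_iso_def using assms by blast

lemma lmod_isoE:
  assumes "M \<cong>\<^sub>U N"
  obtains \<phi> where "left_module M" "left_module N" "bij_betw \<phi> (mcarrier M) (mcarrier N)"
    and "\<And>v w. v \<in> mcarrier M \<Longrightarrow> w \<in> mcarrier M \<Longrightarrow> \<phi> (v + w) = \<phi> v + \<phi> w"
    and "\<And>r v. v \<in> mcarrier M \<Longrightarrow> \<phi> (mact M r v) = mact N r (\<phi> v)"
  using assms unfolding lmod_iso_def by blast

lemma lmod_iso_sym:
  assumes "M \<cong>\<^sub>U N"
  shows "N \<cong>\<^sub>U M"
proof -
  obtain \<phi> where M: "left_module M" and N: "left_module N" and bij: "bij_betw \<phi> (mcarrier M) (mcarrier N)"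
    and add: "\<And>v w. v \<in> mcarrier M \<Longrightarrow> w \<in> mcarrier M \<Longrightarrow> \<phi> (v + w) = \<phi> v + \<phi> w"
    and act: "\<And>r v. v \<in> mcarrier M \<Longrightarrow> \<phi> (mact M r v) = mact N r (\<phi> v)"
    using lmod_isoE[OF assms] by metis
  let ?\<psi> = "the_inv_into (mcarrier M) \<phi>"
  have closed: "?\<psi> v \<in> mcarrier M" and inv: "\<phi> (?\<psi> v) = v" if "v \<in> mcarrier N" for v
    using bij that by (auto simp: bij_betw_def the_inv_into_into f_the_inv_into_f)
  have inj: "x = y" if "\<phi> x = \<phi> y" "x \<in> mcarrier M" "y \<in> mcarrier M" for x y
    using bij that by (auto simp: bij_betw_def inj_on_def)
  show ?thesis
  proof (rule lmod_isoI[OF N M])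
    show "bij_betw ?\<psi> (mcarrier N) (mcarrier M)" using bij by (rule bij_betw_the_inv_into)
    show "?\<psi> (v + w) = ?\<psi> v + ?\<psi> w" if "v \<in> mcarrier N" "w \<in> mcarrier N" for v w
      using that M N by (intro inj) (simp_all add: add closed inv left_module_def)
    show "?\<psi> (mact N r v) = mact M r (?\<psi> v)" if "v \<in> mcarrier N" for r v
      using that M N by (intro inj) (simp_all add: act closed inv left_module_def)
  qed
qed

lemma lmod_iso_trans:
  assumes "M \<cong>\<^sub>U N" and "N \<cong>\<^sub>U P"
  shows "M \<cong>\<^sub>U P"
proof -
  obtain \<phi> where M: "left_module M" and bij: "bij_betw \<phi> (mcarrier M) (mcarrier N)"
    and add: "\<And>v w. v \<in> mcarrier M \<Longrightarrow> w \<in> mcarrier M \<Longrightarrow> \<phi> (v + w) = \<phi> v + \<phi> w"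
    and act: "\<And>r v. v \<in> mcarrier M \<Longrightarrow> \<phi> (mact M r v) = mact N r (\<phi> v)"
    using lmod_isoE[OF assms(1)] by metis
  obtain \<psi> where P: "left_module P" and bij': "bij_betw \<psi> (mcarrier N) (mcarrier P)"
    and add': "\<And>v w. v \<in> mcarrier N \<Longrightarrow> w \<in> mcarrier N \<Longrightarrow> \<psi> (v + w) = \<psi> v + \<psi> w"
    and act': "\<And>r v. v \<in> mcarrier N \<Longrightarrow> \<psi> (mact N r v) = mact P r (\<psi> v)"
    using lmod_isoE[OF assms(2)] by metis
  have closed: "\<phi> v \<in> mcarrier N" if "v \<in> mcarrier M" for v
    using bij that by (auto simp: bij_betw_def)
  show ?thesis
    using M P bij_betw_trans[OF bij bij']
    by (rule lmod_isoI) (simp_all add: add act add' act' closed)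
qed

section \<open>Comparison with the standard model\<close>

lemma rep_hw_model_single:
  "snd (hw_model m n) i j (Poly_Mapping.single k c) = pscale c (
     if i = 1 \<and> j = 1 then Poly_Mapping.single k (of_nat m - of_nat k)
     else if i = 2 \<and> j = 2 then Poly_Mapping.single k (of_nat n + of_nat k)
     else if i = 2 then (if k < m - n then Poly_Mapping.single (k + 1) (of_nat k + 1) else 0)
     else (if k = 0 then 0 else Poly_Mapping.single (k - 1) (of_nat (m - n) - of_nat k + 1)))"
  by (simp add: hw_model_def)

context
  fixes m n :: nat
  assumes le: "n \<le> m"
begin

lemma hw_model_eq: "hw_model m n = ({0..m - n}, snd (hw_model m n))"
  by (simp add: hw_model_def)

lemma is_rep_hw_model': "is_rep ({0..m - n}, snd (hw_model m n))"
  using is_rep_hw_model[OF le] by (subst (asm) hw_model_eq)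

lemma module_of_hw_model: "module_of (hw_model m n) = \<lparr>mcarrier = span_of {0..m - n}, mact = U_action (snd (hw_model m n))\<rparr>"
  by (simp add: module_of_def hw_model_def)

lemma left_module_hw_model: "left_module (module_of (hw_model m n))"
  by (subst hw_model_eq) (rule left_module_module_of[OF is_rep_hw_model'])

end

text \<open>Conditions under which \<open>hw_map\<close> embeds the model of dimension a - b + 1.
  The last one will come from nilpotency of E_21 or from irreducibility.\<close>

locale nat_hw_vector = hw_vector V w "of_nat a" "of_nat b"
  for V :: "(Ugl2, 'v::ab_group_add) lmod" and w :: 'v and a b :: nat +
  assumes le: "b \<le> a"
    and nonzero: "w \<noteq> 0"
    and lowered_end: "lowered (Suc (a - b)) = 0"
begin

abbreviation \<rho> where "\<rho> \<equiv> snd (hw_model a b)"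

lemma rep: "is_rep ({0..a - b}, \<rho>)"
  by (rule is_rep_hw_model'[OF le])

lemma hw_map_gen:
  assumes "f \<in> span_of {0..a - b}"
  shows "hw_map (\<rho> i j f) = act (gen i j) (hw_map f)"
  using assms
proof (induction rule: span_of_induct)
  case zero
  then show ?case by (simp add: hw_model_def)
next
  case (single k c)
  have 12: "hw_map (\<rho> 1 2 (Poly_Mapping.single k c)) = act (gen 1 2) (hw_map (Poly_Mapping.single k c))"
  proof (cases k)
    case 0
    then show ?thesis by (simp add: rep_hw_model_single hw_map_single act_gen_Uconst w_raise)
  next
    case (Suc q)
    have "(of_nat a - of_nat b - of_nat q :: complex) = of_nat (a - b) - of_nat k + 1"
      using le by (simp add: Suc of_nat_diff)
    then show ?thesis
      using gen12_lowered_Suc[of q]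
      by (simp add: Suc rep_hw_model_single hw_map_single act_gen_Uconst act_Uconst_Uconst)
  qed
  have 21: "hw_map (\<rho> 2 1 (Poly_Mapping.single k c)) = act (gen 2 1) (hw_map (Poly_Mapping.single k c))"
  proof (cases "k < a - b")
    case True
    then show ?thesis
      by (simp add: rep_hw_model_single hw_map_single act_gen_Uconst gen21_lowered act_Uconst_Uconst)
  next
    case False
    with single have "Suc k = Suc (a - b)" by simp
    with lowered_end have "lowered (Suc k) = 0" by simp
    with False show ?thesis
      by (simp add: rep_hw_model_single hw_map_single act_gen_Uconst gen21_lowered)
  qed
  have "hw_map (\<rho> 1 1 (Poly_Mapping.single k c)) = act (gen 1 1) (hw_map (Poly_Mapping.single k c))"
    "hw_map (\<rho> 2 2 (Poly_Mapping.single k c)) = act (gen 2 2) (hw_map (Poly_Mapping.single k c))"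
    by (simp_all add: rep_hw_model_single hw_map_single act_gen_Uconst gen11_lowered gen22_lowered act_Uconst_Uconst)
  with 12 21 show ?case using exhaust_2[of i] exhaust_2[of j] by (elim disjE) simp_all
next
  case (add f g)
  have "\<rho> i j (f + g) = \<rho> i j f + \<rho> i j g" by (simp add: hw_model_def lin_ext_add)
  with add show ?case by (simp add: hw_map_add act_add)
qed

lemma hw_map_act:
  assumes "f \<in> span_of {0..a - b}"
  shows "hw_map (U_action \<rho> r f) = act r (hw_map f)"
proof -
  interpret H: gl2_module "module_of (hw_model a b)"
    by (rule gl2_module.intro) (rule left_module_hw_model[OF le])
  have sel: "mcarrier (module_of (hw_model a b)) = span_of {0..a - b}" "H.act = U_action \<rho>"
    by (simp_all add: module_of_hw_model[OF le])
  show ?thesis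
    using assms
  proof (induction r arbitrary: f rule: Ugl2_induct)
    case (Uconst c)
    then show ?case by (simp add: U_action_Uconst[OF rep] hw_map_pscale)
  next
    case (gen i j)
    then show ?case by (simp add: U_action_gen[OF rep] hw_map_gen)
  next
    case (add u v)
    then show ?case using H.add_act[unfolded sel] by (simp add: hw_map_add add_act)
  next
    case (mult u v)
    then show ?case using H.mult_act[unfolded sel] H.act_closed[unfolded sel] by (simp add: mult_act)
  qed
qed

lemma hw_map_inj: "inj_on hw_map (span_of {0..a - b})"
proof (rule inj_onI)
  fix f g assume f: "f \<in> span_of {0..a - b}" and g: "g \<in> span_of {0..a - b}" and eq: "hw_map f = hw_map g"
  have "hw_map (f - g) + hw_map g = hw_map f" by (simp add: hw_map_add[symmetric])
  then have 0: "hw_map (f - g) = 0" using eq by simp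
  have "f - g \<in> span_of {0..a - b}" using span_of_add[OF f span_of_uminus[OF g]] by simp
  then have sub: "Poly_Mapping.keys (f - g) \<subseteq> {0..a - b}" by (simp add: span_of_def)
  have "Poly_Mapping.keys (f - g) = {}"
  proof (rule ccontr)
    assume "Poly_Mapping.keys (f - g) \<noteq> {}"
    then obtain k where k: "k \<in> Poly_Mapping.keys (f - g)" by blast
    then have "lowered k = 0" using 0 hw_map_eq_0D by blast
    moreover have "lowered k \<noteq> 0"
      using k sub by (intro lowered_nonzero[OF nonzero, of _ "a - b"]) (auto simp: of_nat_diff le)
    ultimately show False by simp
  qed
  then show "f = g" by simp
qed

text \<open>The image of \<open>hw_map\<close> is a submodule because the string ends, and it
  contains w; generation by w makes it everything.\<close>

lemma iso_hw_model:
  assumes "\<And>N. submodule N V \<Longrightarrow> w \<in> N \<Longrightarrow> N = mcarrier V"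
  shows "module_of (hw_model a b) \<cong>\<^sub>U V"
proof (rule lmod_isoI[OF left_module_hw_model[OF le] left_module])
  have eq: "{0..a - b} = {..<Suc (a - b)}" by auto
  have "w \<in> hw_map ` span_of {0..a - b}"
    by (intro image_eqI[of _ _ "basis_vec 0"]) (simp_all add: hw_map_single span_of_def del: single_one)
  moreover have "submodule (hw_map ` span_of {0..a - b}) V"
    by (rule submodule_image_hw_map[of _ "Suc (a - b)"]) (intro disjI2 conjI eq lowered_end)
  ultimately have "hw_map ` span_of {0..a - b} = mcarrier V" using assms by blast
  then show "bij_betw hw_map (mcarrier (module_of (hw_model a b))) (mcarrier V)"
    using hw_map_inj by (simp add: bij_betw_def module_of_hw_model[OF le])
qed (simp_all add: hw_map_add hw_map_act module_of_hw_model[OF le])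

end

text \<open>The disjunction covers two settings: concrete polynomials, whose nilpotency follows from
  the Leibniz rule, and abstract irreducible modules.\<close>

lemma nat_hw_vectorI:
  assumes "left_module V" "w \<in> mcarrier V" "w \<noteq> 0" "mact V (gen 1 2) w = 0"
    and "mact V (gen 1 1) w = mact V (Uconst (of_nat a)) w"
    and "mact V (gen 2 2) w = mact V (Uconst (of_nat b)) w" and "b \<le> a"
    and "mact V (gen 2 1 ^ K) w = 0 \<or> irreducible_module V"
  shows "nat_hw_vector V w a b"
proof -
  interpret hw_vector V w "of_nat a" "of_nat b"
    using assms by unfold_locales
  have "of_nat a - of_nat b = (of_nat (a - b) :: complex)" using \<open>b \<le> a\<close> by (simp add: of_nat_diff)
  then have "lowered (Suc (a - b)) = 0"
    using assms(8) lowered_eq_0_if_nilpotent[of K "a - b"] lowered_eq_0_if_irreducible[of "a - b"] assms(3)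
    by argo
  then show ?thesis using assms by unfold_locales
qed

text \<open>Uniqueness of the irreducible module of a dominant integral highest weight; through it
  the result holds for every choice of the family \<open>M\<close>.\<close>

lemma iso_hw_model_if_irreducible:
  assumes "irreducible_highest_weight_module (of_nat a) (of_nat b) M" and "b \<le> a"
  shows "module_of (hw_model a b) \<cong>\<^sub>U M"
proof -
  have irr: "irreducible_module M" and hw: "highest_weight_module (of_nat a) (of_nat b) M"
    using assms(1) by (auto simp: irreducible_highest_weight_module_def)
  obtain v where v: "v \<in> mcarrier M" "v \<noteq> 0" "mact M (gen 1 2) v = 0"
    "mact M (gen 1 1) v = mact M (Uconst (of_nat a)) v"
    "mact M (gen 2 2) v = mact M (Uconst (of_nat b)) v"
    using hw by (auto simp: highest_weight_module_def)
  have "left_module M" using irr by (simp add: irreducible_module_def)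
  then interpret nat_hw_vector M v a b
    by (rule nat_hw_vectorI[OF _ v assms(2) disjI2[OF irr]])
  show ?thesis
  proof (rule iso_hw_model)
    fix N assume "submodule N M" "v \<in> N"
    then show "N = mcarrier M" using irr v(2) by (auto simp: irreducible_module_def)
  qed
qed

section \<open>Casimir element and direct sums\<close>

definition casimir :: Ugl2 where
  "casimir = gen 1 1 * gen 1 1 + gen 2 2 * gen 2 2 + gen 1 2 * gen 2 1 + gen 2 1 * gen 1 2"

text \<open>On the k-th basis vector, with n = a - b, the value is (a - k)^2 + (b + k)^2 + (k + 1)(n
  - k) + k (n - k + 1). Here k cancels and a^2 + b^2 + n remains.\<close>

lemma casimir_hw_model:
  assumes le: "b \<le> a" and f: "f \<in> span_of {0..a - b}"
  shows "mact (module_of (hw_model a b)) casimir f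
    = mact (module_of (hw_model a b)) (Uconst (of_nat (a * a + b * b + (a - b)))) f"
proof -
  interpret H: gl2_module "module_of (hw_model a b)"
    by (rule gl2_module.intro) (rule left_module_hw_model[OF le])
  have rep: "is_rep ({0..a - b}, snd (hw_model a b))" by (rule is_rep_hw_model'[OF le])
  have sel: "mcarrier (module_of (hw_model a b)) = span_of {0..a - b}"
    "H.act = U_action (snd (hw_model a b))"
    by (simp_all add: module_of_hw_model[OF le])
  have gen: "H.act (gen i j) g = snd (hw_model a b) i j g" if "g \<in> span_of {0..a - b}" for i j g
    using that by (simp add: sel U_action_gen[OF rep])
  have const: "H.act (Uconst c) g = pscale c g" if "g \<in> span_of {0..a - b}" for c g
    using that by (simp add: sel U_action_Uconst[OF rep])
  show ?thesis
    using f
  proof (induction rule: span_of_induct)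
    case (single k c)
    obtain n where a: "a = b + n" using le le_iff_add by blast
    have k: "k \<le> n" using single a by simp
    have s: "Poly_Mapping.single k c \<in> span_of {0..a - b}" using single by (auto simp: span_of_def)
    have cas: "H.act casimir g = H.act (gen 1 1) (H.act (gen 1 1) g) + H.act (gen 2 2) (H.act (gen 2 2) g)
        + H.act (gen 1 2) (H.act (gen 2 1) g) + H.act (gen 2 1) (H.act (gen 1 2) g)" if "g \<in> span_of {0..a - b}" for g
      using that by (simp add: casimir_def H.add_act H.mult_act sel(1))
    have cl: "H.act r g \<in> span_of {0..a - b}" if "g \<in> span_of {0..a - b}" for r g
      using that H.act_closed by (simp add: sel(1))
    let ?\<rho> = "snd (hw_model a b)"
    have r11: "?\<rho> 1 1 (Poly_Mapping.single k d) = Poly_Mapping.single k (d * (of_nat a - of_nat k))"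
      and r22: "?\<rho> 2 2 (Poly_Mapping.single k d) = Poly_Mapping.single k (d * (of_nat b + of_nat k))" for d
      by (simp_all add: rep_hw_model_single)
    have r1221: "?\<rho> 1 2 (?\<rho> 2 1 (Poly_Mapping.single k c)) = Poly_Mapping.single k (c * ((of_nat k + 1) * (of_nat n - of_nat k)))"
    \<comment> \<open>The model kills its last basis vector under E_21, in agreement with the factor
      n - k.\<close>
    proof (cases "k = n")
      case True
      then show ?thesis by (simp add: rep_hw_model_single a) (simp add: hw_model_def)
    next
      case False
      with k show ?thesis by (simp add: rep_hw_model_single a mult.assoc)
    qed
    have r2112: "?\<rho> 2 1 (?\<rho> 1 2 (Poly_Mapping.single k c)) = Poly_Mapping.single k (c * (of_nat k * (of_nat n - of_nat k + 1)))"
    proof (cases k)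
      case 0
      then show ?thesis by (simp add: rep_hw_model_single a) (simp add: hw_model_def)
    next
      case (Suc q)
      with k show ?thesis by (simp add: rep_hw_model_single a algebra_simps)
    qed
    have "H.act casimir (Poly_Mapping.single k c) = Poly_Mapping.single k (of_nat (a * a + b * b + (a - b)) * c)"
      unfolding cas[OF s] gen[OF cl[OF s]] unfolding gen[OF s] r11 r22 r1221 r2112 single_add[symmetric]
      by (rule arg_cong[of _ _ "Poly_Mapping.single k"]) (simp add: a algebra_simps)
    then show ?case using s by (simp add: const)
  qed (simp_all add: H.act_add sel(1))
qed

lemma left_module_act_zero:
  assumes "left_module M"
  shows "mact M r 0 = 0"
proof -
  have "mact M r (0 + 0) = mact M r 0 + mact M r 0"
    using assms unfolding left_module_def by blast
  then show ?thesis by simp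
qed

lemma lookup_mact_direct_sum:
  assumes "\<And>i. i \<in> I \<Longrightarrow> left_module (M i)" and "f \<in> mcarrier (direct_sum I M)"
  shows "Poly_Mapping.lookup (mact (direct_sum I M) r f) i
    = (if i \<in> I then mact (M i) r (Poly_Mapping.lookup f i) else 0)"
  using assms left_module_act_zero[of "M i" r]
  by (auto simp: direct_sum_def mapp.rep_eq when_def in_keys_iff)

lemma left_module_direct_sum:
  assumes M: "\<And>i. i \<in> I \<Longrightarrow> left_module (M i)"
  shows "left_module (direct_sum I M)"
proof -
  let ?D = "direct_sum I M"
  have carrier: "f \<in> mcarrier ?D \<longleftrightarrow> (\<forall>i. if i \<in> I then Poly_Mapping.lookup f i \<in> mcarrier (M i) else Poly_Mapping.lookup f i = 0)" for f
    by (auto simp: direct_sum_def in_keys_iff subset_iff)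
  have lookup: "Poly_Mapping.lookup (mact ?D r f) i = (if i \<in> I then mact (M i) r (Poly_Mapping.lookup f i) else 0)"
    if "f \<in> mcarrier ?D" for r f i
    using M that by (rule lookup_mact_direct_sum)
  have closed: "v + w \<in> mcarrier ?D" "- v \<in> mcarrier ?D" "mact ?D r v \<in> mcarrier ?D"
    if v: "v \<in> mcarrier ?D" and w: "w \<in> mcarrier ?D" for r v w
    using M v w lookup[OF v] unfolding carrier by (simp_all add: left_module_def lookup_add split: if_splits)
  have zero: "0 \<in> mcarrier ?D" using M by (simp add: carrier left_module_def)
  have comp: "Poly_Mapping.lookup v i \<in> mcarrier (M i)" if "v \<in> mcarrier ?D" "i \<in> I" for v i
    using that by (simp add: direct_sum_def)
  have out: "Poly_Mapping.lookup v i = 0" if "v \<in> mcarrier ?D" "i \<notin> I" for v i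
    using that unfolding carrier by metis
  have laws: "mact ?D r (v + w) = mact ?D r v + mact ?D r w"
    "mact ?D (r + s) v = mact ?D r v + mact ?D s v"
    "mact ?D (r * s) v = mact ?D r (mact ?D s v)"
    "mact ?D 1 v = v" if v: "v \<in> mcarrier ?D" and w: "w \<in> mcarrier ?D" for r s v w
  proof -
    note M' = M[unfolded left_module_def]
    show "mact ?D r (v + w) = mact ?D r v + mact ?D r w"
      by (rule poly_mapping_eqI) (simp add: lookup v w closed lookup_add M' comp)
    show "mact ?D (r + s) v = mact ?D r v + mact ?D s v"
      by (rule poly_mapping_eqI) (simp add: lookup v closed lookup_add M' comp)
    show "mact ?D (r * s) v = mact ?D r (mact ?D s v)"
      by (rule poly_mapping_eqI) (simp add: lookup[OF v] lookup[OF closed(3)[OF v v]] M' comp v)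
    show "mact ?D 1 v = v"
      by (rule poly_mapping_eqI) (simp add: lookup v M' comp out)
  qed
  show ?thesis
    unfolding left_module_def
    by (intro conjI allI ballI)
      (simp_all only: zero closed(1) closed(2,3)[OF _ zero] laws(1) laws(2-4)[OF _ zero])
qed

text \<open>Each \<open>M i\<close> is carried to the model and from there into \<open>V\<close>
  along the string of \<open>w i\<close>; the map adds up these embeddings. It is onto by
  \<open>generate\<close>, and injective because the components lie in different Casimir
  eigenspaces.\<close>

theorem iso_direct_sum:
  fixes V :: "(Ugl2, 'v::ab_group_add) lmod" and M :: "'i \<Rightarrow> (Ugl2, 'm::ab_group_add) lmod"
  assumes V: "left_module V" and I: "finite I"
    and hw: "\<And>i. i \<in> I \<Longrightarrow> nat_hw_vector V (w i) (a i) (b i)"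
    and irr: "\<And>i. i \<in> I \<Longrightarrow> irreducible_highest_weight_module (of_nat (a i)) (of_nat (b i)) (M i)"
    and inj: "inj_on (\<lambda>i. a i * a i + b i * b i + (a i - b i)) I"
    and generate: "\<And>N. submodule N V \<Longrightarrow> (\<And>i. i \<in> I \<Longrightarrow> w i \<in> N) \<Longrightarrow> N = mcarrier V"
  shows "V \<cong>\<^sub>U direct_sum I M"
proof -
  interpret gl2_module V by (rule gl2_module.intro[OF V])
  let ?c = "\<lambda>i. of_nat (a i * a i + b i * b i + (a i - b i)) :: complex"
  \<comment> \<open>One predicate for all that is needed of an embedding of \<open>M i\<close>, so
    that the embeddings can be chosen for all indices at once.\<close>
  let ?P = "\<lambda>i \<psi>. (\<forall>v\<in>mcarrier (M i). \<psi> v \<in> mcarrier V \<and> act casimir (\<psi> v) = act (Uconst (?c i)) (\<psi> v)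
      \<and> (\<forall>v'\<in>mcarrier (M i). \<psi> (v + v') = \<psi> v + \<psi> v' \<and> (\<psi> v = \<psi> v' \<longrightarrow> v = v'))
      \<and> (\<forall>r. \<psi> (mact (M i) r v) = act r (\<psi> v))) \<and> w i \<in> \<psi> ` mcarrier (M i)"
  have "\<exists>\<psi>. ?P i \<psi>" if i: "i \<in> I" for i
  proof -
    interpret W: nat_hw_vector V "w i" "a i" "b i" using hw i by blast
    let ?H = "module_of (hw_model (a i) (b i))"
    have H: "?H = \<lparr>mcarrier = span_of {0..a i - b i}, mact = U_action W.\<rho>\<rparr>"
      by (rule module_of_hw_model[OF W.le])
    obtain \<phi> where bij: "bij_betw \<phi> (mcarrier (M i)) (mcarrier ?H)"
      and add: "\<And>v w. v \<in> mcarrier (M i) \<Longrightarrow> w \<in> mcarrier (M i) \<Longrightarrow> \<phi> (v + w) = \<phi> v + \<phi> w"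
      and act: "\<And>r v. v \<in> mcarrier (M i) \<Longrightarrow> \<phi> (mact (M i) r v) = mact ?H r (\<phi> v)"
      using lmod_isoE[OF lmod_iso_sym[OF iso_hw_model_if_irreducible[OF irr[OF i] W.le]]] by metis
    have closed: "\<phi> v \<in> span_of {0..a i - b i}" if "v \<in> mcarrier (M i)" for v
      using bij that by (auto simp: bij_betw_def H)
    have casimir: "act casimir (W.hw_map g) = act (Uconst (?c i)) (W.hw_map g)" if "g \<in> span_of {0..a i - b i}" for g
      using casimir_hw_model[OF W.le that] that by (simp add: H flip: W.hw_map_act del: of_nat_add)
    have "?P i (W.hw_map \<circ> \<phi>)"
    proof (intro conjI ballI allI impI)
      fix v v' assume v: "v \<in> mcarrier (M i)" "v' \<in> mcarrier (M i)" "(W.hw_map \<circ> \<phi>) v = (W.hw_map \<circ> \<phi>) v'"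
      then have "\<phi> v = \<phi> v'" using closed W.hw_map_inj by (simp add: inj_on_def)
      then show "v = v'" using v bij by (auto simp: bij_betw_def inj_on_def)
    next
      have "basis_vec 0 \<in> mcarrier ?H" by (simp add: H span_of_def)
      then obtain x where x: "x \<in> mcarrier (M i)" "\<phi> x = basis_vec 0"
        using bij by (metis bij_betw_imp_surj_on imageE)
      then show "w i \<in> (W.hw_map \<circ> \<phi>) ` mcarrier (M i)"
        by (intro image_eqI[of _ _ x]) (simp_all add: W.hw_map_single del: single_one)
    next
      fix v assume v: "v \<in> mcarrier (M i)"
      show "(W.hw_map \<circ> \<phi>) v \<in> mcarrier V" by simp
      show "act casimir ((W.hw_map \<circ> \<phi>) v) = act (Uconst (?c i)) ((W.hw_map \<circ> \<phi>) v)"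
        unfolding comp_apply by (rule casimir[OF closed[OF v]])
      show "(W.hw_map \<circ> \<phi>) (v + v') = (W.hw_map \<circ> \<phi>) v + (W.hw_map \<circ> \<phi>) v'" if "v' \<in> mcarrier (M i)" for v'
        unfolding comp_apply add[OF v that] by (rule W.hw_map_add)
      show "(W.hw_map \<circ> \<phi>) (mact (M i) r v) = act r ((W.hw_map \<circ> \<phi>) v)" for r
        unfolding comp_apply act[OF v] using W.hw_map_act[OF closed[OF v]] by (simp add: H)
    qed
    then show ?thesis by blast
  qed
  then have "\<forall>i\<in>I. \<exists>\<psi>. ?P i \<psi>" by blast
  then obtain \<psi> where "\<forall>i\<in>I. ?P i (\<psi> i)" unfolding bchoice_iff by blast
  then have \<psi>: "\<And>i v. i \<in> I \<Longrightarrow> v \<in> mcarrier (M i) \<Longrightarrow> \<psi> i v \<in> mcarrier V"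
      "\<And>i v. i \<in> I \<Longrightarrow> v \<in> mcarrier (M i) \<Longrightarrow> act casimir (\<psi> i v) = act (Uconst (?c i)) (\<psi> i v)"
      "\<And>i v v'. i \<in> I \<Longrightarrow> v \<in> mcarrier (M i) \<Longrightarrow> v' \<in> mcarrier (M i) \<Longrightarrow> \<psi> i (v + v') = \<psi> i v + \<psi> i v'"
      "\<And>i v v'. i \<in> I \<Longrightarrow> v \<in> mcarrier (M i) \<Longrightarrow> v' \<in> mcarrier (M i) \<Longrightarrow> \<psi> i v = \<psi> i v' \<longleftrightarrow> v = v'"
      "\<And>i v r. i \<in> I \<Longrightarrow> v \<in> mcarrier (M i) \<Longrightarrow> \<psi> i (mact (M i) r v) = act r (\<psi> i v)"
      "\<And>i. i \<in> I \<Longrightarrow> w i \<in> \<psi> i ` mcarrier (M i)"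
    by meson+
  have M: "left_module (M i)" if "i \<in> I" for i
    using irr[OF that] by (simp add: irreducible_highest_weight_module_def irreducible_module_def)
  have M0: "0 \<in> mcarrier (M i)" if "i \<in> I" for i using M[OF that] by (simp add: left_module_def)
  have \<psi>0: "\<psi> i 0 = 0" if "i \<in> I" for i
    using \<psi>(3)[OF that M0[OF that] M0[OF that]] by simp
  let ?D = "direct_sum I M"
  have comp: "Poly_Mapping.lookup f i \<in> mcarrier (M i)" if "f \<in> mcarrier ?D" "i \<in> I" for f i
    using that by (simp add: direct_sum_def)
  define \<Phi> where "\<Phi> f = (\<Sum>i\<in>I. \<psi> i (Poly_Mapping.lookup f i))" for f
  have \<Phi>_closed: "\<Phi> f \<in> mcarrier V" if "f \<in> mcarrier ?D" for f
    unfolding \<Phi>_def by (rule sum_closed) (use \<psi>(1) comp that in blast)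
  have \<Phi>_add: "\<Phi> (f + g) = \<Phi> f + \<Phi> g" if "f \<in> mcarrier ?D" "g \<in> mcarrier ?D" for f g
    using that by (simp add: \<Phi>_def lookup_add \<psi>(3) comp sum.distrib)
  have \<Phi>_act: "\<Phi> (mact ?D r f) = act r (\<Phi> f)" if "f \<in> mcarrier ?D" for f r
    using that unfolding \<Phi>_def
    by (subst act_sum) (simp_all add: \<psi>(1) comp \<psi>(5) lookup_mact_direct_sum[OF M])
  have D: "left_module ?D" by (rule left_module_direct_sum[OF M])
  interpret D: gl2_module ?D by (rule gl2_module.intro[OF D])
  have "\<Phi> ` mcarrier ?D = mcarrier V"
  proof (rule generate)
    show "submodule (\<Phi> ` mcarrier ?D) V"
    proof (rule submoduleI)
      show "\<Phi> ` mcarrier ?D \<subseteq> mcarrier V" using \<Phi>_closed by blast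
      show "0 \<in> \<Phi> ` mcarrier ?D"
        by (rule image_eqI[of _ _ 0]) (simp_all add: \<Phi>_def \<psi>0)
      show "v + w \<in> \<Phi> ` mcarrier ?D" if "v \<in> \<Phi> ` mcarrier ?D" "w \<in> \<Phi> ` mcarrier ?D" for v w
        using that by (auto simp: \<Phi>_add[symmetric] intro!: imageI)
    qed (auto simp: \<Phi>_act[symmetric] intro!: imageI)
  next
    fix i assume i: "i \<in> I"
    then obtain x where x: "x \<in> mcarrier (M i)" "w i = \<psi> i x" using \<psi>(6) by blast
    show "w i \<in> \<Phi> ` mcarrier ?D"
    proof (rule image_eqI[of _ _ "Poly_Mapping.single i x"])
      show "Poly_Mapping.single i x \<in> mcarrier ?D"
        using x i M0 by (auto simp: direct_sum_def lookup_single when_def)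
      have "\<Phi> (Poly_Mapping.single i x) = (\<Sum>j\<in>I. if j = i then \<psi> i x else 0)"
        unfolding \<Phi>_def by (intro sum.cong) (auto simp: lookup_single when_def \<psi>0)
      then show "w i = \<Phi> (Poly_Mapping.single i x)" using x i I by simp
    qed
  qed
  moreover have "inj_on \<Phi> (mcarrier ?D)"
  proof (rule inj_onI)
    fix f g assume f: "f \<in> mcarrier ?D" and g: "g \<in> mcarrier ?D" and eq: "\<Phi> f = \<Phi> g"
    let ?v = "\<lambda>i. \<psi> i (Poly_Mapping.lookup f i) - \<psi> i (Poly_Mapping.lookup g i)"
    have "\<forall>i\<in>I. ?v i = 0"
    proof (rule eigenvectors_independent[where C = casimir and c = ?c])
      show "inj_on ?c I" using inj unfolding inj_on_def of_nat_eq_iff .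
      show "sum ?v I = 0" using eq by (simp add: \<Phi>_def sum_subtractf)
      show "act casimir (?v i) = act (Uconst (?c i)) (?v i)" if "i \<in> I" for i
        using that by (simp only: act_diff \<psi>(1,2) comp f g)
    qed (use I in \<open>simp_all add: \<psi>(1) comp f g\<close>)
    then have "Poly_Mapping.lookup f i = Poly_Mapping.lookup g i" if "i \<in> I" for i
      using that \<psi>(4) comp f g by simp
    moreover have "Poly_Mapping.lookup f i = Poly_Mapping.lookup g i" if "i \<notin> I" for i
    proof -
      have "Poly_Mapping.lookup h i = 0" if "h \<in> mcarrier ?D" for h
        using that \<open>i \<notin> I\<close> unfolding direct_sum_def by (auto simp flip: not_in_keys_iff_lookup_eq_zero)
      then show ?thesis using f g by simp
    qed
    ultimately show "f = g" by (intro poly_mapping_eqI) blast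
  qed
  ultimately have "bij_betw \<Phi> (mcarrier ?D) (mcarrier V)" by (simp add: bij_betw_def)
  then have "?D \<cong>\<^sub>U V" by (rule lmod_isoI[OF D V]) (simp_all add: \<Phi>_add \<Phi>_act)
  then show ?thesis by (rule lmod_iso_sym)
qed

section \<open>Polynomials and derivations\<close>

lemma pscale_eq_const_mult: "pscale c f = const c * f"
  by (induction f rule: poly_mapping_linear_induct)
    (simp_all add: const_def mult_single distrib_left)

lemma const_zero [simp]: "const 0 = 0"
  and const_one [simp]: "const 1 = 1"
  and const_add: "const (c + d) = const c + const d"
  and const_mult: "const (c * d) = const c * const d"
  and const_uminus: "const (- c) = - const c"
  by (simp_all add: const_def single_add mult_single single_uminus)

lemma const_of_nat: "const (of_nat n) = of_nat n"
  by (simp add: const_def)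

lemma const_power: "const (c ^ n) = const c ^ n"
  by (induction n) (simp_all add: const_mult)

lemma pscale_mult_left: "pscale c f * g = pscale c (f * g)"
  and pscale_mult_right: "f * pscale c g = pscale c (f * g)" for f g :: "'v cpoly"
  by (simp_all add: pscale_eq_const_mult mult_ac)

lemma var_power: "var x ^ n = Poly_Mapping.single (Poly_Mapping.single x n) 1"
  by (induction n) (simp_all add: var_def mult_single single_add[symmetric])

text \<open>Updating an exponent vector at a fresh variable multiplies the monomial by a power of
  it. The restriction to variables in \<open>B\<close> suits symmetric algebras of spaces whose
  basis is only part of the type.\<close>

lemma cpoly_induct_on [consumes 1, case_names const var_mult add]:
  assumes "f \<in> span_of {m. Poly_Mapping.keys m \<subseteq> B}"
    and const: "\<And>c. P (const c)" and var: "\<And>x f. x \<in> B \<Longrightarrow> P f \<Longrightarrow> P (var x * f)"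
    and add: "\<And>f g. P f \<Longrightarrow> P g \<Longrightarrow> P (f + g)"
  shows "P f"
  using assms(1)
proof (induction rule: span_of_induct)
  case zero
  then show ?case using const[of 0] by simp
next
  case (single m c)
  have "Poly_Mapping.keys m \<subseteq> B \<longrightarrow> P (Poly_Mapping.single m c)"
  proof (induction m rule: update_induct)
    case const
    then show ?case using assms(2)[of c] by (simp add: const_def)
  next
    case (update m x n)
    have "Poly_Mapping.update x n m = Poly_Mapping.single x n + m"
      using update(1)
      by (intro poly_mapping_eqI) (auto simp: lookup_update lookup_add lookup_single when_def in_keys_iff)
    then have eq: "Poly_Mapping.single (Poly_Mapping.update x n m) c = var x ^ n * Poly_Mapping.single m c"
      by (simp add: var_power mult_single)
    have keys: "Poly_Mapping.keys (Poly_Mapping.update x n m) = insert x (Poly_Mapping.keys m)"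
      using update(2) by (auto simp: in_keys_iff lookup_update split: if_splits)
    have "P (var x ^ k * Poly_Mapping.single m c)" if "x \<in> B" "P (Poly_Mapping.single m c)" for k
      using that by (induction k) (simp_all add: mult.assoc var)
    then show ?case using update(3) unfolding eq keys by simp
  qed
  then show ?case using single by simp
qed (rule add)

lemma cpoly_induct [case_names const var_mult add]:
  assumes "\<And>c. P (const c)" and "\<And>x f. P f \<Longrightarrow> P (var x * f)" and "\<And>f g. P f \<Longrightarrow> P g \<Longrightarrow> P (f + g)"
  shows "P f"
  using assms by (intro cpoly_induct_on[of f UNIV P]) (simp_all add: span_of_def)

text \<open>Vanishing on constants together with the Leibniz rule yields complex linearity.\<close>

locale derivation =
  fixes d :: "'v cpoly \<Rightarrow> 'v cpoly"
  assumes add: "d (f + g) = d f + d g"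
    and mult: "d (f * g) = d f * g + f * d g"
    and const [simp]: "d (const c) = 0"
begin

lemma zero [simp]: "d 0 = 0"
  using const[of 0] by simp

lemma one [simp]: "d 1 = 0"
  using const[of 1] by simp

lemma uminus: "d (- f) = - d f"
  using add[of f "- f"] by (simp add: minus_unique)

lemma diff: "d (f - g) = d f - d g"
  using add[of f "- g"] by (simp add: uminus)

lemma scale: "d (pscale c f) = pscale c (d f)"
  by (simp add: pscale_eq_const_mult mult)

lemma sum: "d (sum h A) = (\<Sum>x\<in>A. d (h x))"
  by (induction A rule: infinite_finite_induct) (simp_all add: add)

lemma power_Suc: "d (f ^ Suc n) = of_nat (Suc n) * f ^ n * d f"
  by (induction n) (simp_all add: mult algebra_simps)

lemma power: "d (f ^ n) = of_nat n * f ^ (n - 1) * d f"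
  using power_Suc[of f "n - 1"] by (cases n) simp_all

end

lemma derivation_eq_on:
  assumes "derivation d" "derivation d'" and "\<And>x. x \<in> B \<Longrightarrow> d (var x) = d' (var x)"
    and "f \<in> span_of {m. Poly_Mapping.keys m \<subseteq> B}"
  shows "d f = d' f"
proof -
  interpret d: derivation d by fact
  interpret d': derivation d' by fact
  show ?thesis
    using assms(4) by (induction rule: cpoly_induct_on) (simp_all add: d.add d.mult d'.add d'.mult assms(3))
qed

lemma derivation_commutator:
  assumes "derivation d" "derivation d'"
  shows "derivation (\<lambda>f. d (d' f) - d' (d f))"
proof -
  interpret d: derivation d by fact
  interpret d': derivation d' by fact
  show ?thesis by unfold_locales (simp_all add: d.add d.mult d'.add d'.mult algebra_simps)
qed

lemma derivation_diff: "derivation d \<Longrightarrow> derivation d' \<Longrightarrow> derivation (\<lambda>f. d f - d' f)"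
  unfolding derivation_def by (simp add: algebra_simps)

lemma derivation_zero: "derivation (\<lambda>f. 0)"
  by unfold_locales simp_all

lemma derivation_sum:
  assumes "\<And>x. x \<in> A \<Longrightarrow> derivation (d x)"
  shows "derivation (\<lambda>f. \<Sum>x\<in>A. h x * d x f)"
proof
  have 1: "d x (f + g) = d x f + d x g" "d x (f * g) = d x f * g + f * d x g" "d x (const c) = 0"
    if "x \<in> A" for x f g c
    using assms[OF that] by (simp_all add: derivation_def)
  show "(\<Sum>x\<in>A. h x * d x (f + g)) = (\<Sum>x\<in>A. h x * d x f) + (\<Sum>x\<in>A. h x * d x g)" for f g
    by (simp add: 1 distrib_left sum.distrib)
  show "(\<Sum>x\<in>A. h x * d x (f * g)) = (\<Sum>x\<in>A. h x * d x f) * g + f * (\<Sum>x\<in>A. h x * d x g)" for f g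
    by (simp add: 1 distrib_left sum.distrib sum_distrib_left sum_distrib_right mult_ac)
  show "(\<Sum>x\<in>A. h x * d x (const c)) = 0" for c
    by (simp add: 1)
qed

lemma pderivative_single:
  "pderivative x (Poly_Mapping.single m c)
     = Poly_Mapping.single (m - Poly_Mapping.single x 1) (c * of_nat (Poly_Mapping.lookup m x))"
  by (simp add: pderivative_def)

lemma pderivative_add: "pderivative x (f + g) = pderivative x f + pderivative x g"
  by (simp add: pderivative_def lin_ext_add)

lemma pderivative_zero [simp]: "pderivative x 0 = 0"
  by (simp add: pderivative_def)

lemma pderivative_var: "pderivative x (var y) = (if x = y then 1 else 0)"
  by (simp add: var_def pderivative_single lookup_single)

interpretation pderivative: derivation "pderivative x"
proof
  show "pderivative x (f + g) = pderivative x f + pderivative x g" for f g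
    by (rule pderivative_add)
  show "pderivative x (const c) = 0" for c by (simp add: const_def pderivative_single)
  have mono: "pderivative x (Poly_Mapping.single m c * Poly_Mapping.single n e)
      = pderivative x (Poly_Mapping.single m c) * Poly_Mapping.single n e
        + Poly_Mapping.single m c * pderivative x (Poly_Mapping.single n e)" for m n c e
  proof -
    let ?x = "Poly_Mapping.single x (1::nat)"
    \<comment> \<open>Subtraction of exponents is truncated: the two exponents can differ only if x
      does not occur in m, and then the coefficient is 0.\<close>
    have 1: "Poly_Mapping.single (m - ?x + n) (c * of_nat (Poly_Mapping.lookup m x) * e)
        = Poly_Mapping.single (m + n - ?x) (c * of_nat (Poly_Mapping.lookup m x) * e)"
    proof (cases "Poly_Mapping.lookup m x = 0")
      case False
      then have "m - ?x + n = m + n - ?x"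
        by (intro poly_mapping_eqI) (auto simp: lookup_add lookup_minus lookup_single when_def)
      then show ?thesis by simp
    qed simp
    have 2: "Poly_Mapping.single (m + (n - ?x)) (c * (e * of_nat (Poly_Mapping.lookup n x)))
        = Poly_Mapping.single (m + n - ?x) (c * (e * of_nat (Poly_Mapping.lookup n x)))"
    proof (cases "Poly_Mapping.lookup n x = 0")
      case False
      then have "m + (n - ?x) = m + n - ?x"
        by (intro poly_mapping_eqI) (auto simp: lookup_add lookup_minus lookup_single when_def)
      then show ?thesis by simp
    qed simp
    show ?thesis
      unfolding pderivative_single mult_single 1 2 single_add[symmetric] lookup_add
      by (simp add: algebra_simps)
  qed
  show "pderivative x (f * g) = pderivative x f * g + f * pderivative x g" for f g
  proof (induction f rule: poly_mapping_linear_induct)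
    case (single m c)
    show ?case
      by (induction g rule: poly_mapping_linear_induct)
        (simp_all add: mono distrib_left pderivative_add algebra_simps)
  qed (simp_all add: distrib_right pderivative_add algebra_simps)
qed

lemma derivation_pderivative: "derivation (pderivative x)"
  by (rule pderivative.derivation_axioms)

section \<open>Substitution homomorphisms\<close>

definition monomial_value :: "('v \<Rightarrow> 'w cpoly) \<Rightarrow> ('v \<Rightarrow>\<^sub>0 nat) \<Rightarrow> 'w cpoly" where
  "monomial_value h m = (\<Prod>x\<in>Poly_Mapping.keys m. h x ^ Poly_Mapping.lookup m x)"

text \<open>Used to embed a tensor factor as a column of variables, and to show that a polynomial is
  nonzero by specializing it.\<close>

definition psubst :: "('v \<Rightarrow> 'w cpoly) \<Rightarrow> 'v cpoly \<Rightarrow> 'w cpoly" where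
  "psubst h = lin_ext (monomial_value h)"

lemma monomial_value_superset:
  "finite A \<Longrightarrow> Poly_Mapping.keys m \<subseteq> A \<Longrightarrow> monomial_value h m = (\<Prod>x\<in>A. h x ^ Poly_Mapping.lookup m x)"
  unfolding monomial_value_def by (intro prod.mono_neutral_left) (auto simp: in_keys_iff)

lemma monomial_value_add: "monomial_value h (m + n) = monomial_value h m * monomial_value h n"
proof -
  let ?A = "Poly_Mapping.keys m \<union> Poly_Mapping.keys n"
  have "Poly_Mapping.keys (m + n) \<subseteq> ?A" by (rule keys_add)
  then show ?thesis
    by (simp add: monomial_value_superset[of ?A] lookup_add power_add prod.distrib)
qed

lemma psubst_const [simp]: "psubst h (const c) = const c"
  by (simp add: psubst_def const_def monomial_value_def pscale_eq_const_mult)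

lemma psubst_zero [simp]: "psubst h 0 = 0"
  and psubst_add: "psubst h (f + g) = psubst h f + psubst h g"
  and psubst_diff: "psubst h (f - g) = psubst h f - psubst h g"
  by (simp_all add: psubst_def lin_ext_add lin_ext_minus)

lemma psubst_one [simp]: "psubst h 1 = 1"
  using psubst_const[of h 1] by simp

lemma psubst_var [simp]: "psubst h (var x) = h x"
  by (simp add: psubst_def var_def monomial_value_def)

lemma psubst_pscale: "psubst h (pscale c f) = pscale c (psubst h f)"
  by (simp add: psubst_def lin_ext_pscale)

lemma psubst_mult: "psubst h (f * g) = psubst h f * psubst h g"
proof (induction f rule: poly_mapping_linear_induct)
  case (single m c)
  show ?case
  proof (induction g rule: poly_mapping_linear_induct)
    case (single n e)
    show ?case
      by (simp add: mult_single psubst_def monomial_value_add pscale_mult_left pscale_mult_right mult.commute)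
  qed (simp_all add: distrib_left psubst_add)
qed (simp_all add: distrib_right psubst_add)

lemma psubst_power: "psubst h (f ^ n) = psubst h f ^ n"
  by (induction n) (simp_all add: psubst_mult)

section \<open>Representations by derivations\<close>

text \<open>Commutators and differences of derivations are derivations, so both sides are determined
  by the variables.\<close>

lemma commutator_derivations:
  assumes deriv: "\<And>i j. derivation (\<rho> i j)"
    and vars: "\<And>i j k l x. x \<in> B \<Longrightarrow> \<rho> i j (\<rho> k l (var x)) - \<rho> k l (\<rho> i j (var x))
        = (if j = k then \<rho> i l (var x) else 0) - (if l = i then \<rho> k j (var x) else 0)"
    and f: "f \<in> span_of {m. Poly_Mapping.keys m \<subseteq> B}"
  shows "\<rho> i j (\<rho> k l f) - \<rho> k l (\<rho> i j f) = (if j = k then \<rho> i l f else 0) - (if l = i then \<rho> k j f else 0)"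
proof (rule derivation_eq_on[where d = "\<lambda>f. \<rho> i j (\<rho> k l f) - \<rho> k l (\<rho> i j f)" and B = B
      and d' = "\<lambda>f. (if j = k then \<rho> i l f else 0) - (if l = i then \<rho> k j f else 0)"])
  show "derivation (\<lambda>f. \<rho> i j (\<rho> k l f) - \<rho> k l (\<rho> i j f))"
    by (rule derivation_commutator) (rule deriv)+
  have "derivation (\<lambda>f. if b then \<rho> i j f else 0)" for b i j
    by (cases b) (simp_all add: deriv derivation_zero)
  then show "derivation (\<lambda>f. (if j = k then \<rho> i l f else 0) - (if l = i then \<rho> k j f else 0))"
    by (intro derivation_diff)
qed (fact vars f)+

abbreviation polarization :: "2 \<Rightarrow> 2 \<Rightarrow> (2 \<times> 2) cpoly \<Rightarrow> (2 \<times> 2) cpoly" where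
  "polarization \<equiv> snd poly_rep"

lemma derivation_polarization: "derivation (polarization i j)"
  unfolding poly_rep_def snd_conv by (intro derivation_sum derivation_pderivative)

lemma polarization_var [simp]: "polarization i j (var (k, l)) = (if k = j then var (i, l) else 0)"
proof -
  have "polarization i j (var (k, l)) = (\<Sum>k'\<in>UNIV. if k' = l then (if k = j then var (i, l) else 0) else 0)"
    unfolding poly_rep_def snd_conv by (intro sum.cong) (auto simp: X_def pderivative_var)
  then show ?thesis by simp
qed

lemma is_rep_poly_rep: "is_rep (UNIV, polarization)"
proof -
  have comm: "polarization i j (polarization k l (var x)) - polarization k l (polarization i j (var x))
      = (if j = k then polarization i l (var x) else 0) - (if l = i then polarization k j (var x) else 0)" for i j k l x
  proof -
    interpret derivation "polarization i j" for i j by (rule derivation_polarization)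
    show ?thesis by (cases x) auto
  qed
  have comm': "polarization i j (polarization k l f) - polarization k l (polarization i j f)
      = (if j = k then polarization i l f else 0) - (if l = i then polarization k j f else 0)" for i j k l f
    using comm by (rule commutator_derivations[where B = UNIV, OF derivation_polarization]) (simp add: span_of_def)
  interpret derivation "polarization i j" for i j by (rule derivation_polarization)
  show ?thesis
    by (simp add: is_rep_def add scale comm' span_of_def)
qed

lemma module_of_poly_rep: "module_of poly_rep = module_of (UNIV, polarization)"
  by (simp add: module_of_def poly_rep_def)

section \<open>Homogeneous polynomials and symmetric powers\<close>

lemma mono_degree_superset:
  "finite A \<Longrightarrow> Poly_Mapping.keys m \<subseteq> A \<Longrightarrow> mono_degree m = (\<Sum>x\<in>A. Poly_Mapping.lookup m x)"
  unfolding mono_degree_def by (intro sum.mono_neutral_left) (auto simp: in_keys_iff)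

lemma mono_degree_add: "mono_degree (m + n) = mono_degree m + mono_degree n"
proof -
  let ?A = "Poly_Mapping.keys m \<union> Poly_Mapping.keys n"
  have "Poly_Mapping.keys (m + n) \<subseteq> ?A" by (rule keys_add)
  then show ?thesis
    by (simp add: mono_degree_superset[of ?A] lookup_add sum.distrib)
qed

lemma mono_degree_single [simp]: "mono_degree (Poly_Mapping.single x n) = n"
  by (cases "n = 0") (simp_all add: mono_degree_def)

abbreviation homogeneous :: "'v set \<Rightarrow> nat \<Rightarrow> 'v cpoly set" where
  "homogeneous B l \<equiv> span_of {m. Poly_Mapping.keys m \<subseteq> B \<and> mono_degree m = l}"

lemma homogeneous_mult:
  assumes "f \<in> homogeneous B k" "g \<in> homogeneous B l"
  shows "f * g \<in> homogeneous B (k + l)"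
proof -
  have "Poly_Mapping.keys x \<subseteq> B \<and> mono_degree x = k + l" if xk: "x \<in> Poly_Mapping.keys (f * g)" for x
  proof -
    obtain m n where m: "m \<in> Poly_Mapping.keys f" and n: "n \<in> Poly_Mapping.keys g" and x: "x = m + n"
      using xk keys_mult[of f g] by blast
    have "Poly_Mapping.keys m \<subseteq> B \<and> mono_degree m = k" "Poly_Mapping.keys n \<subseteq> B \<and> mono_degree n = l"
      using m n assms by (auto simp: span_of_def)
    then show ?thesis using keys_add[of m n] by (auto simp: x mono_degree_add)
  qed
  then show ?thesis by (auto simp: span_of_def)
qed

lemma homogeneous_var: "x \<in> B \<Longrightarrow> var x \<in> homogeneous B 1"
  by (simp add: var_def span_of_def)

lemma homogeneous_power: "f \<in> homogeneous B k \<Longrightarrow> f ^ n \<in> homogeneous B (n * k)"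
proof (induction n)
  case 0
  show ?case by (simp add: span_of_def mono_degree_def)
next
  case (Suc n)
  then have "f * f ^ n \<in> homogeneous B (k + n * k)" by (intro homogeneous_mult)
  then show ?case by simp
qed

lemma linear_form_homogeneous: "w \<in> span_of B \<Longrightarrow> lin_ext var w \<in> homogeneous B 1"
  by (rule span_of_lin_ext, rule homogeneous_var) (auto simp: span_of_def)

lemma pderivative_homogeneous:
  assumes "f \<in> homogeneous B (Suc l)"
  shows "pderivative x f \<in> homogeneous B l"
  using assms
proof (induction rule: span_of_induct)
  case (single m c)
  show ?case
  proof (cases "Poly_Mapping.lookup m x = 0")
    case False
    let ?n = "m - Poly_Mapping.single x 1"
    have m: "m = ?n + Poly_Mapping.single x 1"
      using False by (intro poly_mapping_eqI) (auto simp: lookup_add lookup_minus lookup_single when_def)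
    have "mono_degree m = Suc (mono_degree ?n)" by (subst m) (simp only: mono_degree_add mono_degree_single add_Suc_right add_0_right One_nat_def)
    moreover have "Poly_Mapping.keys ?n \<subseteq> Poly_Mapping.keys m"
      by (auto simp: in_keys_iff lookup_minus)
    ultimately show ?thesis
      using single by (auto simp: pderivative_single span_of_def)
  qed (simp add: pderivative_single)
qed (simp_all add: pderivative_add span_of_add)

lemma pderivative_not_in_vars: "x \<notin> vars f \<Longrightarrow> pderivative x f = 0"
  unfolding pderivative_def lin_ext_def
  by (intro sum.neutral) (auto simp: vars_def in_keys_iff)

lemma finite_vars: "finite (vars f)"
  by (simp add: vars_def)

lemma vars_add: "vars (f + g) \<subseteq> vars f \<union> vars g"
  unfolding vars_def using keys_add[of f g] by blast

lemma vars_mult: "vars (f * g) \<subseteq> vars f \<union> vars g"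
proof
  fix x assume "x \<in> vars (f * g)"
  then obtain k where k: "k \<in> Poly_Mapping.keys (f * g)" "x \<in> Poly_Mapping.keys k" by (auto simp: vars_def)
  obtain m n where "m \<in> Poly_Mapping.keys f" "n \<in> Poly_Mapping.keys g" "k = m + n"
    using k(1) keys_mult[of f g] by blast
  then show "x \<in> vars f \<union> vars g" using k(2) keys_add[of m n] by (auto simp: vars_def)
qed

lemma vars_const [simp]: "vars (const c) = {}"
  by (auto simp: vars_def const_def)

lemma vars_var [simp]: "vars (var x) = {x}"
  by (auto simp: vars_def var_def)

text \<open>The defining sum runs over the variables of its argument. A common index set for several
  arguments exhibits the operator on them as one fixed derivation.\<close>

lemma sym_rep_superset:
  assumes "finite A" "vars f \<subseteq> A"
  shows "snd (sym_rep l V) i j f = (\<Sum>b\<in>A. lin_ext var (snd V i j (basis_vec b)) * pderivative b f)"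
  unfolding sym_rep_def snd_conv using assms
  by (intro sum.mono_neutral_left) (auto simp: pderivative_not_in_vars)

lemma derivation_sym_rep: "derivation (snd (sym_rep l V) i j)"
proof
  fix f g :: "'a cpoly" and c
  let ?A = "vars f \<union> vars g"
  interpret D: derivation "\<lambda>f. \<Sum>b\<in>?A. lin_ext var (snd V i j (basis_vec b)) * pderivative b f"
    by (intro derivation_sum derivation_pderivative)
  have *: "snd (sym_rep l V) i j h = (\<Sum>b\<in>?A. lin_ext var (snd V i j (basis_vec b)) * pderivative b h)"
    if "h \<in> {f, g, f + g, f * g}" for h
    using that finite_vars vars_add[of f g] vars_mult[of f g] by (intro sym_rep_superset) auto
  show "snd (sym_rep l V) i j (f + g) = snd (sym_rep l V) i j f + snd (sym_rep l V) i j g"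
    "snd (sym_rep l V) i j (f * g) = snd (sym_rep l V) i j f * g + f * snd (sym_rep l V) i j g"
    by (simp_all only: * insertI1 insertI2 D.add D.mult)
  show "snd (sym_rep l V) i j (const c) = 0"
    by (simp add: sym_rep_def)
qed

lemma sym_rep_var: "snd (sym_rep l V) i j (var b) = lin_ext var (snd V i j (basis_vec b))"
  by (simp add: sym_rep_def pderivative_var)

text \<open>On linear forms the operators are those of \<open>V\<close>, so the commutation
  relations hold on variables and spread by \<open>commutator_derivations\<close>. The degree is
  kept since each term is a linear form times a derivative.\<close>

lemma is_rep_sym_rep:
  assumes V: "is_rep V"
  shows "is_rep (sym_rep l V)"
proof -
  obtain B \<rho> where V_eq: "V = (B, \<rho>)" by (cases V)
  note rep = V[unfolded V_eq]
  let ?\<sigma> = "snd (sym_rep l V)"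
  interpret derivation "?\<sigma> i j" for i j by (rule derivation_sym_rep)
  have var: "?\<sigma> i j (var b) = lin_ext var (\<rho> i j (basis_vec b))" for i j b
    by (simp add: sym_rep_var V_eq)
  have lin: "?\<sigma> i j (lin_ext var w) = lin_ext var (\<rho> i j w)" if "w \<in> span_of B" for i j w
    using that
  proof (induction rule: span_of_induct)
    case zero
    have "\<rho> i j 0 = 0" using rep_add[OF rep, of 0 0 i j] by simp
    then show ?case by simp
  next
    case (single b c)
    have "\<rho> i j (pscale c (basis_vec b)) = pscale c (\<rho> i j (basis_vec b))"
      using single by (intro rep_pscale[OF rep]) (simp add: span_of_def)
    then show ?case by (simp add: scale var lin_ext_pscale)
  next
    case (add f g)
    then show ?case by (simp add: lin_ext_add rep_add[OF rep] derivation.add[OF derivation_sym_rep])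
  qed
  have comm: "?\<sigma> i j (?\<sigma> k l' f) - ?\<sigma> k l' (?\<sigma> i j f) = (if j = k then ?\<sigma> i l' f else 0) - (if l' = i then ?\<sigma> k j f else 0)"
    if "f \<in> homogeneous B l" for f i j k l'
  proof (rule commutator_derivations[where B = B])
    show "f \<in> span_of {m. Poly_Mapping.keys m \<subseteq> B}" using that by (auto simp: span_of_def)
    fix i j k l' x assume "x \<in> B"
    then have x: "basis_vec x \<in> span_of B" by (simp add: span_of_def)
    have "lin_ext var (\<rho> i j (\<rho> k l' (basis_vec x)) - \<rho> k l' (\<rho> i j (basis_vec x)))
      = lin_ext var ((if j = k then \<rho> i l' (basis_vec x) else 0) - (if l' = i then \<rho> k j (basis_vec x) else 0))"
      using rep_commutator[OF rep x, of i j k l'] by (rule arg_cong)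
    then show "?\<sigma> i j (?\<sigma> k l' (var x)) - ?\<sigma> k l' (?\<sigma> i j (var x))
        = (if j = k then ?\<sigma> i l' (var x) else 0) - (if l' = i then ?\<sigma> k j (var x) else 0)"
      by (simp add: var lin rep_span[OF rep x] lin_ext_minus if_distrib[of "lin_ext var"])
  qed (rule derivation_sym_rep)
  have span: "?\<sigma> i j f \<in> homogeneous B l" if f: "f \<in> homogeneous B l" for f i j
    unfolding sym_rep_def snd_conv V_eq
  proof (rule span_of_sum)
    fix b assume b: "b \<in> vars f"
    then have "b \<in> B" using f by (auto simp: vars_def span_of_def)
    then have 1: "lin_ext var (\<rho> i j (basis_vec b)) \<in> homogeneous B 1"
      by (intro linear_form_homogeneous rep_span[OF rep]) (simp add: span_of_def)
    \<comment> \<open>A variable that occurs forces l > 0, so the derivative has degree l - 1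
      without truncation.\<close>
    obtain m where m: "m \<in> Poly_Mapping.keys f" "b \<in> Poly_Mapping.keys m" using b by (auto simp: vars_def)
    then have "mono_degree m \<noteq> 0" by (auto simp: mono_degree_def in_keys_iff)
    moreover have "mono_degree m = l" using m f by (auto simp: span_of_def)
    ultimately obtain l' where l': "l = Suc l'" by (cases l) auto
    show "lin_ext var (\<rho> i j (basis_vec b)) * pderivative b f \<in> homogeneous B l"
      using homogeneous_mult[OF 1 pderivative_homogeneous[of f B l']] f by (simp add: l')
  qed
  have eq: "sym_rep l V = ({m. Poly_Mapping.keys m \<subseteq> B \<and> mono_degree m = l}, ?\<sigma>)"
    by (simp add: sym_rep_def V_eq)
  show ?thesis
    unfolding is_rep_def
    by (subst eq, unfold prod.case, intro conjI allI ballI)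
      (erule span | rule derivation.add[OF derivation_sym_rep] | rule scale | erule comm)+
qed

lemma is_rep_natural_rep: "is_rep natural_rep"
  by (auto simp: is_rep_def natural_rep_def span_of_def lookup_add single_add lookup_single when_def)

section \<open>Generation of invariant subspaces\<close>

lemma const_numeral: "const (numeral k) = numeral k"
  using const_of_nat[of "numeral k"] by simp

lemma const_sum: "const (sum h A) = (\<Sum>x\<in>A. const (h x))"
  by (induction A rule: infinite_finite_induct) (simp_all add: const_add)

text \<open>Later \<open>d\<close> and \<open>e\<close> are E_21 and E_12, in either order, and
  \<open>N\<close> is a submodule.\<close>

locale stable_subspace = d: derivation d + e: derivation e
  for d e :: "'v cpoly \<Rightarrow> 'v cpoly" +
  fixes N :: "'v cpoly set"
  assumes zero: "0 \<in> N"
    and add: "f \<in> N \<Longrightarrow> g \<in> N \<Longrightarrow> f + g \<in> N"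
    and scale: "f \<in> N \<Longrightarrow> const c * f \<in> N"
    and d: "f \<in> N \<Longrightarrow> d f \<in> N"
    and e: "f \<in> N \<Longrightarrow> e f \<in> N"
begin

lemma uminus: "f \<in> N \<Longrightarrow> - f \<in> N"
  using scale[of f "- 1"] by (simp add: const_uminus)

lemma diff: "f \<in> N \<Longrightarrow> g \<in> N \<Longrightarrow> f - g \<in> N"
  using add[of f "- g"] by (simp add: uminus)

lemma sum: "(\<And>x. x \<in> A \<Longrightarrow> h x \<in> N) \<Longrightarrow> sum h A \<in> N"
  by (induction A rule: infinite_finite_induct) (simp_all add: zero add)

lemma scale_cancel:
  assumes "const c * f \<in> N" "c \<noteq> 0"
  shows "f \<in> N"
proof -
  have "const (1 / c) * (const c * f) = f"
    using assms(2) by (simp add: const_mult[symmetric] mult.assoc[symmetric])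
  then show ?thesis using scale[OF assms(1), of "1 / c"] by simp
qed

lemma of_nat_cancel: "of_nat n * f \<in> N \<Longrightarrow> n \<noteq> 0 \<Longrightarrow> f \<in> N"
  using scale_cancel[of "of_nat n" f] by (simp add: const_of_nat)

text \<open>Modulo \<open>N\<close> the relations make every \<open>Y i\<close> equal to c i / c 0
  times \<open>Y 0\<close>. The extra combination then says that a nonzero multiple of
  \<open>Y 0\<close> lies in \<open>N\<close>.\<close>

lemma two_term_relations:
  assumes rel: "\<And>i. i < s \<Longrightarrow> const (p i) * Y i + const (q i) * Y (Suc i) \<in> N"
    and q: "\<And>i. i < s \<Longrightarrow> q i \<noteq> 0"
    and rec: "\<And>i. i < s \<Longrightarrow> q i * c (Suc i) = - p i * c i"
    and c0: "c 0 \<noteq> 0"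
    and comb: "(\<Sum>i\<le>s. const (b i) * Y i) \<in> N"
    and nz: "(\<Sum>i\<le>s. b i * c i) \<noteq> 0"
    and i: "i \<le> s"
  shows "Y i \<in> N"
proof -
  have mod: "const (c 0) * Y i - const (c i) * Y 0 \<in> N" if "i \<le> s" for i
    using that
  proof (induction i)
    case 0
    then show ?case by (simp add: zero)
  next
    case (Suc i)
    then have IH: "const (c 0) * Y i - const (c i) * Y 0 \<in> N" by simp
    have "const (q i) * (const (c 0) * Y (Suc i) - const (c (Suc i)) * Y 0)
        = const (c 0) * (const (p i) * Y i + const (q i) * Y (Suc i))
          - const (p i) * (const (c 0) * Y i) - const (q i * c (Suc i)) * Y 0"
      by (simp add: const_mult algebra_simps)
    also have "\<dots> = const (c 0) * (const (p i) * Y i + const (q i) * Y (Suc i))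
          - const (p i) * (const (c 0) * Y i - const (c i) * Y 0)"
      using Suc.prems by (simp add: rec const_mult const_uminus algebra_simps)
    also have "\<dots> \<in> N"
      using Suc.prems by (intro diff scale rel IH) simp
    finally show ?case using scale_cancel q Suc.prems by simp
  qed
  have "const (c 0) * (\<Sum>i\<le>s. const (b i) * Y i) - (\<Sum>i\<le>s. const (b i) * (const (c 0) * Y i - const (c i) * Y 0))
      = (\<Sum>i\<le>s. const (b i * c i) * Y 0)"
    by (simp add: sum_distrib_left sum_subtractf[symmetric] const_mult algebra_simps)
  also have "\<dots> = const (\<Sum>i\<le>s. b i * c i) * Y 0"
    by (simp add: const_sum sum_distrib_right)
  finally have eq: "const (c 0) * (\<Sum>i\<le>s. const (b i) * Y i)
      - (\<Sum>i\<le>s. const (b i) * (const (c 0) * Y i - const (c i) * Y 0)) = const (\<Sum>i\<le>s. b i * c i) * Y 0" .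
  have "const (\<Sum>i\<le>s. b i * c i) * Y 0 \<in> N"
    unfolding eq[symmetric] by (intro diff scale comb sum mod) simp
  then have Y0: "Y 0 \<in> N" using nz scale_cancel by blast
  have "const (c 0) * Y i = (const (c 0) * Y i - const (c i) * Y 0) + const (c i) * Y 0" by simp
  also have "\<dots> \<in> N" by (intro add mod i scale Y0)
  finally show ?thesis using c0 scale_cancel by blast
qed

end

text \<open>
  With \<open>s = l - m\<close>, the quotient of the span of the \<open>D\<^sup>m u\<^sup>i v\<^sup>s\<^sup>-\<^sup>i\<close> by the image of the level \<open>m + 1\<close>
  under \<open>E\<^sub>2\<^sub>1\<close> is a line on which the class of \<open>D\<^sup>m u\<^sup>i v\<^sup>s\<^sup>-\<^sup>i\<close> is proportional to
  \<open>(- 1)\<^sup>i (m + i)! (m + s - i)!\<close>; \<open>kappa m s \<alpha>\<close> is the resulting coordinate of \<open>D\<^sup>m (u + \<alpha> v)\<^sup>s\<close>.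
\<close>

definition kappa :: "nat \<Rightarrow> nat \<Rightarrow> complex \<Rightarrow> complex" where
  "kappa m s \<alpha> = (\<Sum>i\<le>s. of_nat (s choose i) * \<alpha> ^ (s - i) * ((- 1) ^ i * fact (m + i) * fact (m + s - i)))"

text \<open>The relations are invariant under exchanging \<open>d, D\<close> with \<open>e, D'\<close>, so each statement below also
  holds with \<open>D'\<close> in place of \<open>D\<close>.\<close>

locale bidegree = stable_subspace d e N
  for d e :: "'v cpoly \<Rightarrow> 'v cpoly" and N +
  fixes D D' u v :: "'v cpoly"
  assumes d_u [simp]: "d u = D'" and d_v [simp]: "d v = D'" and d_D [simp]: "d D = u + v" and d_D' [simp]: "d D' = 0"
    and e_u [simp]: "e u = D" and e_v [simp]: "e v = D" and e_D' [simp]: "e D' = u + v" and e_D [simp]: "e D = 0"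
    and DD': "D * D' = u * v"
begin

text \<open>Differentiating u or v produces D', which one factor D turns into u v; this is why the
  result consists of monomials of level m again.\<close>

lemma d_monomial:
  "d (D ^ Suc m * u ^ i * v ^ j)
     = of_nat (m + 1 + i) * (D ^ m * u ^ i * v ^ Suc j) + of_nat (m + 1 + j) * (D ^ m * u ^ Suc i * v ^ j)"
proof -
  \<comment> \<open>Absorbs the truncated exponent: for i = 0 both sides vanish.\<close>
  have u: "u * (of_nat i * u ^ (i - 1)) = of_nat i * u ^ i" by (cases i) simp_all
  have v: "v * (of_nat j * v ^ (j - 1)) = of_nat j * v ^ j" by (cases j) simp_all
  have "d (D ^ Suc m * u ^ i * v ^ j)
     = of_nat (Suc m) * D ^ m * (u + v) * u ^ i * v ^ j
       + D ^ m * (D * D') * (of_nat i * u ^ (i - 1) * v ^ j + u ^ i * (of_nat j * v ^ (j - 1)))"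
    unfolding d.mult d.power_Suc d.power[of u] d.power[of v] by (simp add: algebra_simps)
  also have "\<dots> = of_nat (Suc m) * D ^ m * (u + v) * u ^ i * v ^ j
       + D ^ m * ((u * (of_nat i * u ^ (i - 1))) * v * v ^ j + u * u ^ i * (v * (of_nat j * v ^ (j - 1))))"
    unfolding DD' by (simp add: algebra_simps)
  also have "\<dots> = of_nat (m + 1 + i) * (D ^ m * u ^ i * v ^ Suc j) + of_nat (m + 1 + j) * (D ^ m * u ^ Suc i * v ^ j)"
    unfolding u v by (simp add: algebra_simps)
  finally show ?thesis .
qed

lemma monomials_step:
  assumes next_level: "\<And>i j. Suc m + i + j = l \<Longrightarrow> D ^ Suc m * u ^ i * v ^ j \<in> N"
    and comb: "D ^ m * (u + const \<alpha> * v) ^ (l - m) \<in> N" and nz: "kappa m (l - m) \<alpha> \<noteq> 0"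
    and ij: "m + i + j = l"
  shows "D ^ m * u ^ i * v ^ j \<in> N"
proof -
  define s where "s = l - m"
  let ?Y = "\<lambda>i. D ^ m * u ^ i * v ^ (s - i)"
  have "?Y i \<in> N"
  \<comment> \<open>\<open>p\<close> and \<open>q\<close> are the coefficients in
    \<open>d_monomial\<close> at j = s - Suc i, the factorials solve the resulting recurrence, and
    \<open>b\<close> lists the binomial coefficients of D^m (u + \<alpha> v)^s.\<close>
  proof (rule two_term_relations[where Y = ?Y and i = i and s = s and p = "\<lambda>i. of_nat (m + 1 + i)" and q = "\<lambda>i. of_nat (m + s - i)"
        and c = "\<lambda>i. (- 1) ^ i * fact (m + i) * fact (m + s - i)"
        and b = "\<lambda>i. of_nat (s choose i) * \<alpha> ^ (s - i)"])
    show "const (of_nat (m + 1 + i)) * ?Y i + const (of_nat (m + s - i)) * ?Y (Suc i) \<in> N" if "i < s" for i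
    proof -
      have "d (D ^ Suc m * u ^ i * v ^ (s - Suc i)) \<in> N"
        using that by (intro d next_level) (simp add: s_def)
      moreover have "Suc (s - Suc i) = s - i" "m + 1 + (s - Suc i) = m + s - i" using that by auto
      ultimately show ?thesis by (simp only: d_monomial const_of_nat)
    qed
    show "of_nat (m + s - i) * ((- 1) ^ Suc i * fact (m + Suc i) * fact (m + s - Suc i))
        = - of_nat (m + 1 + i) * ((- 1) ^ i * fact (m + i) * (fact (m + s - i) :: complex))" if "i < s" for i
    proof -
      have "m + s - i = Suc (m + s - Suc i)" using that by simp
      then have "(fact (m + s - i) :: complex) = of_nat (m + s - i) * fact (m + s - Suc i)" by simp
      then show ?thesis by (simp add: algebra_simps)
    qed
    have "(\<Sum>i\<le>s. const (of_nat (s choose i) * \<alpha> ^ (s - i)) * ?Y i) = D ^ m * (u + const \<alpha> * v) ^ s"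
      by (simp add: binomial_ring sum_distrib_left const_mult const_of_nat const_power power_mult_distrib mult_ac)
    then show "(\<Sum>i\<le>s. const (of_nat (s choose i) * \<alpha> ^ (s - i)) * ?Y i) \<in> N"
      using comb by (simp add: s_def)
    show "(\<Sum>i\<le>s. of_nat (s choose i) * \<alpha> ^ (s - i) * ((- 1) ^ i * fact (m + i) * fact (m + s - i))) \<noteq> 0"
      using nz by (simp add: kappa_def s_def)
  qed (use ij in \<open>auto simp: s_def\<close>)
  moreover have "s - i = j" using ij by (simp add: s_def)
  ultimately show ?thesis by simp
qed

text \<open>Descending induction on the level m. It is run as an induction on k with l < m + k,
  whose base case is vacuous.\<close>

lemma monomials_upper:
  assumes comb: "\<And>m. m \<le> l \<Longrightarrow> D ^ m * (u + const \<alpha> * v) ^ (l - m) \<in> N"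
    and nz: "\<And>m. m \<le> l \<Longrightarrow> kappa m (l - m) \<alpha> \<noteq> 0"
    and ij: "m + i + j = l"
  shows "D ^ m * u ^ i * v ^ j \<in> N"
proof -
  have "D ^ m * u ^ i * v ^ j \<in> N" if "l < m + k" "m + i + j = l" for k m i j
    using that
  proof (induction k arbitrary: m i j)
    case (Suc k)
    show ?case
      by (rule monomials_step[OF Suc.IH comb nz Suc.prems(2)]) (use Suc.prems in auto)
  qed simp
  from this[of m "Suc l"] show ?thesis using ij by simp
qed

text \<open>E_12 kills D and maps u + \<alpha> v to (1 + \<alpha>) D, so each application trades one
  factor u + \<alpha> v for D at a nonzero cost.\<close>

lemma power_combination:
  assumes "(u + const \<alpha> * v) ^ l \<in> N" "\<alpha> \<noteq> - 1" "m \<le> l"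
  shows "D ^ m * (u + const \<alpha> * v) ^ (l - m) \<in> N"
  using assms(3)
proof (induction m)
  case (Suc m)
  let ?f = "u + const \<alpha> * v"
  obtain s where s: "l - m = Suc s" "l - Suc m = s" using Suc.prems by (metis Suc_diff_Suc Suc_le_eq)
  have "e (D ^ m * ?f ^ Suc s) \<in> N" using Suc s by (intro e) simp
  moreover have "e (D ^ m * ?f ^ Suc s) = const (of_nat (Suc s) * (1 + \<alpha>)) * (D ^ Suc m * ?f ^ s)"
    unfolding e.mult e.power_Suc e.power[of D] by (simp add: e.add e.mult const_mult const_add const_of_nat algebra_simps)
  moreover have "of_nat (Suc s) * (1 + \<alpha>) \<noteq> 0"
    using assms(2) by (simp only: mult_eq_0_iff of_nat_eq_0_iff add_eq_0_iff) simp
  ultimately show ?case using scale_cancel s by simp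
qed (use assms in simp)

end

text \<open>The operators of the three-dimensional irreducible representation. D, p, D' may be
  quadratic polynomials or, up to scalars, independent variables.\<close>

locale symmetric_square = stable_subspace d e N
  for d e :: "'v cpoly \<Rightarrow> 'v cpoly" and N +
  fixes D D' p :: "'v cpoly"
  assumes d_D [simp]: "d D = p" and d_p [simp]: "d p = 2 * D'" and d_D' [simp]: "d D' = 0"
    and e_D' [simp]: "e D' = p" and e_p [simp]: "e p = 2 * D" and e_D [simp]: "e D = 0"
begin

text \<open>Applying E_12 to D^(a - 1) p^(b + 1) D'^c gives a nonzero multiple of the wanted
  monomial plus one with smaller a + c; E_21 does the same for D'.\<close>

lemma monomials_if_power:
  assumes "p ^ l \<in> N" and "a + b + c = l"
  shows "D ^ a * p ^ b * D' ^ c \<in> N"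
  using assms(2)
proof (induction "a + c" arbitrary: a b c rule: less_induct)
  case less
  have d_mono: "d (D ^ a * p ^ Suc b * D' ^ c) = of_nat (2 * Suc b) * (D ^ a * p ^ b * D' ^ Suc c)
      + of_nat a * (D ^ (a - 1) * p ^ (b + 2) * D' ^ c)"
    and e_mono: "e (D ^ a * p ^ Suc b * D' ^ c) = of_nat (2 * Suc b) * (D ^ Suc a * p ^ b * D' ^ c)
      + of_nat c * (D ^ a * p ^ (b + 2) * D' ^ (c - 1))" for a b c
    unfolding d.mult e.mult d.power_Suc e.power_Suc d.power[of D] d.power[of D'] e.power[of D] e.power[of D']
    by (simp_all add: algebra_simps power2_eq_square)
  consider "a = 0" "c = 0" | a' where "a = Suc a'" | c' where "c = Suc c'" by (cases a; cases c) auto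
  then show ?case
  proof cases
    case 1
    then show ?thesis using assms(1) less.prems by simp
  next
    case 2
    have 1: "D ^ a' * p ^ Suc b * D' ^ c \<in> N" using 2 less.prems by (intro less.hyps) auto
    have 2: "of_nat c * (D ^ a' * p ^ (b + 2) * D' ^ (c - 1)) \<in> N"
    proof (cases c)
      case (Suc c')
      have "D ^ a' * p ^ (b + 2) * D' ^ (c - 1) \<in> N" using 2 Suc less.prems by (intro less.hyps) auto
      from scale[OF this, of "of_nat c"] show ?thesis by (simp only: const_of_nat)
    qed (simp add: zero)
    have "of_nat (2 * Suc b) * (D ^ Suc a' * p ^ b * D' ^ c) \<in> N"
      using diff[OF e[OF 1] 2] unfolding e_mono by simp
    then have "D ^ Suc a' * p ^ b * D' ^ c \<in> N" by (rule of_nat_cancel) simp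
    then show ?thesis using \<open>a = Suc a'\<close> by simp
  next
    case 3
    have 1: "D ^ a * p ^ Suc b * D' ^ c' \<in> N" using 3 less.prems by (intro less.hyps) auto
    have 2: "of_nat a * (D ^ (a - 1) * p ^ (b + 2) * D' ^ c') \<in> N"
    proof (cases a)
      case (Suc a')
      have "D ^ (a - 1) * p ^ (b + 2) * D' ^ c' \<in> N" using 3 Suc less.prems by (intro less.hyps) auto
      from scale[OF this, of "of_nat a"] show ?thesis by (simp only: const_of_nat)
    qed (simp add: zero)
    have "of_nat (2 * Suc b) * (D ^ a * p ^ b * D' ^ Suc c') \<in> N"
      using diff[OF d[OF 1] 2] unfolding d_mono by simp
    then have "D ^ a * p ^ b * D' ^ Suc c' \<in> N" by (rule of_nat_cancel) simp
    then show ?thesis using \<open>c = Suc c'\<close> by simp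
  qed
qed

text \<open>The scheme of \<open>monomials_upper\<close> for the monomials D^m p^b (D D')^c with m +
  b + 2 c = l. Level m + 1 determines level m up to a line, which the highest weight vector reaches
  if l - m is even; if l - m is odd the relations already suffice.\<close>

lemma power_if_discriminants:
  assumes discr: "\<And>j. 2 * j \<le> l \<Longrightarrow> D ^ (l - 2 * j) * (p ^ 2 - 4 * D * D') ^ j \<in> N"
  shows "p ^ l \<in> N"
proof -
  have d_mono: "d (D ^ Suc (m + c) * p ^ b * D' ^ c)
      = of_nat (m + 1 + c) * (D ^ m * p ^ Suc b * (D * D') ^ c) + of_nat (2 * b) * (D ^ m * p ^ (b - 1) * (D * D') ^ Suc c)"
    for m b c
    unfolding d.mult d.power_Suc d.power[of p] d.power[of D']
    by (simp add: algebra_simps power_mult_distrib power_add)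
  have "D ^ m * p ^ b * (D * D') ^ c \<in> N" if "l < m + k" "m + b + 2 * c = l" for k m b c
    using that
  proof (induction k arbitrary: m b c)
    case (Suc k)
    define s where "s = l - m"
    define h where "h = s div 2"
    let ?Y = "\<lambda>c. D ^ m * p ^ (s - 2 * c) * (D * D') ^ c"
    let ?r = "\<lambda>c. of_nat (m + 1 + c) * ?Y c + of_nat (2 * (s - 1 - 2 * c)) * ?Y (Suc c)"
    have rel: "?r c \<in> N" if c: "2 * c < s" for c
    proof -
      have "D ^ Suc m * p ^ (s - 1 - 2 * c) * (D * D') ^ c \<in> N"
        using c Suc.prems by (intro Suc.IH) (auto simp: s_def)
      then have "D ^ Suc (m + c) * p ^ (s - 1 - 2 * c) * D' ^ c \<in> N"
        by (simp add: power_mult_distrib power_add mult_ac)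
      then have "d (D ^ Suc (m + c) * p ^ (s - 1 - 2 * c) * D' ^ c) \<in> N" by (rule d)
      moreover have "Suc (s - 1 - 2 * c) = s - 2 * c" "s - 1 - 2 * c - 1 = s - 2 * Suc c" using c by auto
      ultimately show ?thesis by (simp only: d_mono)
    qed
    define P where "P i = (of_nat (m + 1 + i) :: complex)" for i
    define Q where "Q i = (of_nat (2 * (s - 1 - 2 * i)) :: complex)" for i
    \<comment> \<open>The solution of the recurrence up to the sign (-1)^i; real, so that positivity
      can be used below.\<close>
    define a where "a i = (\<Prod>k<i. (of_nat (m + 1 + k) / of_nat (2 * (s - 1 - 2 * k)) :: real))" for i
    have Q: "Q i \<noteq> 0" if "i < h" for i using that by (simp add: Q_def h_def del: of_nat_mult of_nat_diff)
    have apos: "a i > 0" if "i \<le> h" for i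
      unfolding a_def using that by (intro prod_pos) (auto simp: h_def simp del: of_nat_add of_nat_mult of_nat_Suc)
    \<comment> \<open>For even s these are the coefficients of D^m (p^2 - 4 D D')^h. For odd s the
      relation at c = h has second coefficient 0 and puts \<open>?Y h\<close> itself into N, so a
      unit vector serves.\<close>
    define b' where "b' i = (if even s then of_nat (h choose i) * (- 4) ^ i else if i = h then 1 else 0 :: complex)" for i
    have "?Y c \<in> N"
    proof (rule two_term_relations[where Y = ?Y and i = c and s = h and p = P and q = Q and c = "\<lambda>i. (- 1) ^ i * of_real (a i)" and b = b'])
      show "const (P i) * ?Y i + const (Q i) * ?Y (Suc i) \<in> N" if "i < h" for i
        using rel[of i] that unfolding P_def Q_def const_of_nat h_def by auto
      show "Q i * ((- 1) ^ Suc i * of_real (a (Suc i))) = - P i * ((- 1) ^ i * of_real (a i))" if "i < h" for i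
      proof -
        have "complex_of_real (a (Suc i)) = of_real (a i) * (P i / Q i)"
          by (simp add: a_def P_def Q_def)
        then show ?thesis using Q[OF that] by simp
      qed
      show "(\<Sum>i\<le>h. const (b' i) * ?Y i) \<in> N"
      proof (cases "even s")
        case True
        then have s: "s = 2 * h" by (simp add: h_def)
        have "(\<Sum>i\<le>h. const (b' i) * ?Y i) = D ^ m * (- 4 * (D * D') + p ^ 2) ^ h"
          unfolding binomial_ring sum_distrib_left
        proof (intro sum.cong refl)
          fix i assume "i \<in> {..h}"
          then have "2 * h - 2 * i = 2 * (h - i)" by simp
          moreover have "(- 4 * (D * D')) ^ i = const ((- 4) ^ i) * D ^ i * D' ^ i"
            by (simp add: const_power const_uminus const_numeral power_mult_distrib[symmetric] mult_ac)
          ultimately show "const (b' i) * ?Y i = D ^ m * (of_nat (h choose i) * (- 4 * (D * D')) ^ i * (p ^ 2) ^ (h - i))"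
            by (simp add: b'_def True const_mult const_of_nat s power_mult[symmetric] power_mult_distrib mult_ac)
        qed
        also have "- 4 * (D * D') + p ^ 2 = p ^ 2 - 4 * D * D'" by (simp add: algebra_simps)
        finally have "(\<Sum>i\<le>h. const (b' i) * ?Y i) = D ^ m * (p ^ 2 - 4 * D * D') ^ h" .
        moreover have "l - 2 * h = m" "2 * h \<le> l" using s Suc.prems by (auto simp: s_def)
        ultimately show ?thesis using discr[of h] by simp
      next
        case False
        then have s: "s = 2 * h + 1" by (simp add: h_def)
        have "of_nat (m + 1 + h) * ?Y h \<in> N" using rel[of h] by (simp add: s)
        then have "?Y h \<in> N" by (rule of_nat_cancel) simp
        moreover have "(\<Sum>i\<le>h. const (b' i) * ?Y i) = (\<Sum>i\<le>h. if i = h then ?Y h else 0)"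
          by (intro sum.cong) (auto simp: b'_def False)
        ultimately show ?thesis by simp
      qed
      show "(\<Sum>i\<le>h. b' i * ((- 1) ^ i * of_real (a i))) \<noteq> 0"
      proof (cases "even s")
        case True
        \<comment> \<open>The alternating signs of the discriminant and of the recurrence cancel,
          leaving a sum of positive terms.\<close>
        have "(\<Sum>i\<le>h. b' i * ((- 1) ^ i * of_real (a i))) = of_real (\<Sum>i\<le>h. of_nat (h choose i) * 4 ^ i * a i)"
          unfolding of_real_sum
        proof (intro sum.cong refl)
          fix i
          have "(- 4 :: complex) ^ i * (- 1) ^ i = 4 ^ i" by (simp add: power_mult_distrib[symmetric])
          then show "b' i * ((- 1) ^ i * of_real (a i)) = complex_of_real (of_nat (h choose i) * 4 ^ i * a i)"
            by (simp add: b'_def True mult.assoc)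
        qed
        moreover have "(\<Sum>i\<le>h. of_nat (h choose i) * 4 ^ i * a i) > 0"
          by (intro sum_pos) (auto intro!: mult_pos_pos apos)
        ultimately show ?thesis by (simp only: of_real_eq_0_iff)
      next
        case False
        have "(\<Sum>i\<le>h. b' i * ((- 1) ^ i * of_real (a i))) = (\<Sum>i\<le>h. if i = h then (- 1) ^ h * of_real (a h) else 0)"
          by (intro sum.cong) (auto simp: b'_def False)
        then show ?thesis using apos[of h] by simp
      qed
      show "c \<le> h" using Suc.prems by (auto simp: h_def s_def)
    qed (use Q in \<open>simp_all add: a_def\<close>)
    moreover have "s - 2 * c = b" using Suc.prems by (simp add: s_def)
    ultimately show ?case by simp
  qed simp
  from this[of 0 "Suc l" l 0] show ?thesis by simp
qed

end

section \<open>Zeros on the unit circle\<close>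

text \<open>The power series of \<open>(1 - x t)\<^sup>-\<^sup>k\<^sup>-\<^sup>1\<close>.\<close>

definition neg_power_fps :: "complex \<Rightarrow> nat \<Rightarrow> complex fps" where
  "neg_power_fps x k = Abs_fps (\<lambda>n. of_nat ((n + k) choose k) * x ^ n)"

text \<open>Coefficientwise this is Pascal's rule.\<close>

lemma neg_power_fps_Suc:
  "(1 - fps_const x * fps_X) * neg_power_fps x (Suc k) = neg_power_fps x k"
proof (rule fps_ext)
  fix n
  show "fps_nth ((1 - fps_const x * fps_X) * neg_power_fps x (Suc k)) n = fps_nth (neg_power_fps x k) n"
    by (cases n) (simp_all add: neg_power_fps_def left_diff_distrib mult.assoc algebra_simps)
qed

lemma fps_deriv_neg_power:
  "fps_deriv (neg_power_fps x k) = fps_const (of_nat (Suc k) * x) * neg_power_fps x (Suc k)"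
proof (rule fps_ext)
  fix n
  have "Suc n * ((Suc n + k) choose k) = Suc k * ((n + Suc k) choose Suc k)"
  proof -
    have "Suc k * (Suc (n + k) choose Suc k) = Suc (n + k) * ((n + k) choose k)"
      using Suc_times_binomial_eq[of "n + k" k] by simp
    moreover have "Suc n * ((Suc (n + k)) choose k) = Suc (n + k) * ((n + k) choose k)"
      using binomial_absorb_comp[of "Suc (n + k)" k] by (simp add: Suc_diff_le)
    ultimately show ?thesis by simp
  qed
  then have "of_nat (Suc n) * of_nat ((Suc n + k) choose k) = (of_nat (Suc k) * of_nat ((n + Suc k) choose Suc k) :: complex)"
    by (metis of_nat_mult)
  then show "fps_nth (fps_deriv (neg_power_fps x k)) n
      = fps_nth (fps_const (of_nat (Suc k) * x) * neg_power_fps x (Suc k)) n"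
    unfolding neg_power_fps_def fps_deriv_nth fps_mult_left_const_nth fps_nth_Abs_fps
    by (simp only: Suc_eq_plus1[symmetric] mult.assoc[symmetric]) (simp add: mult_ac)
qed

text \<open>The cross terms 2 c d Re(P cnj Q) agree in both squares and cancel.\<close>

lemma cmod_swap_diff:
  "(cmod (of_real c * P + of_real d * Q))\<^sup>2 - (cmod (of_real d * P + of_real c * Q))\<^sup>2
     = (c\<^sup>2 - d\<^sup>2) * ((cmod P)\<^sup>2 - (cmod Q)\<^sup>2)"
  unfolding cmod_power2 by (simp add: power2_eq_square algebra_simps)

lemma cmod_swap_less_iff:
  assumes "0 < d" "d < c"
  shows "cmod (of_real d * P + of_real c * Q) < cmod (of_real c * P + of_real d * Q) \<longleftrightarrow> cmod Q < cmod P"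
proof -
  have "c\<^sup>2 - d\<^sup>2 > 0" using assms by (simp add: power_strict_mono)
  then have "(cmod Q)\<^sup>2 < (cmod P)\<^sup>2 \<longleftrightarrow> 0 < (c\<^sup>2 - d\<^sup>2) * ((cmod P)\<^sup>2 - (cmod Q)\<^sup>2)"
    by (simp add: zero_less_mult_iff)
  moreover have "(cmod z)\<^sup>2 < (cmod w)\<^sup>2 \<longleftrightarrow> cmod z < cmod w" for z w
    by (meson norm_ge_zero pos2 power2_less_imp_less power_strict_mono)
  ultimately show ?thesis
    unfolding cmod_swap_diff[symmetric] by simp
qed

text \<open>
  With \<open>A\<^sub>k\<close> and \<open>B\<^sub>k\<close> the series at \<open>1\<close> and at \<open>x\<close>, the derivative of \<open>A\<^sub>m B\<^sub>m\<close> is a multiple of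
  \<open>G + x H\<close> for \<open>G = A\<^sub>m\<^sub>+\<^sub>1 B\<^sub>m\<close> and \<open>H = A\<^sub>m B\<^sub>m\<^sub>+\<^sub>1\<close>. The coefficients \<open>P n\<close> of \<open>G\<close> and \<open>Q n\<close> of
  \<open>x H\<close> satisfy a symmetric two-term recurrence, up to a factor \<open>x\<close> in that of \<open>Q\<close>, which preserves
  \<open>|Q| < |P|\<close> when \<open>|x| < 1\<close> and \<open>|P| < |Q|\<close> when \<open>|x| > 1\<close>; hence they never cancel.
\<close>

lemma fps_nth_product_nonzero:
  assumes "cmod x \<noteq> 1"
  shows "fps_nth (neg_power_fps 1 m * neg_power_fps x m) s \<noteq> 0"
proof -
  define F where "F = neg_power_fps 1 m * neg_power_fps x m"
  define G where "G = neg_power_fps 1 (Suc m) * neg_power_fps x m"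
  define H where "H = neg_power_fps 1 m * neg_power_fps x (Suc m)"
  let ?m = "of_nat (Suc m) :: complex" and ?m' = "of_nat (Suc (Suc m)) :: complex"
  have F': "fps_deriv F = fps_const ?m * G + fps_const (?m * x) * H"
    by (simp only: F_def G_def H_def fps_deriv_mult fps_deriv_neg_power) (simp add: algebra_simps)
  \<comment> \<open>Differentiation raises an index to m + 2; the factor 1 - t lowers the series at
    1 again, so the equation closes on \<open>G\<close> and \<open>H\<close>.\<close>
  have "(1 - fps_const 1 * fps_X) * fps_deriv G
      = fps_const ?m' * ((1 - fps_const 1 * fps_X) * neg_power_fps 1 (Suc (Suc m))) * neg_power_fps x m
        + fps_const (?m * x) * ((1 - fps_const 1 * fps_X) * neg_power_fps 1 (Suc m)) * neg_power_fps x (Suc m)"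
    unfolding G_def fps_deriv_mult fps_deriv_neg_power fps_const_mult[symmetric]
    by (simp add: algebra_simps del: fps_const_mult of_nat_Suc)
  then have G': "(1 - fps_X) * fps_deriv G = fps_const ?m' * G + fps_const (?m * x) * H"
    unfolding neg_power_fps_Suc by (simp add: G_def H_def mult.assoc)
  have "(1 - fps_const x * fps_X) * fps_deriv H
      = fps_const (?m' * x) * neg_power_fps 1 m * ((1 - fps_const x * fps_X) * neg_power_fps x (Suc (Suc m)))
        + fps_const ?m * neg_power_fps 1 (Suc m) * ((1 - fps_const x * fps_X) * neg_power_fps x (Suc m))"
    unfolding H_def fps_deriv_mult fps_deriv_neg_power fps_const_mult[symmetric]
    by (simp add: algebra_simps del: fps_const_mult of_nat_Suc)
  then have H': "(1 - fps_const x * fps_X) * fps_deriv H = fps_const ?m * G + fps_const (?m' * x) * H"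
    unfolding neg_power_fps_Suc by (simp add: G_def H_def mult.assoc add.commute)
  have XD: "fps_nth (fps_X * fps_deriv K) n = of_nat n * fps_nth K n" for K :: "complex fps" and n
    by (cases n) simp_all
  define P where "P n = fps_nth G n" for n
  define Q where "Q n = x * fps_nth H n" for n
  have P_Suc: "of_nat (Suc n) * P (Suc n) = of_nat (n + Suc (Suc m)) * P n + ?m * Q n" for n
  proof -
    have "fps_nth ((1 - fps_X) * fps_deriv G) n = ?m' * P n + ?m * Q n"
      unfolding G' by (simp add: P_def Q_def del: of_nat_Suc)
    moreover have "fps_nth ((1 - fps_X) * fps_deriv G) n = of_nat (Suc n) * P (Suc n) - of_nat n * P n"
      unfolding left_diff_distrib fps_sub_nth XD by (simp add: P_def)
    ultimately show ?thesis by (simp add: algebra_simps)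
  qed
  have Q_Suc: "of_nat (Suc n) * Q (Suc n) = x * (?m * P n + of_nat (n + Suc (Suc m)) * Q n)" for n
  proof -
    have "fps_nth ((1 - fps_const x * fps_X) * fps_deriv H) n = ?m * P n + ?m' * Q n"
      unfolding H' by (simp add: P_def Q_def del: of_nat_Suc)
    moreover have "fps_nth ((1 - fps_const x * fps_X) * fps_deriv H) n
        = of_nat (Suc n) * fps_nth H (Suc n) - of_nat n * Q n"
      unfolding left_diff_distrib fps_sub_nth mult.assoc fps_mult_left_const_nth XD by (simp add: Q_def)
    ultimately have "of_nat (Suc n) * fps_nth H (Suc n) = ?m * P n + of_nat (n + Suc (Suc m)) * Q n"
      by (simp add: algebra_simps)
    then have "x * (of_nat (Suc n) * fps_nth H (Suc n)) = x * (?m * P n + of_nat (n + Suc (Suc m)) * Q n)"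
      by simp
    then show ?thesis unfolding Q_def by (simp only: mult.left_commute)
  qed
  \<comment> \<open>Both inductions start here, with moduli 1 and |x|, which differ by
    hypothesis.\<close>
  have 0: "P 0 = 1" "Q 0 = x" by (simp_all add: P_def Q_def G_def H_def neg_power_fps_def)
  have PQ: "cmod (P n) \<noteq> cmod (Q n)" for n
  proof -
    have norm_P: "of_nat (Suc n) * cmod (P (Suc n)) = cmod (of_real (of_nat (n + Suc (Suc m))) * P n + of_real (of_nat (Suc m)) * Q n)" for n
      using arg_cong[OF P_Suc[of n], of cmod] by (simp only: norm_mult norm_of_nat of_real_of_nat_eq)
    have norm_Q: "of_nat (Suc n) * cmod (Q (Suc n)) = cmod x * cmod (of_real (of_nat (Suc m)) * P n + of_real (of_nat (n + Suc (Suc m))) * Q n)" for n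
      using arg_cong[OF Q_Suc[of n], of cmod] by (simp only: norm_mult norm_of_nat of_real_of_nat_eq)
    \<comment> \<open>The diagonal coefficient n + m + 2 exceeds the off-diagonal m + 1, as
      \<open>cmod_swap_less_iff\<close> requires.\<close>
    have c: "0 < (of_nat (Suc m) :: real)" "of_nat (Suc m) < (of_nat (n + Suc (Suc m)) :: real)" for n by simp_all
    show ?thesis
    proof (cases "cmod x < 1")
      case True
      have "cmod (Q n) < cmod (P n)"
      proof (induction n)
        case (Suc n)
        have "of_nat (Suc n) * cmod (Q (Suc n)) \<le> 1 * cmod (of_real (of_nat (Suc m)) * P n + of_real (of_nat (n + Suc (Suc m))) * Q n)"
          unfolding norm_Q using True by (intro mult_right_mono) simp_all
        also have "\<dots> < of_nat (Suc n) * cmod (P (Suc n))"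
          unfolding norm_P using cmod_swap_less_iff[OF c(1) c(2)[of n], of "P n" "Q n"] Suc by simp
        finally show ?case by (simp only: mult_less_cancel_left_pos of_nat_0_less_iff zero_less_Suc)
      qed (use True 0 in simp)
      then show ?thesis by simp
    next
      case False
      then have x: "1 < cmod x" using assms by simp
      have "cmod (P n) < cmod (Q n)"
      proof (induction n)
        case (Suc n)
        have "of_nat (Suc n) * cmod (P (Suc n)) < cmod (of_real (of_nat (Suc m)) * P n + of_real (of_nat (n + Suc (Suc m))) * Q n)"
          unfolding norm_P using cmod_swap_less_iff[OF c(1) c(2)[of n], of "Q n" "P n"] Suc by (simp add: add.commute)
        also have "\<dots> \<le> of_nat (Suc n) * cmod (Q (Suc n))"
          unfolding norm_Q using mult_right_mono[of 1 "cmod x"] x by simp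
        finally show ?case by (simp only: mult_less_cancel_left_pos of_nat_0_less_iff zero_less_Suc)
      qed (use x 0 in simp)
      then show ?thesis by simp
    qed
  qed
  show ?thesis
  proof (cases s)
    case 0
    then show ?thesis by (simp add: neg_power_fps_def)
  next
    case (Suc n)
    \<comment> \<open>A zero of this coefficient would mean P n = - Q n, hence equal moduli.\<close>
    have "of_nat (Suc n) * fps_nth F (Suc n) = ?m * (P n + Q n)"
      using arg_cong[OF F', of "\<lambda>f. fps_nth f n"] by (simp add: P_def Q_def algebra_simps)
    moreover have "P n + Q n \<noteq> 0" using PQ[of n] by (metis add_eq_0_iff norm_minus_cancel)
    ultimately show ?thesis by (metis F_def Suc mult_eq_0_iff of_nat_eq_0_iff nat.distinct(1))
  qed
qed

text \<open>Write (m + i)! as a binomial coefficient times m! i!, and likewise for s - i. The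
  factors i! and (s - i)! turn the binomial coefficient of s into s!, and a Cauchy product
  remains.\<close>

lemma kappa_eq_fps_nth:
  "kappa m s \<alpha> = (- 1) ^ s * fact s * fact m * fact m * fps_nth (neg_power_fps 1 m * neg_power_fps (- \<alpha>) m) s"
  unfolding kappa_def fps_mult_nth sum_distrib_left atLeast0AtMost
proof (rule sum.cong)
  fix i assume "i \<in> {..s}"
  then have i: "i \<le> s" by simp
  have sign: "(- 1) ^ s * (- \<alpha>) ^ (s - i) = (- 1) ^ i * \<alpha> ^ (s - i)"
  proof -
    have "(- 1 :: complex) ^ s = (- 1) ^ i * (- 1) ^ (s - i)" using i by (simp add: power_add[symmetric])
    moreover have "(- 1 :: complex) ^ (s - i) * (- 1) ^ (s - i) = 1" by (simp add: power_mult_distrib[symmetric])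
    ultimately show ?thesis unfolding power_minus[of \<alpha>] by simp
  qed
  have fact_s: "fact s = of_nat (s choose i) * fact i * (fact (s - i) :: complex)"
    by (simp add: binomial_fact[OF i])
  have fact_add: "fact (k + m) = of_nat ((k + m) choose m) * fact m * (fact k :: complex)" for k
    by (simp add: binomial_fact[of m "k + m"])
  have "of_nat (s choose i) * \<alpha> ^ (s - i) * ((- 1) ^ i * fact (i + m) * fact (s - i + m))
      = ((- 1) ^ s * (- \<alpha>) ^ (s - i)) * fact s * fact m * fact m
        * (of_nat ((i + m) choose m) * of_nat ((s - i + m) choose m))"
    unfolding sign fact_add fact_s by (simp only: mult_ac)
  moreover have "m + s - i = s - i + m" "m + i = i + m" using i by simp_all
  ultimately show "of_nat (s choose i) * \<alpha> ^ (s - i) * ((- 1) ^ i * fact (m + i) * fact (m + s - i))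
      = (- 1) ^ s * fact s * fact m * fact m * (fps_nth (neg_power_fps 1 m) i * fps_nth (neg_power_fps (- \<alpha>) m) (s - i))"
    by (simp only: neg_power_fps_def fps_nth_Abs_fps power_one mult_1_right mult_1_left mult_ac)
qed simp

lemma kappa_nonzero: "cmod \<alpha> \<noteq> 1 \<Longrightarrow> kappa m s \<alpha> \<noteq> 0"
  using fps_nth_product_nonzero[of "- \<alpha>" m s] by (simp add: kappa_eq_fps_nth)

text \<open>At \<alpha> = -1 every summand has the sign (-1)^s. This value lies on the unit circle
  and is the one that belongs to the determinant.\<close>

lemma kappa_minus_one_nonzero: "kappa m s (- 1) \<noteq> 0"
proof -
  have "kappa m s (- 1) = (- 1) ^ s * of_real (\<Sum>i\<le>s. of_nat (s choose i) * (fact (m + i) * fact (m + s - i)))"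
    unfolding kappa_def of_real_sum sum_distrib_left
  proof (rule sum.cong)
    fix i assume "i \<in> {..s}"
    then have "(- 1 :: complex) ^ s = (- 1) ^ (s - i) * (- 1) ^ i" by (simp add: power_add[symmetric])
    then show "of_nat (s choose i) * (- 1) ^ (s - i) * ((- 1) ^ i * fact (m + i) * fact (m + s - i))
        = (- 1 :: complex) ^ s * of_real (of_nat (s choose i) * (fact (m + i) * fact (m + s - i)))"
      by (simp add: mult_ac)
  qed simp
  moreover have "(\<Sum>i\<le>s. of_nat (s choose i) * (fact (m + i) * fact (m + s - i))) > (0 :: real)"
    by (intro sum_pos mult_pos_pos) auto
  ultimately show ?thesis by (simp only: mult_eq_0_iff of_real_eq_0_iff) simp
qed

section \<open>Highest weight vectors and decompositions\<close>

text \<open>By the Leibniz rule, p + q applications hit \<open>f\<close> at least p times or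
  \<open>g\<close> at least q times in every term.\<close>

lemma (in derivation) nilpotent_mult:
  assumes "(d ^^ p) f = 0" "(d ^^ q) g = 0"
  shows "(d ^^ (p + q)) (f * g) = 0"
proof -
  have iter_zero: "(d ^^ n) 0 = 0" for n
    by (induction n) simp_all
  have iter_add: "(d ^^ n) (f + g) = (d ^^ n) f + (d ^^ n) g" for n f g
    by (induction n) (simp_all add: add)
  have "(d ^^ n) (f * g) = 0" if "n = p + q" "(d ^^ p) f = 0" "(d ^^ q) g = 0" for n p q f g
    using that
  proof (induction n arbitrary: p q f g)
    case (Suc n)
    show ?case
    proof (cases "p = 0 \<or> q = 0")
      case True
      then have "f * g = 0" using Suc.prems by auto
      then show ?thesis by (simp only: iter_zero)
    next
      case False
      then obtain p' q' where pq: "p = Suc p'" "q = Suc q'" by (metis not0_implies_Suc)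
      have "(d ^^ n) (d f * g) = 0"
        using Suc.prems pq by (intro Suc.IH[of p' q]) (simp_all add: funpow_swap1)
      moreover have "(d ^^ n) (f * d g) = 0"
        using Suc.prems pq by (intro Suc.IH[of p q']) (simp_all add: funpow_swap1)
      ultimately show ?thesis by (simp only: funpow_Suc_right comp_apply mult iter_add add_0_left)
    qed
  qed auto
  then show ?thesis using assms by blast
qed

text \<open>The additional 1 in the exponent accounts for the zeroth power, which one application
  kills.\<close>

lemma (in derivation) nilpotent_power:
  assumes "(d ^^ p) f = 0"
  shows "(d ^^ (n * p + 1)) (f ^ n) = 0"
proof (induction n)
  case (Suc n)
  then have "(d ^^ (p + (n * p + 1))) (f * f ^ n) = 0" by (intro nilpotent_mult assms)
  then show ?case by (simp add: add.assoc)
qed simp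

text \<open>Lets statements about the module \<open>Wmod\<close> be reduced to the operators
  \<open>\<rho> i j\<close> on polynomials.\<close>

locale derivation_submodule =
  fixes B :: "('v \<Rightarrow>\<^sub>0 nat) set" and \<rho> :: "2 \<Rightarrow> 2 \<Rightarrow> 'v cpoly \<Rightarrow> 'v cpoly" and W :: "'v cpoly set"
  assumes rep: "is_rep (B, \<rho>)" and deriv: "derivation (\<rho> i j)"
    and sub: "submodule W (module_of (B, \<rho>))"
begin

abbreviation Wmod :: "(Ugl2, 'v cpoly) lmod" where
  "Wmod \<equiv> \<lparr>mcarrier = W, mact = U_action \<rho>\<rparr>"

lemma left_module_W: "left_module Wmod" and W_span: "W \<subseteq> span_of B"
  using sub by (simp_all add: submodule_def module_of_def)

lemma act_gen: "f \<in> W \<Longrightarrow> U_action \<rho> (gen i j) f = \<rho> i j f"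
  and act_Uconst: "f \<in> W \<Longrightarrow> U_action \<rho> (Uconst c) f = pscale c f"
  using W_span by (simp_all add: U_action_gen[OF rep] U_action_Uconst[OF rep] subset_iff)

lemma stable_subspace_submodule:
  assumes "submodule N Wmod"
  shows "stable_subspace (\<rho> 2 1) (\<rho> 1 2) N"
proof -
  have N: "N \<subseteq> W" "left_module \<lparr>mcarrier = N, mact = U_action \<rho>\<rparr>"
    using assms by (simp_all add: submodule_def)
  interpret N: gl2_module "\<lparr>mcarrier = N, mact = U_action \<rho>\<rparr>" by (rule gl2_module.intro) (rule N)
  have act: "U_action \<rho> r f \<in> N" if "f \<in> N" for r f using N.act_closed that by simp
  interpret derivation "\<rho> i j" for i j by (rule deriv)
  show ?thesis
  proof
    show "0 \<in> N" using N.zero_closed by simp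
    show "f + g \<in> N" if "f \<in> N" "g \<in> N" for f g using N.add_closed that by simp
    show "const c * f \<in> N" if "f \<in> N" for f c
      using act[OF that, of "Uconst c"] act_Uconst[of f c] N(1) that by (auto simp: pscale_eq_const_mult)
    show "\<rho> 2 1 f \<in> N" "\<rho> 1 2 f \<in> N" if "f \<in> N" for f
      using act[OF that] act_gen[of f] N(1) that by (metis subsetD)+
  qed
qed

lemma submodule_W: "submodule W Wmod"
  using left_module_W by (simp add: submodule_def)

lemma hw_vectorI:
  assumes "w \<in> W" "w \<noteq> 0" "\<rho> 1 2 w = 0" "\<rho> 1 1 w = of_nat a * w" "\<rho> 2 2 w = of_nat b * w" "b \<le> a"
    and nil: "(\<rho> 2 1 ^^ K) w = 0"
  shows "nat_hw_vector Wmod w a b"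
proof (rule nat_hw_vectorI[OF left_module_W])
  interpret W: gl2_module Wmod by (rule gl2_module.intro[OF left_module_W])
  have "U_action \<rho> (gen 2 1 ^ k) w = (\<rho> 2 1 ^^ k) w \<and> (\<rho> 2 1 ^^ k) w \<in> W" for k
  proof (induction k)
    case 0
    then show ?case using W.one_act[of w] assms(1) by simp
  next
    case (Suc k)
    have "U_action \<rho> (gen 2 1 ^ Suc k) w = U_action \<rho> (gen 2 1) (U_action \<rho> (gen 2 1 ^ k) w)"
      using W.mult_act[of w "gen 2 1" "gen 2 1 ^ k"] assms(1) by simp
    also have "\<dots> = \<rho> 2 1 ((\<rho> 2 1 ^^ k) w)" using Suc act_gen by simp
    finally show ?case using W.act_closed[of "(\<rho> 2 1 ^^ k) w" "gen 2 1"] Suc act_gen by simp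
  qed
  then show "mact Wmod (gen 2 1 ^ K) w = 0 \<or> irreducible_module Wmod" using nil by simp
qed (use assms in \<open>simp_all add: act_gen act_Uconst pscale_eq_const_mult const_of_nat\<close>)

end

text \<open>For fixed total weight L the Casimir eigenvalue of (L - s, s) strictly decreases in s up
  to L / 2.\<close>

lemma casimir_weight_inj: "inj_on (\<lambda>s. (L - s) * (L - s) + s * s + (L - s - s)) {s. 2 * s \<le> L}" for L :: nat
proof (rule linorder_inj_onI)
  fix s t assume st: "s < t" "s \<in> {s. 2 * s \<le> L}" "t \<in> {s. 2 * s \<le> L}"
  obtain q where q: "t = s + Suc q" using st(1) less_imp_Suc_add by auto
  obtain r where r: "L = 2 * t + r" using st(3) le_iff_add by auto
  \<comment> \<open>With t = s + q + 1 and L = 2 t + r all truncated subtractions disappear and a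
    polynomial comparison remains.\<close>
  have "L - s = s + 2 * Suc q + r" "L - s - s = 2 * Suc q + r" "L - t = s + Suc q + r" "L - t - t = r"
    using q r by auto
  then show "(L - s) * (L - s) + s * s + (L - s - s) \<noteq> (L - t) * (L - t) + t * t + (L - t - t)"
    unfolding q by (simp only:) (simp add: algebra_simps)
qed auto

text \<open>The hypotheses list the action on \<open>D = x\<^sub>1\<^sub>1 x\<^sub>1\<^sub>2\<close>, \<open>p = per X\<close> and \<open>D' = x\<^sub>2\<^sub>1 x\<^sub>2\<^sub>2\<close>, or on the
  halves of \<open>e\<^sub>1\<^sup>2\<close>, \<open>e\<^sub>2\<^sup>2\<close> and on \<open>e\<^sub>1 e\<^sub>2\<close>.\<close>

locale symmetric_square_submodule = derivation_submodule B \<rho> W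
  for B :: "('v \<Rightarrow>\<^sub>0 nat) set" and \<rho> W +
  fixes D D' p :: "'v cpoly" and l :: nat
  assumes table: "\<rho> 2 1 D = p" "\<rho> 2 1 p = 2 * D'" "\<rho> 2 1 D' = 0" "\<rho> 1 2 D' = p" "\<rho> 1 2 p = 2 * D" "\<rho> 1 2 D = 0"
      "\<rho> 1 1 D = 2 * D" "\<rho> 1 1 p = p" "\<rho> 1 1 D' = 0" "\<rho> 2 2 D = 0" "\<rho> 2 2 p = p" "\<rho> 2 2 D' = 2 * D'"
    and nonzero: "D ^ a * (p\<^sup>2 - 4 * D * D') ^ b \<noteq> 0"
    and power_in: "p ^ l \<in> W"
    and generate: "\<And>N. submodule N Wmod \<Longrightarrow> p ^ l \<in> N \<Longrightarrow> N = W"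
begin

text \<open>D is a highest weight vector of weight (2, 0), and the discriminant is killed by E_12
  and E_21 and has weight (2, 2). The products therefore have weight (2 l - 2 j, 2 j).\<close>

theorem iso_direct_sum_even_weights:
  assumes irr: "\<And>a b. b \<le> a \<Longrightarrow> irreducible_highest_weight_module (of_nat a) (of_nat b) (M a b)"
  shows "Wmod \<cong>\<^sub>U direct_sum {0..l div 2} (\<lambda>j. M (2 * l - 2 * j) (2 * j))"
proof (rule iso_direct_sum)
  let ?\<Delta> = "p\<^sup>2 - 4 * D * D'"
  let ?w = "\<lambda>j. D ^ (l - 2 * j) * ?\<Delta> ^ j"
  interpret \<rho>: derivation "\<rho> i j" for i j by (rule deriv)
  have symmetric_square: "symmetric_square (\<rho> 2 1) (\<rho> 1 2) N D D' p" if "submodule N Wmod" for N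
    by (intro symmetric_square.intro symmetric_square_axioms.intro stable_subspace_submodule that table)
  interpret W: symmetric_square "\<rho> 2 1" "\<rho> 1 2" W D D' p by (rule symmetric_square[OF submodule_W])
  show "left_module Wmod" by (rule left_module_W)
  show "nat_hw_vector Wmod (?w j) (2 * l - 2 * j) (2 * j)" if "j \<in> {0..l div 2}" for j
  proof -
    have j: "2 * j \<le> l" using that by auto
    have \<rho>_numeral: "\<rho> i k (numeral n) = 0" for i k n
      using \<rho>.const[of i k "numeral n"] by (simp add: const_numeral)
    have \<Delta>: "\<rho> 1 2 ?\<Delta> = 0" "\<rho> 2 1 ?\<Delta> = 0" "\<rho> 1 1 ?\<Delta> = 2 * ?\<Delta>" "\<rho> 2 2 ?\<Delta> = 2 * ?\<Delta>"
      by (simp_all add: power2_eq_square \<rho>.diff \<rho>.mult table \<rho>_numeral algebra_simps)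
    have pow: "of_nat n * f ^ (n - 1) * (2 * f) = of_nat (2 * n) * f ^ n" for n and f :: "'v cpoly"
      by (cases n) (simp_all add: algebra_simps)
    show ?thesis
    proof (rule hw_vectorI)
      \<comment> \<open>Expanded into monomials of degree l in D, p, D', which lie in W by
        \<open>W.monomials_if_power\<close>.\<close>
      have "?w j = (\<Sum>i\<le>j. const (of_nat (j choose i) * (- 4) ^ i) * (D ^ (l - 2 * j + i) * p ^ (2 * (j - i)) * D' ^ i))"
      proof -
        have "(- (4 * D * D')) ^ i = const ((- 4) ^ i) * D ^ i * D' ^ i" for i
          by (simp add: const_power const_uminus const_numeral power_mult_distrib[symmetric] mult_ac)
        then have "?\<Delta> ^ j = (\<Sum>i\<le>j. of_nat (j choose i) * (const ((- 4) ^ i) * D ^ i * D' ^ i) * (p\<^sup>2) ^ (j - i))"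
          using binomial_ring[of "- (4 * D * D')" "p\<^sup>2" j] by simp
        then show ?thesis
          by (simp only: sum_distrib_left const_mult const_of_nat power_add power_mult[of p 2]) (simp only: mult_ac)
      qed
      also have "\<dots> \<in> W"
        using j power_in by (intro W.sum W.scale W.monomials_if_power[of l]) auto
      finally show "?w j \<in> W" .
      show "?w j \<noteq> 0" by (rule nonzero)
      show "\<rho> 1 2 (?w j) = 0"
        by (simp only: \<rho>.mult \<rho>.power table \<Delta> mult_zero_left mult_zero_right add_0_left)
      have "\<rho> 1 1 (?w j) = of_nat (2 * (l - 2 * j)) * ?w j + of_nat (2 * j) * ?w j"
        by (simp only: \<rho>.mult \<rho>.power table \<Delta> pow) (simp add: algebra_simps)
      then show "\<rho> 1 1 (?w j) = of_nat (2 * l - 2 * j) * ?w j"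
      proof -
        have "2 * l - 2 * j = 2 * (l - 2 * j) + 2 * j" using j by simp
        then show ?thesis using \<open>\<rho> 1 1 (?w j) = _\<close> by (simp only: of_nat_add distrib_right)
      qed
      show "\<rho> 2 2 (?w j) = of_nat (2 * j) * ?w j"
        by (simp only: \<rho>.mult \<rho>.power table \<Delta> pow) (simp add: algebra_simps)
      show "2 * j \<le> 2 * l - 2 * j" using j by simp
      have "(\<rho> 2 1 ^^ 3) D = \<rho> 2 1 (\<rho> 2 1 (\<rho> 2 1 D))" by (simp add: numeral_3_eq_3)
      then have "(\<rho> 2 1 ^^ 3) D = 0" by (simp only: table \<rho>.mult \<rho>_numeral mult_zero_left mult_zero_right add_0_left)
      moreover have "(\<rho> 2 1 ^^ 1) ?\<Delta> = 0" using \<Delta>(2) by simp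
      \<comment> \<open>E_21 sends D through p and 2 D' to 0, hence the 3; the discriminant needs
        one step.\<close>
      ultimately show "(\<rho> 2 1 ^^ (((l - 2 * j) * 3 + 1) + (j * 1 + 1))) (?w j) = 0"
        by (intro \<rho>.nilpotent_mult \<rho>.nilpotent_power)
    qed
  qed
  show "irreducible_highest_weight_module (of_nat (2 * l - 2 * j)) (of_nat (2 * j)) (M (2 * l - 2 * j) (2 * j))"
    if "j \<in> {0..l div 2}" for j
    using that by (intro irr) auto
  show "inj_on (\<lambda>j. (2 * l - 2 * j) * (2 * l - 2 * j) + 2 * j * (2 * j) + (2 * l - 2 * j - 2 * j)) {0..l div 2}"
  proof (rule inj_onI)
    fix x y assume x: "x \<in> {0..l div 2}" and y: "y \<in> {0..l div 2}"
      and eq: "(2 * l - 2 * x) * (2 * l - 2 * x) + 2 * x * (2 * x) + (2 * l - 2 * x - 2 * x)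
        = (2 * l - 2 * y) * (2 * l - 2 * y) + 2 * y * (2 * y) + (2 * l - 2 * y - 2 * y)"
    \<comment> \<open>The weights are those of \<open>casimir_weight_inj\<close> for total weight 2
      l at the even places 2 x and 2 y.\<close>
    have "2 * (2 * x) \<le> 2 * l" "2 * (2 * y) \<le> 2 * l" using x y by auto
    then have "2 * x = 2 * y"
      by (intro inj_onD[OF casimir_weight_inj[of "2 * l"] eq] CollectI)
    then show "x = y" by simp
  qed
  fix N assume N: "submodule N Wmod" and w: "\<And>j. j \<in> {0..l div 2} \<Longrightarrow> ?w j \<in> N"
  interpret N: symmetric_square "\<rho> 2 1" "\<rho> 1 2" N D D' p by (rule symmetric_square[OF N])
  have "p ^ l \<in> N" using w by (intro N.power_if_discriminants) auto
  then show "N = mcarrier Wmod" using generate[OF N] by simp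
qed simp

end

context
  fixes i j :: 2
begin

interpretation derivation "polarization i j" by (rule derivation_polarization)

lemmas polarization_mult = mult and polarization_add = add and polarization_diff = diff
  and polarization_const = const and polarization_power = power

end

section \<open>Cyclic submodules of the polynomial ring and the permanent\<close>

abbreviation x11 :: "(2 \<times> 2) cpoly" where "x11 \<equiv> var (1, 1)"
abbreviation x12 :: "(2 \<times> 2) cpoly" where "x12 \<equiv> var (1, 2)"
abbreviation x21 :: "(2 \<times> 2) cpoly" where "x21 \<equiv> var (2, 1)"
abbreviation x22 :: "(2 \<times> 2) cpoly" where "x22 \<equiv> var (2, 2)"

lemma alpha_det_X: "alpha_det \<alpha> X = x11 * x22 + const \<alpha> * (x12 * x21)"
  by (simp add: alpha_det_def X_def mult_ac)

lemma per_X: "per X = x11 * x22 + x12 * x21"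
  using alpha_det_X[of 1] by (simp add: alpha_det_one)

lemma det_X: "det X = x11 * x22 - x12 * x21"
  using alpha_det_X[of "- 1"] by (simp add: alpha_det_minus_one const_uminus)

lemma mcarrier_module_of_poly_rep [simp]: "mcarrier (module_of poly_rep) = UNIV"
  by (simp add: module_of_def poly_rep_def span_of_def)

interpretation poly_rep: gl2_module "module_of poly_rep"
  unfolding module_of_poly_rep by (rule gl2_module.intro) (rule left_module_module_of[OF is_rep_poly_rep])

lemma derivation_submodule_poly_rep:
  "submodule W (module_of poly_rep) \<Longrightarrow> derivation_submodule UNIV polarization W"
  unfolding module_of_poly_rep
  by (intro derivation_submodule.intro is_rep_poly_rep derivation_polarization)

lemma cyclic_poly_rep:
  "cyclic (module_of poly_rep) f = \<lparr>mcarrier = mcarrier (cyclic (module_of poly_rep) f), mact = U_action polarization\<rparr>"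
  by (simp add: cyclic_def module_of_def)

lemma derivation_submodule_cyclic:
  "derivation_submodule UNIV polarization (mcarrier (cyclic (module_of poly_rep) f))"
  by (intro derivation_submodule_poly_rep poly_rep.cyclic_submodule) simp

lemma (in derivation_submodule) submodule_trans:
  "submodule N Wmod \<Longrightarrow> submodule N (module_of (B, \<rho>))"
  using W_span by (auto simp: submodule_def module_of_def)

lemma cyclic_generated:
  assumes "submodule N (cyclic (module_of poly_rep) f)" "f \<in> N"
  shows "N = mcarrier (cyclic (module_of poly_rep) f)"
proof
  interpret derivation_submodule UNIV polarization "mcarrier (cyclic (module_of poly_rep) f)"
    by (rule derivation_submodule_cyclic)
  show "N \<subseteq> mcarrier (cyclic (module_of poly_rep) f)" using assms(1) by (simp add: submodule_def)
  have "submodule N Wmod" using assms(1) by (simp only: cyclic_poly_rep[symmetric])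
  then have "submodule N (module_of (UNIV, polarization))" by (rule submodule_trans)
  then have "submodule N (module_of poly_rep)" by (simp only: module_of_poly_rep)
  then show "mcarrier (cyclic (module_of poly_rep) f) \<subseteq> N"
    using assms(2) by (rule poly_rep.cyclic_subset)
qed

theorem cyclic_per_iso:
  assumes "\<And>a b. b \<le> a \<Longrightarrow> irreducible_highest_weight_module (of_nat a) (of_nat b) (M a b)"
  shows "cyclic (module_of poly_rep) (per X ^ l) \<cong>\<^sub>U direct_sum {0..l div 2} (\<lambda>j. M (2 * l - 2 * j) (2 * j))"
proof -
  let ?W = "mcarrier (cyclic (module_of poly_rep) (per X ^ l))"
  interpret derivation_submodule UNIV polarization ?W by (rule derivation_submodule_cyclic)
  interpret symmetric_square_submodule UNIV polarization ?W "x11 * x12" "x21 * x22" "per X" l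
  proof
    let ?\<Delta> = "(per X)\<^sup>2 - 4 * (x11 * x12) * (x21 * x22)"
    fix a b
    \<comment> \<open>At x21 = 0 and all other variables 1, both D and the permanent become 1 and D'
      becomes 0.\<close>
    have "psubst (\<lambda>k. if k = (2, 1) then 0 else 1) ((x11 * x12) ^ a * ?\<Delta> ^ b) = (1 :: (2 \<times> 2) cpoly)"
      by (simp add: psubst_mult psubst_power psubst_diff psubst_add per_X)
    then show "(x11 * x12) ^ a * ?\<Delta> ^ b \<noteq> 0" by (metis psubst_zero zero_neq_one)
  next
    show "per X ^ l \<in> ?W" by (rule poly_rep.in_cyclic) simp
    show "N = ?W" if "submodule N Wmod" "per X ^ l \<in> N" for N
      using cyclic_generated[OF that(1)[folded cyclic_poly_rep] that(2)] .
  qed (simp_all add: per_X polarization_mult polarization_add algebra_simps)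
  show ?thesis
    using iso_direct_sum_even_weights[of M] assms by (simp only: cyclic_poly_rep[symmetric])
qed

section \<open>Symmetric powers of the symmetric square\<close>

context
begin

text \<open>Exponent vectors of the monomials in e_1, e_2 of degree 2. They index the basis of Sym^2
  and so serve as variables of the outer polynomial ring.\<close>

private definition "e11 = Poly_Mapping.single (1::2) (2::nat)"
private definition "e12 = Poly_Mapping.single (1::2) (1::nat) + Poly_Mapping.single 2 1"
private definition "e22 = Poly_Mapping.single (2::2) (2::nat)"
private lemmas e_defs = e11_def e12_def e22_def
private abbreviation "\<sigma> \<equiv> snd (sym_rep 2 natural_rep)"
private abbreviation "\<tau> l \<equiv> snd (sym_rep l (sym_rep 2 natural_rep))"

private lemma monomials: "{m :: 2 \<Rightarrow>\<^sub>0 nat. mono_degree m = 2} = {e11, e12, e22}"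
proof -
  have "m \<in> {e11, e12, e22}" if "mono_degree m = 2" for m :: "2 \<Rightarrow>\<^sub>0 nat"
  proof -
    have sum: "Poly_Mapping.lookup m 1 + Poly_Mapping.lookup m 2 = 2"
      using that mono_degree_superset[of UNIV m] by (simp add: sum_2)
    have m: "m = n" if "Poly_Mapping.lookup m 1 = Poly_Mapping.lookup n 1" "Poly_Mapping.lookup m 2 = Poly_Mapping.lookup n 2" for n
    proof (rule poly_mapping_eqI)
      show "Poly_Mapping.lookup m k = Poly_Mapping.lookup n k" for k
        using that exhaust_2[of k] by auto
    qed
    consider "Poly_Mapping.lookup m 1 = 2" "Poly_Mapping.lookup m 2 = 0" | "Poly_Mapping.lookup m 1 = 1" "Poly_Mapping.lookup m 2 = 1"
      | "Poly_Mapping.lookup m 1 = 0" "Poly_Mapping.lookup m 2 = 2"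
      using sum by linarith
    then show ?thesis
      by cases (use m[of e11] m[of e12] m[of e22] in \<open>simp_all add: e_defs lookup_add lookup_single\<close>)
  qed
  then show ?thesis by (auto simp: mono_degree_add e_defs)
qed

private lemma distinct: "e11 \<noteq> e12" "e11 \<noteq> e22" "e12 \<noteq> e22"
proof -
  have "Poly_Mapping.lookup e11 1 = 2" "Poly_Mapping.lookup e12 1 = 1" "Poly_Mapping.lookup e22 1 = 0"
    by (simp_all add: e_defs lookup_add lookup_single)
  then show "e11 \<noteq> e12" "e11 \<noteq> e22" "e12 \<noteq> e22" by auto
qed

private lemma \<sigma>_var: "\<sigma> i j (var b) = (if b = j then var i else 0)"
  by (simp add: sym_rep_var natural_rep_def lookup_single)

private lemma var_mult: "var 1 * var 1 = basis_vec e11" "var 1 * var 2 = basis_vec e12"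
    "var 2 * var 1 = basis_vec e12" "var 2 * var 2 = basis_vec e22"
  unfolding var_def mult_single e_defs single_add[symmetric] one_add_one mult_1_right
  by (simp_all only: add.commute)

private lemma \<tau>_var: "\<tau> l 2 1 (var e11) = 2 * var e12" "\<tau> l 2 1 (var e12) = var e22" "\<tau> l 2 1 (var e22) = 0"
    "\<tau> l 1 2 (var e11) = 0" "\<tau> l 1 2 (var e12) = var e11" "\<tau> l 1 2 (var e22) = 2 * var e12"
    "\<tau> l 1 1 (var e11) = 2 * var e11" "\<tau> l 1 1 (var e12) = var e12" "\<tau> l 1 1 (var e22) = 0"
    "\<tau> l 2 2 (var e11) = 0" "\<tau> l 2 2 (var e12) = var e12" "\<tau> l 2 2 (var e22) = 2 * var e22"
proof -
  interpret \<sigma>: derivation "\<sigma> i j" for i j by (rule derivation_sym_rep)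
  have \<tau>: "\<tau> l i j (var m) = lin_ext var (\<sigma> i j (basis_vec m))" for i j m
    by (rule sym_rep_var)
  have v: "lin_ext var (basis_vec m) = var m" for m :: "2 \<Rightarrow>\<^sub>0 nat" by simp
  have ne: "(1::2) \<noteq> 2" "(2::2) \<noteq> 1" by simp_all
  show "\<tau> l 2 1 (var e11) = 2 * var e12" "\<tau> l 2 1 (var e12) = var e22" "\<tau> l 2 1 (var e22) = 0"
    "\<tau> l 1 2 (var e11) = 0" "\<tau> l 1 2 (var e12) = var e11" "\<tau> l 1 2 (var e22) = 2 * var e12"
    "\<tau> l 1 1 (var e11) = 2 * var e11" "\<tau> l 1 1 (var e12) = var e12" "\<tau> l 1 1 (var e22) = 0"
    "\<tau> l 2 2 (var e11) = 0" "\<tau> l 2 2 (var e12) = var e12" "\<tau> l 2 2 (var e22) = 2 * var e22"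
    \<comment> \<open>Each basis vector of Sym^2 is split into two variables, so that the Leibniz
      rule of the inner algebra computes its image.\<close>
    unfolding \<tau> var_mult(1,2,4)[symmetric] \<sigma>.mult \<sigma>_var
    by (simp_all only: ne if_True if_False refl mult_zero_left mult_zero_right add_0_left add_0_right
          var_mult lin_ext_add lin_ext_zero v mult_2)
qed

theorem sym_sym_iso:
  assumes "\<And>a b. b \<le> a \<Longrightarrow> irreducible_highest_weight_module (of_nat a) (of_nat b) (M a b)"
  shows "module_of (sym_rep l (sym_rep 2 natural_rep)) \<cong>\<^sub>U direct_sum {0..l div 2} (\<lambda>j. M (2 * l - 2 * j) (2 * j))"
proof -
  let ?S = "{e11, e12, e22}"
  let ?B = "{m. Poly_Mapping.keys m \<subseteq> ?S \<and> mono_degree m = l}"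
  have eq: "sym_rep l (sym_rep 2 natural_rep) = (?B, \<tau> l)"
    by (simp add: sym_rep_def natural_rep_def monomials)
  have rep: "is_rep (?B, \<tau> l)"
    unfolding eq[symmetric] by (intro is_rep_sym_rep is_rep_natural_rep)
  interpret \<tau>: derivation "\<tau> l i j" for i j by (rule derivation_sym_rep)
  have left: "left_module (module_of (?B, \<tau> l))" by (rule left_module_module_of[OF rep])
  interpret derivation_submodule ?B "\<tau> l" "span_of ?B"
  proof (intro derivation_submodule.intro rep derivation_sym_rep)
    show "submodule (span_of ?B) (module_of (?B, \<tau> l))"
      using left by (simp add: submodule_def module_of_def)
  qed
  \<comment> \<open>The halves turn E_21 e_1^2 = 2 e_1 e_2 into E_21 D = p, as \<open>table\<close>
    demands.\<close>
  let ?D = "const (1 / 2) * var e11" and ?D' = "const (1 / 2) * var e22" and ?p = "var e12"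
  have half: "const (1 / 2) * (2 * f) = f" "2 * (const (1 / 2) * f) = f" for f :: "(2 \<Rightarrow>\<^sub>0 nat) cpoly"
  proof -
    have "const (1 / 2) * 2 = (1 :: (2 \<Rightarrow>\<^sub>0 nat) cpoly)"
      by (simp only: const_numeral[symmetric] const_mult[symmetric]) simp
    then show "const (1 / 2) * (2 * f) = f" "2 * (const (1 / 2) * f) = f"
      by (metis mult.assoc mult.commute mult_1)+
  qed
  interpret symmetric_square_submodule ?B "\<tau> l" "span_of ?B" ?D ?D' ?p l
  proof
    let ?\<Delta> = "?p\<^sup>2 - 4 * ?D * ?D'"
    fix a b
    \<comment> \<open>Specializes D and p to 1 and D' to 0, hence the discriminant to 1.\<close>
    have "psubst (\<lambda>k. if k = e11 then const 2 else if k = e12 then 1 else 0) (?D ^ a * ?\<Delta> ^ b) = (1 :: (2 \<Rightarrow>\<^sub>0 nat) cpoly)"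
      using distinct by (simp add: psubst_mult psubst_power psubst_diff const_mult[symmetric])
    then show "?D ^ a * ?\<Delta> ^ b \<noteq> 0" by (metis psubst_zero zero_neq_one)
  next
    show "?p ^ l \<in> span_of ?B"
      using homogeneous_power[OF homogeneous_var[of e12 ?S], of l] by simp
  next
    fix N assume N: "submodule N Wmod" and p: "?p ^ l \<in> N"
    interpret N: symmetric_square "\<tau> l 2 1" "\<tau> l 1 2" N ?D ?D' ?p
      by (intro symmetric_square.intro symmetric_square_axioms.intro stable_subspace_submodule N)
        (simp_all add: \<tau>.mult \<tau>_var half)
    have "f \<in> N" if "f \<in> span_of ?B" for f
      using that
    proof (induction rule: span_of_induct)
      case (single k c)
      let ?a = "Poly_Mapping.lookup k e11" and ?b = "Poly_Mapping.lookup k e12" and ?c = "Poly_Mapping.lookup k e22"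
      \<comment> \<open>Up to a power of 2, every basis monomial of the whole space is some D^a p^b
        D'^c, so the power of p generates it.\<close>
      have "k = (\<Sum>x\<in>?S. Poly_Mapping.single x (Poly_Mapping.lookup k x))"
        using single by (intro poly_mapping_eqI) (auto simp: lookup_sum lookup_single when_def in_keys_iff subset_iff)
      also have "\<dots> = Poly_Mapping.single e11 ?a + Poly_Mapping.single e12 ?b + Poly_Mapping.single e22 ?c"
        using distinct by (simp add: add.assoc)
      finally have k: "k = Poly_Mapping.single e11 ?a + Poly_Mapping.single e12 ?b + Poly_Mapping.single e22 ?c" .
      have "?a + ?b + ?c = l"
        using single mono_degree_superset[of ?S k] distinct by (simp add: add.assoc)
      have "Poly_Mapping.single k c = const c * (var e11 ^ ?a * var e12 ^ ?b * var e22 ^ ?c)"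
        by (subst k) (simp add: const_def var_power mult_single)
      also have "\<dots> = const c * ((2 * ?D) ^ ?a * ?p ^ ?b * (2 * ?D') ^ ?c)"
        unfolding half ..
      also have "\<dots> = const (c * 2 ^ (?a + ?c)) * (?D ^ ?a * ?p ^ ?b * ?D' ^ ?c)"
        unfolding power_mult_distrib power_add const_mult const_power const_numeral by (simp only: mult_ac)
      also have "\<dots> \<in> N"
        by (intro N.scale N.monomials_if_power[OF p]) fact
      finally show ?case .
    qed (auto intro: N.zero N.add)
    moreover have "N \<subseteq> span_of ?B" using N by (simp add: submodule_def)
    ultimately show "N = span_of ?B" by blast
  qed (simp_all add: \<tau>.mult \<tau>_var half mult.left_commute[of 2])
  show ?thesis
    by (subst eq) (use iso_direct_sum_even_weights[of M] assms in \<open>simp add: module_of_def\<close>)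
qed

end

section \<open>The determinant\<close>

lemma polarization_det: "polarization i j (det X) = (if i = j then det X else 0)"
  using exhaust_2[of i] exhaust_2[of j]
  by (elim disjE) (simp_all add: det_X polarization_diff polarization_mult algebra_simps)

text \<open>By the Leibniz rule E_ij multiplies det^l by l if i = j and by 0 otherwise, so its line
  is stable.\<close>

theorem mcarrier_cyclic_det:
  "mcarrier (cyclic (module_of poly_rep) (det X ^ l)) = {const c * det X ^ l | c. True}"
proof
  let ?S = "{const c * det X ^ l | c. True}"
  have act: "mact (module_of poly_rep) (Uconst c) f = const c * f"
      "mact (module_of poly_rep) (gen i j) f = polarization i j f" for c f i j
    unfolding module_of_poly_rep
    by (simp_all add: module_of_def U_action_Uconst[OF is_rep_poly_rep] U_action_gen[OF is_rep_poly_rep]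
        span_of_def pscale_eq_const_mult)
  have "submodule ?S (module_of poly_rep)"
  proof (rule poly_rep.submoduleI)
    show "0 \<in> ?S" by (auto intro: exI[of _ 0])
    show "f + g \<in> ?S" if "f \<in> ?S" "g \<in> ?S" for f g
    proof -
      from that obtain c e where "f = const c * det X ^ l" "g = const e * det X ^ l" by blast
      then have "f + g = const (c + e) * det X ^ l" by (simp add: const_add distrib_right)
      then show ?thesis by blast
    qed
    show "mact (module_of poly_rep) (Uconst c) f \<in> ?S" if "f \<in> ?S" for c f
    proof -
      from that obtain e where "f = const e * det X ^ l" by blast
      then have "const c * f = const (c * e) * det X ^ l" by (simp add: const_mult mult.assoc)
      then show ?thesis unfolding act by blast
    qed
    show "mact (module_of poly_rep) (gen i j) f \<in> ?S" if "f \<in> ?S" for i j f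
    proof -
      from that obtain c where f: "f = const c * det X ^ l" by blast
      have "of_nat l * det X ^ (l - 1) * det X = of_nat l * det X ^ l" by (cases l) (simp_all add: mult.commute)
      then have "polarization i j f = const (c * (if i = j then of_nat l else 0)) * det X ^ l"
        unfolding f polarization_mult polarization_power polarization_const polarization_det
        by (simp add: const_mult const_of_nat mult.assoc)
      then show ?thesis unfolding act by blast
    qed
  qed simp
  moreover have "det X ^ l \<in> ?S" by (auto intro: exI[of _ 1])
  ultimately show "mcarrier (cyclic (module_of poly_rep) (det X ^ l)) \<subseteq> ?S"
    by (rule poly_rep.cyclic_subset)
  show "?S \<subseteq> mcarrier (cyclic (module_of poly_rep) (det X ^ l))"
    unfolding cyclic_def by (auto simp flip: act(1))
qed

lemma psubst_det_X: "psubst (\<lambda>k. if k = (2, 1) then 0 else 1) (det X) = 1"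
  by (simp add: det_X psubst_diff psubst_mult)

theorem cyclic_det_iso:
  assumes "irreducible_highest_weight_module (of_nat l) (of_nat l) M"
  shows "cyclic (module_of poly_rep) (det X ^ l) \<cong>\<^sub>U M"
proof -
  let ?W = "mcarrier (cyclic (module_of poly_rep) (det X ^ l))"
  interpret derivation_submodule UNIV polarization ?W by (rule derivation_submodule_cyclic)
  have pow: "of_nat l * det X ^ (l - 1) * det X = of_nat l * det X ^ l" by (cases l) (simp_all add: mult.commute)
  have "nat_hw_vector Wmod (det X ^ l) l l"
  proof (rule hw_vectorI)
    show "det X ^ l \<in> ?W" by (rule poly_rep.in_cyclic) simp
    have "psubst (\<lambda>k. if k = (2, 1) then 0 else 1) (det X ^ l) = (1 :: (2 \<times> 2) cpoly)"
      by (simp add: psubst_power psubst_det_X)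
    then show "det X ^ l \<noteq> 0" by (metis psubst_zero zero_neq_one)
    show "(polarization 2 1 ^^ 1) (det X ^ l) = 0" by (simp add: polarization_power polarization_det)
  qed (simp_all add: polarization_power polarization_det pow del: One_nat_def)
  then interpret nat_hw_vector Wmod "det X ^ l" l l .
  have "module_of (hw_model l l) \<cong>\<^sub>U Wmod"
  proof (rule iso_hw_model)
    fix N assume "submodule N Wmod" "det X ^ l \<in> N"
    then show "N = mcarrier Wmod" using cyclic_generated[of N "det X ^ l"] by (simp only: cyclic_poly_rep[symmetric])
  qed
  then have "cyclic (module_of poly_rep) (det X ^ l) \<cong>\<^sub>U module_of (hw_model l l)"
    unfolding cyclic_poly_rep[symmetric] by (rule lmod_iso_sym)
  then show ?thesis using iso_hw_model_if_irreducible[OF assms] lmod_iso_trans by blast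
qed

text \<open>An injective intertwiner pulls the commutation relations back from
  \<open>\<sigma>\<close> to \<open>\<rho>\<close>. This gives at once that \<open>\<rho>\<close> is
  a representation and that it is isomorphic to its image.\<close>

lemma rep_transport:
  fixes T :: "('b \<Rightarrow>\<^sub>0 complex) \<Rightarrow> ('c \<Rightarrow>\<^sub>0 complex)"
  assumes \<sigma>: "is_rep (C, \<sigma>)"
    and T_add: "\<And>v w. T (v + w) = T v + T w" and T_scale: "\<And>c v. T (pscale c v) = pscale c (T v)"
    and T_inj: "inj_on T (span_of B)" and T_span: "\<And>v. v \<in> span_of B \<Longrightarrow> T v \<in> span_of C"
    and \<rho>_add: "\<And>i j v w. \<rho> i j (v + w) = \<rho> i j v + \<rho> i j w"
    and \<rho>_scale: "\<And>i j c v. \<rho> i j (pscale c v) = pscale c (\<rho> i j v)"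
    and \<rho>_span: "\<And>i j v. v \<in> span_of B \<Longrightarrow> \<rho> i j v \<in> span_of B"
    and T_\<rho>: "\<And>i j v. v \<in> span_of B \<Longrightarrow> T (\<rho> i j v) = \<sigma> i j (T v)"
  shows "submodule (T ` span_of B) (module_of (C, \<sigma>))"
    and "module_of (B, \<rho>) \<cong>\<^sub>U \<lparr>mcarrier = T ` span_of B, mact = U_action \<sigma>\<rparr>"
proof -
  interpret C: gl2_module "module_of (C, \<sigma>)"
    by (rule gl2_module.intro) (rule left_module_module_of[OF \<sigma>])
  have sel: "mcarrier (module_of (C, \<sigma>)) = span_of C" "C.act = U_action \<sigma>"
    by (simp_all add: module_of_def)
  have T_diff: "T (v - w) = T v - T w" for v w
    using T_add[of "v - w" w] by simp
  have T_zero: "T 0 = 0" using T_add[of 0 0] by simp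
  show sub: "submodule (T ` span_of B) (module_of (C, \<sigma>))"
  proof (rule C.submoduleI)
    show "T ` span_of B \<subseteq> mcarrier (module_of (C, \<sigma>))" using T_span by (auto simp: sel)
    show "0 \<in> T ` span_of B" by (rule image_eqI[of _ _ 0]) (simp_all add: T_zero)
    show "v + w \<in> T ` span_of B" if "v \<in> T ` span_of B" "w \<in> T ` span_of B" for v w
      using that by (auto simp: T_add[symmetric] intro!: imageI span_of_add)
    show "C.act (Uconst c) v \<in> T ` span_of B" if "v \<in> T ` span_of B" for c v
    proof -
      obtain x where x: "x \<in> span_of B" "v = T x" using \<open>v \<in> T ` span_of B\<close> by blast
      then have "C.act (Uconst c) v = T (pscale c x)"
        by (simp add: sel U_action_Uconst[OF \<sigma>] T_span T_scale)
      then show ?thesis using span_of_pscale[OF x(1)] by blast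
    qed
    show "C.act (gen i j) v \<in> T ` span_of B" if "v \<in> T ` span_of B" for i j v
    proof -
      obtain x where x: "x \<in> span_of B" "v = T x" using \<open>v \<in> T ` span_of B\<close> by blast
      then have "C.act (gen i j) v = T (\<rho> i j x)"
        by (simp add: sel U_action_gen[OF \<sigma>] T_span T_\<rho>)
      then show ?thesis using \<rho>_span[OF x(1)] by blast
    qed
  qed
  have comm: "\<rho> i j (\<rho> k l v) - \<rho> k l (\<rho> i j v) = (if j = k then \<rho> i l v else 0) - (if l = i then \<rho> k j v else 0)"
    if v: "v \<in> span_of B" for i j k l v
  proof (rule inj_onD[OF T_inj])
    show "T (\<rho> i j (\<rho> k l v) - \<rho> k l (\<rho> i j v)) = T ((if j = k then \<rho> i l v else 0) - (if l = i then \<rho> k j v else 0))"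
      using rep_commutator[OF \<sigma> T_span[OF v], of i j k l]
      by (simp add: T_diff T_\<rho> v \<rho>_span T_zero split: if_splits)
    have diff: "x - y \<in> span_of B" if "x \<in> span_of B" "y \<in> span_of B" for x y :: "'b \<Rightarrow>\<^sub>0 complex"
      using span_of_add[OF that(1) span_of_uminus[OF that(2)]] by simp
    show "\<rho> i j (\<rho> k l v) - \<rho> k l (\<rho> i j v) \<in> span_of B"
      "(if j = k then \<rho> i l v else 0) - (if l = i then \<rho> k j v else 0) \<in> span_of B"
      using v \<rho>_span by (auto intro!: diff span_of_uminus)
  qed
  have rep: "is_rep (B, \<rho>)"
    unfolding is_rep_def prod.case by (intro conjI allI ballI \<rho>_span \<rho>_add \<rho>_scale comm)
  interpret B: gl2_module "module_of (B, \<rho>)"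
    by (rule gl2_module.intro) (rule left_module_module_of[OF rep])
  have selB: "mcarrier (module_of (B, \<rho>)) = span_of B" "B.act = U_action \<rho>"
    by (simp_all add: module_of_def)
  have T_act: "T (B.act r v) = C.act r (T v)" if "v \<in> span_of B" for r v
    using that
  proof (induction r arbitrary: v rule: Ugl2_induct)
    case (Uconst c)
    then show ?case by (simp add: sel(2) selB(2) U_action_Uconst[OF rep] U_action_Uconst[OF \<sigma>] T_scale T_span)
  next
    case (gen i j)
    then show ?case by (simp add: sel(2) selB(2) U_action_gen[OF rep] U_action_gen[OF \<sigma>] T_\<rho> T_span)
  next
    case (add r s)
    then show ?case by (simp add: B.add_act C.add_act sel(1) selB(1) T_add T_span)
  next
    case (mult r s)
    have "B.act s v \<in> span_of B" using B.act_closed[of v s] mult.prems by (simp only: selB(1))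
    then show ?case using mult by (simp add: B.mult_act C.mult_act sel(1) selB(1) T_span)
  qed
  show "module_of (B, \<rho>) \<cong>\<^sub>U \<lparr>mcarrier = T ` span_of B, mact = U_action \<sigma>\<rparr>"
  proof (rule lmod_isoI)
    show "left_module (module_of (B, \<rho>))" by (rule B.left_module)
    show "left_module \<lparr>mcarrier = T ` span_of B, mact = U_action \<sigma>\<rparr>"
      using sub by (simp add: submodule_def module_of_def)
    show "bij_betw T (mcarrier (module_of (B, \<rho>))) (mcarrier \<lparr>mcarrier = T ` span_of B, mact = U_action \<sigma>\<rparr>)"
      using T_inj by (simp add: bij_betw_def selB(1))
    show "T (B.act r v) = mact \<lparr>mcarrier = T ` span_of B, mact = U_action \<sigma>\<rparr> r (T v)"
      if "v \<in> mcarrier (module_of (B, \<rho>))" for r v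
      using T_act that by (simp add: sel(2) selB(1))
  qed (rule T_add)
qed

section \<open>Tensor squares of symmetric powers as polynomials\<close>

text \<open>Polarizations act on row indices only, so each column of variables spans a copy of the
  natural representation.\<close>

definition column :: "2 \<Rightarrow> 2 cpoly \<Rightarrow> (2 \<times> 2) cpoly" where
  "column k = psubst (\<lambda>i. var (i, k))"

definition column_product :: "((2 \<Rightarrow>\<^sub>0 nat) \<times> (2 \<Rightarrow>\<^sub>0 nat) \<Rightarrow>\<^sub>0 complex) \<Rightarrow> (2 \<times> 2) cpoly" where
  "column_product = lin_ext (\<lambda>(m, n). column 1 (basis_vec m) * column 2 (basis_vec n))"

lemma column_product_add: "column_product (f + g) = column_product f + column_product g"
  and column_product_pscale: "column_product (pscale c f) = pscale c (column_product f)"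
  and column_product_zero: "column_product 0 = 0"
  and column_product_basis: "column_product (basis_vec (m, n)) = column 1 (basis_vec m) * column 2 (basis_vec n)"
  by (simp_all add: column_product_def lin_ext_add lin_ext_pscale)

lemma tensor_vec_add_left: "tensor_vec (v + v') w = tensor_vec v w + tensor_vec v' w"
  and tensor_vec_zero_left: "tensor_vec 0 w = 0"
  and tensor_vec_single_left: "tensor_vec (Poly_Mapping.single a c) w = pscale c (lin_ext (\<lambda>b. basis_vec (a, b)) w)"
  by (simp_all add: tensor_vec_def lin_ext_add)

lemma column_product_tensor_vec: "column_product (tensor_vec v w) = column 1 v * column 2 w"
proof (induction v rule: poly_mapping_linear_induct)
  case zero
  then show ?case by (simp add: tensor_vec_zero_left column_product_zero column_def)
next
  case (single a c)
  have "column_product (lin_ext (\<lambda>b. basis_vec (a, b)) w) = column 1 (basis_vec a) * column 2 w"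
  proof (induction w rule: poly_mapping_linear_induct)
    case zero
    then show ?case by (simp add: column_product_zero column_def)
  next
    case (single b e)
    have "Poly_Mapping.single b e = pscale e (basis_vec b)" by simp
    then have "column 2 (Poly_Mapping.single b e) = pscale e (column 2 (basis_vec b))"
      unfolding column_def by (metis psubst_pscale)
    then show ?case
      by (simp only: lin_ext_single column_product_pscale column_product_basis pscale_mult_right)
  next
    case (add f g)
    then show ?case by (simp add: lin_ext_add column_product_add column_def psubst_add distrib_left)
  qed
  moreover have "column 1 (Poly_Mapping.single a c) = pscale c (column 1 (basis_vec a))"
    using psubst_pscale[of "\<lambda>i. var (i, 1)" c "basis_vec a"] by (simp add: column_def)
  ultimately show ?case
    by (simp only: tensor_vec_single_left column_product_pscale pscale_mult_left)
next
  case (add f g)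
  then show ?case by (simp add: tensor_vec_add_left column_product_add column_def psubst_add distrib_right)
qed

text \<open>The column map is multiplicative, so both sides obey the same Leibniz rule and only
  variables matter. The operator of \<open>sym_rep\<close> does not depend on \<open>l\<close>,
  which is therefore arbitrary.\<close>

lemma polarization_column:
  "polarization i j (column k f) = column k (snd (sym_rep l natural_rep) i j f)"
proof (induction f rule: cpoly_induct)
  interpret \<sigma>: derivation "snd (sym_rep l natural_rep) i j" by (rule derivation_sym_rep)
  {
    case (const c)
    then show ?case by (simp add: column_def polarization_const)
  next
    case (var_mult b f)
    have "snd (sym_rep l natural_rep) i j (var b) = (if b = j then var i else 0)"
      by (simp add: sym_rep_var natural_rep_def lookup_single)
    then show ?case
      using var_mult
      by (simp add: column_def psubst_mult psubst_add polarization_mult \<sigma>.mult)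
  next
    case (add f g)
    then show ?case by (simp add: column_def psubst_add polarization_add \<sigma>.add)
  }
qed

lemma column_basis:
  "column k (basis_vec m) = var (1, k) ^ Poly_Mapping.lookup m 1 * var (2, k) ^ Poly_Mapping.lookup m 2"
proof -
  have "monomial_value (\<lambda>i. var (i, k)) m = (\<Prod>i\<in>UNIV. var (i, k) ^ Poly_Mapping.lookup m i)"
    by (rule monomial_value_superset) auto
  then show ?thesis by (simp add: column_def psubst_def UNIV_2)
qed

definition matrix_monomial :: "nat \<Rightarrow> nat \<Rightarrow> nat \<Rightarrow> nat \<Rightarrow> (2 \<times> 2) cpoly" where
  "matrix_monomial a b c e = x11 ^ a * x21 ^ b * x12 ^ c * x22 ^ e"

lemma matrix_monomial_single:
  "matrix_monomial a b c e = basis_vec (Poly_Mapping.single (1, 1) a + Poly_Mapping.single (2, 1) b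
     + Poly_Mapping.single (1, 2) c + Poly_Mapping.single (2, 2) e)"
  by (simp add: matrix_monomial_def var_power mult_single)

lemma column_product_basis_eq:
  "column_product (basis_vec (m, n)) = matrix_monomial (Poly_Mapping.lookup m 1) (Poly_Mapping.lookup m 2)
     (Poly_Mapping.lookup n 1) (Poly_Mapping.lookup n 2)"
  by (simp add: column_product_basis column_basis matrix_monomial_def mult.assoc)

lemma lin_ext_basis_inj:
  assumes "inj h"
  shows "inj (lin_ext (\<lambda>b. basis_vec (h b)))"
proof (rule injI)
  have lookup: "Poly_Mapping.lookup (lin_ext (\<lambda>b. basis_vec (h b)) f) (h b) = Poly_Mapping.lookup f b" for f b
    by (induction f rule: poly_mapping_linear_induct)
      (simp_all add: lin_ext_add lookup_add lookup_single when_def inj_eq[OF assms])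
  fix f g assume "lin_ext (\<lambda>b. basis_vec (h b)) f = lin_ext (\<lambda>b. basis_vec (h b)) g"
  then show "f = g" by (intro poly_mapping_eqI) (metis lookup)
qed

text \<open>A pair of exponent vectors becomes one exponent matrix with these two columns, so basis
  vectors go to distinct monomials.\<close>

lemma column_product_inj: "inj column_product"
proof -
  define h where "h = (\<lambda>(m, n). Poly_Mapping.single (1::2, 1::2) (Poly_Mapping.lookup m (1::2)) + Poly_Mapping.single (2, 1) (Poly_Mapping.lookup m 2)
     + Poly_Mapping.single (1, 2) (Poly_Mapping.lookup n (1::2)) + Poly_Mapping.single (2, 2) (Poly_Mapping.lookup n 2 :: nat))"
  have "column_product = lin_ext (\<lambda>b. basis_vec (h b))"
  proof -
    have "(\<lambda>(m, n). column 1 (basis_vec m) * column 2 (basis_vec n)) = (\<lambda>b. basis_vec (h b))"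
      by (intro ext) (simp add: column_product_basis[symmetric] column_product_basis_eq matrix_monomial_single h_def split: prod.splits)
    then show ?thesis by (simp add: column_product_def)
  qed
  moreover have "inj h"
  proof (rule injI)
    fix x y assume eq: "h x = h y"
    obtain m n m' n' where xy: "x = (m, n)" "y = (m', n')" by (metis prod.exhaust)
    have look: "Poly_Mapping.lookup (h (m, n)) (i, k) = Poly_Mapping.lookup (if k = 1 then m else n) i" for m n i k
      using exhaust_2[of i] exhaust_2[of k] by (elim disjE) (simp_all add: h_def lookup_add lookup_single)
    have "Poly_Mapping.lookup m i = Poly_Mapping.lookup m' i" "Poly_Mapping.lookup n i = Poly_Mapping.lookup n' i" for i
      using look[of m n i 1] look[of m' n' i 1] look[of m n i 2] look[of m' n' i 2] eq by (simp_all add: xy)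
    then show "x = y" by (simp add: xy poly_mapping_eqI)
  qed
  ultimately show ?thesis using lin_ext_basis_inj by metis
qed

abbreviation (input) "sym_tensor l \<equiv> tensor_rep (sym_rep l natural_rep) (sym_rep l natural_rep)"

definition bihomogeneous :: "nat \<Rightarrow> (2 \<times> 2) cpoly set" where
  "bihomogeneous l = column_product ` span_of (fst (sym_tensor l))"

lemma fst_sym_tensor: "fst (sym_tensor l) = {m. mono_degree m = l} \<times> {m. mono_degree m = l}"
  by (simp add: tensor_rep_def sym_rep_def natural_rep_def)

lemma span_of_tensor_vec: "v \<in> span_of A \<Longrightarrow> w \<in> span_of B \<Longrightarrow> tensor_vec v w \<in> span_of (A \<times> B)"
  unfolding tensor_vec_def
  by (intro span_of_lin_ext) (auto simp: span_of_def)

text \<open>The action on tensors turns into the Leibniz rule for a product of a polynomial in the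
  first column and one in the second.\<close>

lemma sym_tensor_transport:
  "submodule (bihomogeneous l) (module_of poly_rep)"
  "module_of (sym_tensor l) \<cong>\<^sub>U \<lparr>mcarrier = bihomogeneous l, mact = U_action polarization\<rparr>"
proof -
  let ?A = "{m :: 2 \<Rightarrow>\<^sub>0 nat. mono_degree m = l}"
  let ?\<sigma> = "snd (sym_rep l natural_rep)" and ?\<rho> = "snd (sym_tensor l)"
  have eq: "sym_tensor l = (?A \<times> ?A, ?\<rho>)" by (simp add: fst_sym_tensor[symmetric])
  have sym: "is_rep (?A, ?\<sigma>)"
    using is_rep_sym_rep[OF is_rep_natural_rep, of l] by (simp add: sym_rep_def natural_rep_def)
  have \<rho>: "?\<rho> i j = lin_ext (\<lambda>(a, b). tensor_vec (?\<sigma> i j (basis_vec a)) (basis_vec b) + tensor_vec (basis_vec a) (?\<sigma> i j (basis_vec b)))" for i j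
    by (simp add: tensor_rep_def)
  have T\<rho>: "column_product (?\<rho> i j v) = polarization i j (column_product v)" for i j v
  proof (induction v rule: poly_mapping_linear_induct)
    case zero
    then show ?case using polarization_const[of i j 0] by (simp add: \<rho> column_product_zero)
  next
    case (single b c)
    obtain m n where b: "b = (m, n)" by fastforce
    have "Poly_Mapping.single b c = pscale c (basis_vec b)" by simp
    moreover have "column_product (?\<rho> i j (basis_vec b)) = polarization i j (column_product (basis_vec b))"
      unfolding b column_product_basis polarization_mult polarization_column[of _ _ _ _ l]
      by (simp add: \<rho> column_product_add column_product_tensor_vec)
    ultimately show ?case
      using derivation.scale[OF derivation_polarization[of i j]]
      by (simp only: \<rho> lin_ext_pscale column_product_pscale)
  next
    case (add f g)
    then show ?case by (simp add: \<rho> lin_ext_add column_product_add polarization_add)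
  qed
  have inj: "inj_on column_product (span_of (?A \<times> ?A))"
    using column_product_inj by (rule inj_on_subset) simp
  have span: "column_product v \<in> span_of UNIV" for v
    by (simp add: span_of_def)
  have add: "?\<rho> i j (v + w) = ?\<rho> i j v + ?\<rho> i j w" and scale: "?\<rho> i j (pscale c v) = pscale c (?\<rho> i j v)" for i j c v w
    by (simp_all add: \<rho> lin_ext_add lin_ext_pscale)
  have stable: "?\<rho> i j v \<in> span_of (?A \<times> ?A)" if v: "v \<in> span_of (?A \<times> ?A)" for i j v
    unfolding \<rho>
  proof (rule span_of_lin_ext)
    fix x assume "x \<in> Poly_Mapping.keys v"
    then obtain m n where x: "x = (m, n)" "m \<in> ?A" "n \<in> ?A" using v by (auto simp: span_of_def)
    then have "basis_vec m \<in> span_of ?A" "basis_vec n \<in> span_of ?A" by (simp_all add: span_of_def)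
    then show "(case x of (a, b) \<Rightarrow> tensor_vec (?\<sigma> i j (basis_vec a)) (basis_vec b) + tensor_vec (basis_vec a) (?\<sigma> i j (basis_vec b)))
        \<in> span_of (?A \<times> ?A)"
      unfolding x prod.case by (intro span_of_add span_of_tensor_vec rep_span[OF sym])
  qed
  note transport = rep_transport[where T = column_product and \<rho> = ?\<rho> and B = "?A \<times> ?A" and C = UNIV and \<sigma> = polarization]
  show "submodule (bihomogeneous l) (module_of poly_rep)"
    unfolding module_of_poly_rep bihomogeneous_def fst_sym_tensor
    by (rule transport(1))
      (fact is_rep_poly_rep column_product_add column_product_pscale inj add scale stable | rule span T\<rho>)+
  have "module_of (?A \<times> ?A, ?\<rho>) \<cong>\<^sub>U \<lparr>mcarrier = column_product ` span_of (?A \<times> ?A), mact = U_action polarization\<rparr>"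
    by (rule transport(2))
      (fact is_rep_poly_rep column_product_add column_product_pscale inj add scale stable | rule span T\<rho>)+
  then show "module_of (sym_tensor l) \<cong>\<^sub>U \<lparr>mcarrier = bihomogeneous l, mact = U_action polarization\<rparr>"
    by (simp only: eq[symmetric] bihomogeneous_def fst_sym_tensor)
qed

lemma matrix_monomial_bihomogeneous:
  assumes "a + b = l" "c + e = l"
  shows "matrix_monomial a b c e \<in> bihomogeneous l"
proof -
  let ?m = "Poly_Mapping.single (1::2) a + Poly_Mapping.single 2 b" and ?n = "Poly_Mapping.single (1::2) c + Poly_Mapping.single 2 e"
  have "matrix_monomial a b c e = column_product (basis_vec (?m, ?n))"
    unfolding column_product_basis_eq by (simp add: lookup_add lookup_single)
  moreover have "basis_vec (?m, ?n) \<in> span_of (fst (sym_tensor l))"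
    unfolding fst_sym_tensor using assms by (simp add: span_of_def mono_degree_add)
  ultimately show ?thesis unfolding bihomogeneous_def by blast
qed

lemma bihomogeneous_subset:
  assumes zero: "0 \<in> N" and add: "\<And>f g. f \<in> N \<Longrightarrow> g \<in> N \<Longrightarrow> f + g \<in> N" and scale: "\<And>c f. f \<in> N \<Longrightarrow> const c * f \<in> N"
    and mono: "\<And>a b c e. a + b = l \<Longrightarrow> c + e = l \<Longrightarrow> matrix_monomial a b c e \<in> N"
  shows "bihomogeneous l \<subseteq> N"
proof -
  have "column_product v \<in> N" if "v \<in> span_of (fst (sym_tensor l))" for v
    using that
  proof (induction rule: span_of_induct)
    case (single b c)
    obtain m n where b: "b = (m, n)" by fastforce
    have deg: "mono_degree m = Poly_Mapping.lookup m 1 + Poly_Mapping.lookup m 2" for m :: "2 \<Rightarrow>\<^sub>0 nat"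
      using mono_degree_superset[of UNIV m] by (simp add: sum_2)
    have "column_product (basis_vec (m, n)) \<in> N"
      unfolding column_product_basis_eq using single deg by (intro mono) (auto simp: b fst_sym_tensor)
    moreover have "column_product (Poly_Mapping.single b c) = const c * column_product (basis_vec (m, n))"
      using column_product_pscale[of c "basis_vec b"] by (simp add: b pscale_eq_const_mult)
    ultimately show ?case using scale by simp
  qed (simp_all add: column_product_zero column_product_add zero add)
  then show ?thesis by (auto simp: bihomogeneous_def)
qed

section \<open>Generation by powers of the \<alpha>-determinant\<close>

abbreviation "upper \<equiv> x11 * x12"
abbreviation "lower \<equiv> x21 * x22"
abbreviation "diag \<equiv> x11 * x22"
abbreviation "antidiag \<equiv> x12 * x21"

context derivation_submodule
begin

lemma stable_subspace_swap:
  assumes "submodule N Wmod"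
  shows "stable_subspace (\<rho> 1 2) (\<rho> 2 1) N"
proof -
  interpret stable_subspace "\<rho> 2 1" "\<rho> 1 2" N by (rule stable_subspace_submodule[OF assms])
  show ?thesis by unfold_locales (auto intro: zero add scale d e)
qed

end

text \<open>Exchanging the two rows swaps E_12 with E_21, \<open>upper\<close> with
  \<open>lower\<close>, and \<open>diag\<close> with \<open>antidiag\<close>; the last swap is
  harmless because the relations are symmetric in u and v.\<close>

lemma bidegree_submodule:
  assumes "submodule N (module_of poly_rep)"
  shows "bidegree (polarization 2 1) (polarization 1 2) N upper lower diag antidiag"
    and "bidegree (polarization 1 2) (polarization 2 1) N lower upper diag antidiag"
proof -
  have univ: "submodule UNIV (module_of poly_rep)"
    using poly_rep.left_module by (simp add: submodule_def) (simp add: module_of_def poly_rep_def span_of_def)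
  interpret derivation_submodule UNIV polarization UNIV by (rule derivation_submodule_poly_rep[OF univ])
  have N: "submodule N Wmod"
    using assms by (simp add: submodule_def module_of_def)
  show "bidegree (polarization 2 1) (polarization 1 2) N upper lower diag antidiag"
    by (intro bidegree.intro bidegree_axioms.intro stable_subspace_submodule N)
      (simp_all add: polarization_mult mult_ac add.commute)
  show "bidegree (polarization 1 2) (polarization 2 1) N lower upper diag antidiag"
    by (intro bidegree.intro bidegree_axioms.intro stable_subspace_swap N)
      (simp_all add: polarization_mult mult_ac add.commute)
qed

lemma bihomogeneous_subset_submodule:
  assumes N: "submodule N (module_of poly_rep)" and "alpha_det \<alpha> X ^ l \<in> N" and \<alpha>: "cmod \<alpha> \<noteq> 1"
  shows "bihomogeneous l \<subseteq> N"
proof -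
  interpret up: bidegree "polarization 2 1" "polarization 1 2" N upper lower diag antidiag
    by (rule bidegree_submodule(1)[OF N])
  interpret low: bidegree "polarization 1 2" "polarization 2 1" N lower upper diag antidiag
    by (rule bidegree_submodule(2)[OF N])
  have power: "(diag + const \<alpha> * antidiag) ^ l \<in> N" using assms(2) by (simp add: alpha_det_X)
  have ne: "\<alpha> \<noteq> - 1" using \<alpha> by auto
  have up: "upper ^ m * diag ^ i * antidiag ^ j \<in> N" and low: "lower ^ m * diag ^ i * antidiag ^ j \<in> N"
    if "m + i + j = l" for m i j
    using up.monomials_upper[OF up.power_combination[OF power ne] kappa_nonzero[OF \<alpha>] that]
      low.monomials_upper[OF low.power_combination[OF power ne] kappa_nonzero[OF \<alpha>] that] by simp_all
  show ?thesis
  proof (rule bihomogeneous_subset)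
    fix a b c e assume abce: "a + b = l" "c + e = l"
    show "matrix_monomial a b c e \<in> N"
    \<comment> \<open>As a + b = c + e, the excess a - e equals c - b. If it is nonnegative it
      counts factors D; otherwise its negative counts factors D'.\<close>
    proof (cases "a \<ge> e")
      case True
      then obtain m where m: "a = m + e" using le_iff_add by (metis add.commute)
      have "matrix_monomial a b c e = upper ^ m * diag ^ e * antidiag ^ b"
      proof -
        have "c = m + b" using abce m by simp
        then show ?thesis by (simp add: matrix_monomial_def m power_add power_mult_distrib mult_ac)
      qed
      then show ?thesis using up[of m e b] abce m by simp
    next
      case False
      then obtain m where m: "e = m + a" using le_iff_add by (metis add.commute nat_le_linear)
      have "matrix_monomial a b c e = lower ^ m * diag ^ a * antidiag ^ c"
      proof -
        have "b = m + c" using abce m by simp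
        then show ?thesis by (simp add: matrix_monomial_def m power_add power_mult_distrib mult_ac)
      qed
      then show ?thesis using low[of m a c] abce m by simp
    qed
  qed (rule up.zero up.add up.scale; assumption)+
qed

lemma bihomogeneous_upper_alpha_det:
  assumes "m + s = l"
  shows "upper ^ m * alpha_det \<alpha> X ^ s \<in> bihomogeneous l"
proof -
  interpret bidegree "polarization 2 1" "polarization 1 2" "bihomogeneous l" upper lower diag antidiag
    by (rule bidegree_submodule(1)[OF sym_tensor_transport(1)])
  have "upper ^ m * alpha_det \<alpha> X ^ s
      = (\<Sum>i\<le>s. const (of_nat (s choose i) * \<alpha> ^ (s - i)) * matrix_monomial (m + i) (s - i) (m + (s - i)) i)"
    by (simp only: alpha_det_X binomial_ring sum_distrib_left const_mult const_of_nat const_power power_mult_distrib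
        matrix_monomial_def power_add mult_ac)
  also have "\<dots> \<in> bihomogeneous l"
    using assms by (intro sum scale matrix_monomial_bihomogeneous) auto
  finally show ?thesis .
qed

lemma mcarrier_cyclic_alpha_det:
  assumes "cmod \<alpha> \<noteq> 1"
  shows "mcarrier (cyclic (module_of poly_rep) (alpha_det \<alpha> X ^ l)) = bihomogeneous l"
proof
  show "mcarrier (cyclic (module_of poly_rep) (alpha_det \<alpha> X ^ l)) \<subseteq> bihomogeneous l"
    using bihomogeneous_upper_alpha_det[of 0 l l \<alpha>]
    by (intro poly_rep.cyclic_subset sym_tensor_transport(1)) simp
  show "bihomogeneous l \<subseteq> mcarrier (cyclic (module_of poly_rep) (alpha_det \<alpha> X ^ l))"
    by (rule bihomogeneous_subset_submodule[OF poly_rep.cyclic_submodule poly_rep.in_cyclic assms]) simp_all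
qed

theorem cyclic_alpha_det_iso:
  assumes "cmod \<alpha> \<noteq> 1"
  shows "cyclic (module_of poly_rep) (alpha_det \<alpha> X ^ l) \<cong>\<^sub>U module_of (sym_tensor l)"
proof (rule lmod_iso_sym)
  have "cyclic (module_of poly_rep) (alpha_det \<alpha> X ^ l) = \<lparr>mcarrier = bihomogeneous l, mact = U_action polarization\<rparr>"
    by (subst cyclic_poly_rep) (simp add: mcarrier_cyclic_alpha_det[OF assms])
  then show "module_of (sym_tensor l) \<cong>\<^sub>U cyclic (module_of poly_rep) (alpha_det \<alpha> X ^ l)"
    using sym_tensor_transport(2)[of l] by simp
qed

text \<open>D has weight (2, 0) and det has weight (1, 1), so D^(l - s) det^s has weight (2 l - s,
  s). That these vectors generate is shown by passing from \<alpha> = -1 to \<alpha> = 0.\<close>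

theorem sym_tensor_iso:
  assumes irr: "\<And>a b. b \<le> a \<Longrightarrow> irreducible_highest_weight_module (of_nat a) (of_nat b) (M a b)"
  shows "module_of (sym_tensor l) \<cong>\<^sub>U direct_sum {0..l} (\<lambda>s. M (2 * l - s) s)"
proof -
  interpret derivation_submodule UNIV polarization "bihomogeneous l"
    by (rule derivation_submodule_poly_rep[OF sym_tensor_transport(1)])
  interpret \<rho>: derivation "polarization i j" for i j by (rule derivation_polarization)
  let ?w = "\<lambda>s. upper ^ (l - s) * det X ^ s"
  have "Wmod \<cong>\<^sub>U direct_sum {0..l} (\<lambda>s. M (2 * l - s) s)"
  proof (rule iso_direct_sum)
    show "left_module Wmod" by (rule left_module_W)
    show "nat_hw_vector Wmod (?w s) (2 * l - s) s" if "s \<in> {0..l}" for s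
    proof (rule hw_vectorI)
      have s: "s \<le> l" using that by simp
      show "?w s \<in> bihomogeneous l"
        using bihomogeneous_upper_alpha_det[of "l - s" s l "- 1"] s by (simp add: alpha_det_minus_one)
      have "psubst (\<lambda>k. if k = (2, 1) then 0 else 1) (?w s) = (1 :: (2 \<times> 2) cpoly)"
        by (simp add: psubst_mult psubst_power psubst_det_X)
      then show "?w s \<noteq> 0" by (metis psubst_zero zero_neq_one)
      have upper: "polarization 1 2 upper = 0" "polarization 1 1 upper = 2 * upper" "polarization 2 2 upper = 0"
        by (simp_all add: \<rho>.mult)
      have pow: "of_nat n * f ^ (n - 1) * f = of_nat n * f ^ n" for n and f :: "(2 \<times> 2) cpoly"
        by (cases n) (simp_all add: mult_ac)
      have pow2: "of_nat n * f ^ (n - 1) * (2 * f) = of_nat (2 * n) * f ^ n" for n and f :: "(2 \<times> 2) cpoly"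
        by (cases n) (simp_all add: algebra_simps)
      have det: "polarization 1 1 (det X) = det X" "polarization 2 2 (det X) = det X"
        by (simp_all add: polarization_det)
      show "polarization 1 2 (?w s) = 0"
        by (simp add: \<rho>.mult[of 1 2 "upper ^ (l - s)"] \<rho>.power upper polarization_det)
      have "polarization 1 1 (?w s) = of_nat (2 * (l - s)) * ?w s + of_nat s * ?w s"
        unfolding \<rho>.mult[of 1 1 "upper ^ (l - s)"] \<rho>.power upper det pow pow2
        by (simp only: mult_ac)
      moreover have "2 * l - s = 2 * (l - s) + s" using s by simp
      ultimately show "polarization 1 1 (?w s) = of_nat (2 * l - s) * ?w s"
        by (simp only: of_nat_add distrib_right)
      show "polarization 2 2 (?w s) = of_nat s * ?w s"
        unfolding \<rho>.mult[of 2 2 "upper ^ (l - s)"] \<rho>.power upper det pow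
        by (simp add: mult_ac)
      show "s \<le> 2 * l - s" using s by simp
      \<comment> \<open>E_21 sends \<open>upper\<close> to the permanent, then to twice
        \<open>lower\<close>, then to 0.\<close>
      have "(polarization 2 1 ^^ 3) upper = 0"
        using \<rho>.const[of 2 1 2] by (simp add: numeral_3_eq_3 \<rho>.mult \<rho>.add const_numeral)
      moreover have "(polarization 2 1 ^^ 1) (det X) = 0" by (simp add: polarization_det)
      ultimately show "(polarization 2 1 ^^ (((l - s) * 3 + 1) + (s * 1 + 1))) (?w s) = 0"
        by (intro \<rho>.nilpotent_mult \<rho>.nilpotent_power)
    qed
    show "irreducible_highest_weight_module (of_nat (2 * l - s)) (of_nat s) (M (2 * l - s) s)" if "s \<in> {0..l}" for s
      using that by (intro irr) auto
    show "inj_on (\<lambda>s. (2 * l - s) * (2 * l - s) + s * s + (2 * l - s - s)) {0..l}"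
      by (rule inj_on_subset[OF casimir_weight_inj]) auto
    fix N assume N: "submodule N Wmod" and w: "\<And>s. s \<in> {0..l} \<Longrightarrow> ?w s \<in> N"
    have N': "submodule N (module_of poly_rep)"
      unfolding module_of_poly_rep by (rule submodule_trans[OF N])
    interpret N: bidegree "polarization 2 1" "polarization 1 2" N upper lower diag antidiag
      by (rule bidegree_submodule(1)[OF N'])
    \<comment> \<open>The hypothesis on the D^m det^(l - m) is the input of
      \<open>N.monomials_upper\<close> at \<alpha> = -1; of its output one monomial
      suffices.\<close>
    have "upper ^ 0 * diag ^ l * antidiag ^ 0 \<in> N"
    proof (rule N.monomials_upper)
      show "upper ^ m * (diag + const (- 1) * antidiag) ^ (l - m) \<in> N" if "m \<le> l" for m
        using w[of "l - m"] that by (simp add: det_X const_uminus)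
      show "kappa m (l - m) (- 1) \<noteq> 0" for m by (rule kappa_minus_one_nonzero)
    qed simp
    \<comment> \<open>u^l is the power of the \<alpha>-determinant at 0, off the unit circle, hence
      a generator.\<close>
    then have "alpha_det 0 X ^ l \<in> N" by (simp add: alpha_det_X)
    then have "bihomogeneous l \<subseteq> N" by (rule bihomogeneous_subset_submodule[OF N']) simp
    then show "N = mcarrier Wmod" using N by (simp add: submodule_def)
  qed simp
  then show ?thesis by (rule lmod_iso_trans[OF sym_tensor_transport(2)])
qed

theorem corollary4p4:
  fixes l :: nat
    and M :: "nat \<Rightarrow> nat \<Rightarrow> (Ugl2, 'm::ab_group_add) lmod"
  assumes "l > 0"
    and "\<And>\<mu>\<^sub>1 \<mu>\<^sub>2. \<mu>\<^sub>2 \<le> \<mu>\<^sub>1 \<Longrightarrow> irreducible_highest_weight_module (of_nat \<mu>\<^sub>1) (of_nat \<mu>\<^sub>2) (M \<mu>\<^sub>1 \<mu>\<^sub>2)"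
  shows "(\<forall>\<alpha>::complex. cmod \<alpha> \<noteq> 1 \<longrightarrow>
            cyclic (module_of poly_rep) (alpha_det \<alpha> X ^ l)
              \<cong>\<^sub>U module_of (tensor_rep (sym_rep l natural_rep) (sym_rep l natural_rep)) \<and>
            module_of (tensor_rep (sym_rep l natural_rep) (sym_rep l natural_rep))
              \<cong>\<^sub>U direct_sum {0..l} (\<lambda>s. M (2 * l - s) s))
       \<and> (cyclic (module_of poly_rep) (per X ^ l)
              \<cong>\<^sub>U direct_sum {0..l div 2} (\<lambda>j. M (2 * l - 2 * j) (2 * j)) \<and>
          direct_sum {0..l div 2} (\<lambda>j. M (2 * l - 2 * j) (2 * j))
              \<cong>\<^sub>U module_of (sym_rep l (sym_rep 2 natural_rep)))
       \<and> (mcarrier (cyclic (module_of poly_rep) (det X ^ l)) = {const c * det X ^ l | c. True} \<and>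
          cyclic (module_of poly_rep) (det X ^ l) \<cong>\<^sub>U M l l)"
proof (intro conjI allI impI)
  note irr = assms(2)
  fix \<alpha> :: complex assume \<alpha>: "cmod \<alpha> \<noteq> 1"
  show "cyclic (module_of poly_rep) (alpha_det \<alpha> X ^ l) \<cong>\<^sub>U module_of (sym_tensor l)"
    by (rule cyclic_alpha_det_iso[OF \<alpha>])
  show "module_of (sym_tensor l) \<cong>\<^sub>U direct_sum {0..l} (\<lambda>s. M (2 * l - s) s)"
    by (rule sym_tensor_iso[OF irr])
next
  note irr = assms(2)
  show "cyclic (module_of poly_rep) (per X ^ l) \<cong>\<^sub>U direct_sum {0..l div 2} (\<lambda>j. M (2 * l - 2 * j) (2 * j))"
    by (rule cyclic_per_iso[OF irr])
  show "direct_sum {0..l div 2} (\<lambda>j. M (2 * l - 2 * j) (2 * j)) \<cong>\<^sub>U module_of (sym_rep l (sym_rep 2 natural_rep))"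
    by (rule lmod_iso_sym[OF sym_sym_iso[OF irr]])
  show "mcarrier (cyclic (module_of poly_rep) (det X ^ l)) = {const c * det X ^ l | c. True}"
    by (rule mcarrier_cyclic_det)
  show "cyclic (module_of poly_rep) (det X ^ l) \<cong>\<^sub>U M l l"
    by (rule cyclic_det_iso[OF irr]) simp
qed

end
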